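(* Let $\Gamma_{13}$ be the simple graph on the $26$ vertices $a_1,b_1,a_2,b_2,\dots,a_{13},b_{13}$ in which, for $c,c'\in\{a,b\}$, there is an edge between $c_i$ and $c'_j$ if and only if $|i-j|=1$. Let $\Gamma$ be the graph obtained from $\Gamma_{13}$ by adding the edges of the $5$-cycle $a_1-a_4-a_7-a_{10}-a_{13}-a_1$. Let $W_{13}$ and $W$ be the right-angled Coxeter groups with defining graphs $\Gamma_{13}$ and $\Gamma$, respectively. Then $W$ and $W_{13}$ are not sublinear biLipschitz equivalent.
   Context: The right-angled Coxeter group with defining graph $\Gamma$ is generated by the vertices of $\Gamma$, subject to $v^2=1$ for every vertex $v$ and $vw=wv$ for every edge $\{v,w\}$. For pointed proper geodesic metric spaces $X,Y$ (basepoints $\mathfrak o$, $\Vert x\Vert=d(x,\mathfrak o)$), $L\ge1$ and a concave nondecreasing function $\theta\colon[0,\infty)\to[1,\infty)$ with $\theta(r)/r\to0$, an $(L,\theta)$-sublinear biLipschitz equivalence is a map $\Phi\colon X\to Y$ such that for all $x_1,x_2\in X$, $$\tfrac1L d(x_1,x_2)-\theta(\max(\Vert x_1\Vert,\Vert x_2\Vert))\le d(\Phi(x_1),\Phi(x_2))\le L d(x_1,x_2)+\theta(\max(\Vert x_1\Vert,\Vert x_2\Vert)),$$ and, for some $D\ge0$, every $y\in Y$ satisfies $d(y,\Phi(X))\le D\,\theta(\Vert y\Vert)$. Two finitely generated groups are sublinear biLipschitz equivalent if there is an $(L,\theta)$-sublinear biLipschitz equivalence, for some $L$ and some such $\theta$,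 between their Cayley graphs with respect to finite generating sets (based at the identity). *)

theory Defs
  imports "HOL-Analysis.Analysis" "HOL-Algebra.Generated_Groups"
begin

section \<open>Groups given by generators and relations\<close>

text \<open>The letter \<open>(v, True)\<close> stands for the generator \<open>v\<close>, and \<open>(v, False)\<close> for its formal inverse.\<close>

type_synonym 'v word = "('v \<times> bool) list"

definition words :: "'v set \<Rightarrow> 'v word set" where
  "words V = lists (V \<times> UNIV)"

text \<open>
  The least congruence on the monoid of words that cancels formal inverses and contains
  \<open>Rels\<close>; a pair \<open>(p, q) \<in> Rels\<close> is the defining relation \<open>p = q\<close>.
\<close>

inductive pres_eq :: "'v set \<Rightarrow> ('v word \<times> 'v word) set \<Rightarrow> 'v word \<Rightarrow> 'v word \<Rightarrow> bool"
  for V :: "'v set" and Rels :: "('v word \<times> 'v word) set" where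
  cancel: "v \<in> V \<Longrightarrow> pres_eq V Rels [(v, b), (v, \<not> b)] []"
| rels: "(p, q) \<in> Rels \<Longrightarrow> p \<in> words V \<Longrightarrow> q \<in> words V \<Longrightarrow> pres_eq V Rels p q"
| refl: "x \<in> words V \<Longrightarrow> pres_eq V Rels x x"
| sym: "pres_eq V Rels x y \<Longrightarrow> pres_eq V Rels y x"
| trans: "pres_eq V Rels x y \<Longrightarrow> pres_eq V Rels y z \<Longrightarrow> pres_eq V Rels x z"
| cong: "pres_eq V Rels x x' \<Longrightarrow> pres_eq V Rels y y' \<Longrightarrow> pres_eq V Rels (x @ y) (x' @ y')"

definition pres_class :: "'v set \<Rightarrow> ('v word \<times> 'v word) set \<Rightarrow> 'v word \<Rightarrow> 'v word set" where
  "pres_class V Rels x = {y. pres_eq V Rels x y}"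

definition presented_group :: "'v set \<Rightarrow> ('v word \<times> 'v word) set \<Rightarrow> 'v word set monoid" where
  "presented_group V Rels =
     \<lparr>carrier = pres_class V Rels ` words V,
      mult = (\<lambda>A B. \<Union>x\<in>A. \<Union>y\<in>B. pres_class V Rels (x @ y)),
      one = pres_class V Rels []\<rparr>"

section \<open>Right-angled Coxeter groups\<close>

text \<open>A simple graph is given by its vertex set and its set of edges, the edges being two-element
  sets of vertices.\<close>

definition racg_relations :: "'v set \<Rightarrow> 'v set set \<Rightarrow> ('v word \<times> 'v word) set" where
  "racg_relations V E =
     {([(v, True), (v, True)], []) | v. v \<in> V} \<union>
     {([(v, True), (w, True)], [(w, True), (v, True)]) | v w. {v, w} \<in> E}"

definition racg :: "'v set \<Rightarrow> 'v set set \<Rightarrow> 'v word set monoid" where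
  "racg V E = presented_group V (racg_relations V E)"

section \<open>Cayley graphs as metric graphs\<close>

text \<open>Cells of the geometric realization of a graph, in barycentric coordinates:
  \<open>cell {v}\<close> is the vertex \<open>v\<close>, i.e. the function \<open>indicat_real {v}\<close>, and
  \<open>cell {u, v}\<close> is the closed edge joining \<open>u\<close> and \<open>v\<close>.\<close>

definition cell :: "'v set \<Rightarrow> ('v \<Rightarrow> real) set" where
  "cell e = {x. (\<forall>w. 0 \<le> x w) \<and> (\<forall>w. w \<notin> e \<longrightarrow> x w = 0) \<and> (\<Sum>w\<in>e. x w) = 1}"

definition realization :: "'v set \<Rightarrow> 'v set set \<Rightarrow> ('v \<Rightarrow> real) set" where
  "realization V E = (\<Union>v\<in>V. cell {v}) \<union> (\<Union>e\<in>E. cell e)"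

text \<open>
  \<open>pl_path V E x l y\<close>: there is a piecewise linear path of length \<open>l\<close> from \<open>x\<close> to \<open>y\<close>.
  On an edge \<open>e\<close>, isometric to the unit interval, the distance of two points is the difference of
  their barycentric coordinates with respect to either endpoint \<open>u\<close> of \<open>e\<close>.
\<close>

inductive pl_path ::
  "'v set \<Rightarrow> 'v set set \<Rightarrow> ('v \<Rightarrow> real) \<Rightarrow> real \<Rightarrow> ('v \<Rightarrow> real) \<Rightarrow> bool"
  for V :: "'v set" and E :: "'v set set" where
  const: "x \<in> realization V E \<Longrightarrow> pl_path V E x 0 x"
| step: "pl_path V E x l y \<Longrightarrow> e \<in> E \<Longrightarrow> u \<in> e \<Longrightarrow> y \<in> cell e \<Longrightarrow> z \<in> cell e
          \<Longrightarrow> pl_path V E x (l + \<bar>y u - z u\<bar>) z"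

text \<open>The length metric. It is of interest only for connected graphs; the value \<open>0\<close> for points
  that are not joined by a path is a dummy.\<close>

definition graph_dist :: "'v set \<Rightarrow> 'v set set \<Rightarrow> ('v \<Rightarrow> real) \<Rightarrow> ('v \<Rightarrow> real) \<Rightarrow> real" where
  "graph_dist V E x y = (if \<exists>l. pl_path V E x l y then Inf {l. pl_path V E x l y} else 0)"

definition cayley_edges :: "('g, 'm) monoid_scheme \<Rightarrow> 'g set \<Rightarrow> 'g set set" where
  "cayley_edges G S = {{g, g \<otimes>\<^bsub>G\<^esub> s} | g s. g \<in> carrier G \<and> s \<in> S \<and> s \<noteq> \<one>\<^bsub>G\<^esub>}"

definition cayley_space :: "('g, 'm) monoid_scheme \<Rightarrow> 'g set \<Rightarrow> ('g \<Rightarrow> real) set" where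
  "cayley_space G S = realization (carrier G) (cayley_edges G S)"

definition cayley_dist ::
  "('g, 'm) monoid_scheme \<Rightarrow> 'g set \<Rightarrow> ('g \<Rightarrow> real) \<Rightarrow> ('g \<Rightarrow> real) \<Rightarrow> real" where
  "cayley_dist G S = graph_dist (carrier G) (cayley_edges G S)"

definition cayley_base :: "('g, 'm) monoid_scheme \<Rightarrow> 'g \<Rightarrow> real" where
  "cayley_base G = indicat_real {\<one>\<^bsub>G\<^esub>}"

section \<open>Sublinear biLipschitz equivalence\<close>

definition sublinear_gauge :: "(real \<Rightarrow> real) \<Rightarrow> bool" where
  "sublinear_gauge \<theta> \<longleftrightarrow>
     concave_on {0..} \<theta> \<and> mono_on {0..} \<theta> \<and> (\<forall>r\<ge>0. 1 \<le> \<theta> r) \<and>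
     ((\<lambda>r. \<theta> r / r) \<longlongrightarrow> 0) at_top"

text \<open>The pointed metric spaces are given by a carrier, a distance and a base point.\<close>

definition sublinear_biLipschitz ::
  "real \<Rightarrow> (real \<Rightarrow> real) \<Rightarrow> 'a set \<Rightarrow> ('a \<Rightarrow> 'a \<Rightarrow> real) \<Rightarrow> 'a \<Rightarrow>
   'b set \<Rightarrow> ('b \<Rightarrow> 'b \<Rightarrow> real) \<Rightarrow> 'b \<Rightarrow> ('a \<Rightarrow> 'b) \<Rightarrow> bool" where
  "sublinear_biLipschitz L \<theta> X dX oX Y dY oY \<Phi> \<longleftrightarrow>
     \<Phi> \<in> X \<rightarrow> Y \<and>
     (\<forall>x1\<in>X. \<forall>x2\<in>X.
        1 / L * dX x1 x2 - \<theta> (max (dX x1 oX) (dX x2 oX)) \<le> dY (\<Phi> x1) (\<Phi> x2) \<and>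
        dY (\<Phi> x1) (\<Phi> x2) \<le> L * dX x1 x2 + \<theta> (max (dX x1 oX) (dX x2 oX))) \<and>
     (\<exists>D\<ge>0. \<forall>y\<in>Y. (INF x\<in>X. dY y (\<Phi> x)) \<le> D * \<theta> (dY y oY))"

definition finite_generating_set :: "('g, 'm) monoid_scheme \<Rightarrow> 'g set \<Rightarrow> bool" where
  "finite_generating_set G S \<longleftrightarrow> finite S \<and> S \<subseteq> carrier G \<and> generate G S = carrier G"

definition sublinear_biLipschitz_equivalent ::
  "('g, 'm) monoid_scheme \<Rightarrow> ('h, 'n) monoid_scheme \<Rightarrow> bool" where
  "sublinear_biLipschitz_equivalent G H \<longleftrightarrow>
     (\<exists>S T L \<theta> \<Phi>. finite_generating_set G S \<and> finite_generating_set H T \<and>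
        L \<ge> 1 \<and> sublinear_gauge \<theta> \<and>
        sublinear_biLipschitz L \<theta>
          (cayley_space G S) (cayley_dist G S) (cayley_base G)
          (cayley_space H T) (cayley_dist H T) (cayley_base H) \<Phi>)"

section \<open>The two defining graphs\<close>

text \<open>The vertices \<open>a\<^sub>i\<close> and \<open>b\<^sub>i\<close> are the pairs \<open>(SideA, i)\<close> and \<open>(SideB, i)\<close>.\<close>

datatype side = SideA | SideB

definition V13 :: "(side \<times> nat) set" where
  "V13 = UNIV \<times> {1..13}"

definition E13 :: "(side \<times> nat) set set" where
  "E13 = {{(c, i), (c', j)} | c c' i j. i \<in> {1..13} \<and> j \<in> {1..13} \<and> \<bar>int i - int j\<bar> = 1}"

definition C5 :: "(side \<times> nat) set set" where
  "C5 = {{(SideA, 1), (SideA, 4)}, {(SideA, 4), (SideA, 7)}, {(SideA, 7), (SideA, 10)},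
         {(SideA, 10), (SideA, 13)}, {(SideA, 13), (SideA, 1)}}"

definition W_Gamma13 :: "(side \<times> nat) word set monoid" where
  "W_Gamma13 = racg V13 E13"

definition W_Gamma :: "(side \<times> nat) word set monoid" where
  "W_Gamma = racg V13 (E13 \<union> C5)"

section \<open>Basic properties\<close>

lemma words_simps [simp]:
  "[] \<in> words V" "(a # x) \<in> words V \<longleftrightarrow> fst a \<in> V \<and> x \<in> words V"
  "x @ y \<in> words V \<longleftrightarrow> x \<in> words V \<and> y \<in> words V"
  by (auto simp: words_def mem_Times_iff)

lemma pres_eq_words: "pres_eq V R x y \<Longrightarrow> x \<in> words V \<and> y \<in> words V"
  by (induction rule: pres_eq.induct) auto

lemma pres_class_eq_iff:
  assumes "x \<in> words V"
  shows "pres_class V R x = pres_class V R y \<longleftrightarrow> pres_eq V R x y"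
proof
  assume "pres_class V R x = pres_class V R y"
  then have "pres_eq V R y x"
    using pres_eq.refl[OF assms] by (auto simp: pres_class_def)
  then show "pres_eq V R x y" by (rule pres_eq.sym)
next
  assume "pres_eq V R x y"
  then show "pres_class V R x = pres_class V R y"
    unfolding pres_class_def by (blast intro: pres_eq.sym pres_eq.trans)
qed

lemma presented_group_mult:
  assumes "x \<in> words V" "y \<in> words V"
  shows "pres_class V R x \<otimes>\<^bsub>presented_group V R\<^esub> pres_class V R y = pres_class V R (x @ y)"
proof -
  have "pres_class V R (x' @ y') = pres_class V R (x @ y)"
    if "x' \<in> pres_class V R x" "y' \<in> pres_class V R y" for x' y'
    using that assms pres_eq.cong[of V R x x' y y'] pres_class_eq_iff[of "x @ y" V R "x' @ y'"]
    by (auto simp: pres_class_def)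
  moreover have "x \<in> pres_class V R x" "y \<in> pres_class V R y"
    using assms by (auto simp: pres_class_def pres_eq.refl)
  ultimately have "(\<Union>x'\<in>pres_class V R x. \<Union>y'\<in>pres_class V R y. pres_class V R (x' @ y'))
      = pres_class V R (x @ y)" by blast
  then show ?thesis by (simp add: presented_group_def)
qed

definition inv_word :: "'v word \<Rightarrow> 'v word" where
  "inv_word x = rev (map (\<lambda>(v, b). (v, \<not> b)) x)"

lemma inv_word_words [simp]: "inv_word x \<in> words V \<longleftrightarrow> x \<in> words V"
  by (induction x) (auto simp: inv_word_def)

lemma inv_word_cancel: "x \<in> words V \<Longrightarrow> pres_eq V R (inv_word x @ x) []"
proof (induction x)
  case Nil
  then show ?case by (simp add: inv_word_def pres_eq.refl)
next
  case (Cons a x)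
  obtain v b where a: "a = (v, b)" by (cases a)
  have v: "v \<in> V" and x: "x \<in> words V" using Cons.prems by (auto simp: a)
  have "pres_eq V R ([(v, \<not> b), (v, b)] @ x) ([] @ x)"
    using pres_eq.cong[OF pres_eq.cancel[OF v, of R "\<not> b"] pres_eq.refl[OF x, of R]] by simp
  then have "pres_eq V R (inv_word x @ ([(v, \<not> b), (v, b)] @ x)) (inv_word x @ ([] @ x))"
    using x by (intro pres_eq.cong[OF pres_eq.refl]) auto
  then show ?case
    using pres_eq.trans[OF _ Cons.IH[OF x]] by (simp add: a inv_word_def)
qed

lemma group_presented_group: "group (presented_group V R)"
proof (rule groupI)
  let ?G = "presented_group V R"
  have car: "carrier ?G = pres_class V R ` words V" and
    one: "\<one>\<^bsub>?G\<^esub> = pres_class V R []" by (simp_all add: presented_group_def)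
  show "\<one>\<^bsub>?G\<^esub> \<in> carrier ?G" by (simp add: car one)
  show "p \<otimes>\<^bsub>?G\<^esub> q \<in> carrier ?G" if "p \<in> carrier ?G" "q \<in> carrier ?G" for p q
    using that by (auto simp: car presented_group_mult)
  show "p \<otimes>\<^bsub>?G\<^esub> q \<otimes>\<^bsub>?G\<^esub> r = p \<otimes>\<^bsub>?G\<^esub> (q \<otimes>\<^bsub>?G\<^esub> r)"
    if "p \<in> carrier ?G" "q \<in> carrier ?G" "r \<in> carrier ?G" for p q r
    using that by (auto simp: car presented_group_mult)
  show "\<one>\<^bsub>?G\<^esub> \<otimes>\<^bsub>?G\<^esub> p = p" if "p \<in> carrier ?G" for p
    using that by (auto simp: car one presented_group_mult)
  show "\<exists>q\<in>carrier ?G. q \<otimes>\<^bsub>?G\<^esub> p = \<one>\<^bsub>?G\<^esub>" if p: "p \<in> carrier ?G" for p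
  proof -
    obtain x where x: "x \<in> words V" "p = pres_class V R x" using p by (auto simp: car)
    have "pres_class V R (inv_word x) \<otimes>\<^bsub>?G\<^esub> p = \<one>\<^bsub>?G\<^esub>"
      using x inv_word_cancel[OF x(1), of R]
      by (simp add: one presented_group_mult pres_class_eq_iff)
    then show ?thesis using x by (auto simp: car)
  qed
qed

lemma presented_group_generators:
  assumes "finite V"
  shows "finite_generating_set (presented_group V R) ((\<lambda>v. pres_class V R [(v, True)]) ` V)"
proof -
  let ?G = "presented_group V R" and ?S = "(\<lambda>v. pres_class V R [(v, True)]) ` V"
  interpret group ?G by (rule group_presented_group)
  have car: "carrier ?G = pres_class V R ` words V" and
    one: "\<one>\<^bsub>?G\<^esub> = pres_class V R []" by (simp_all add: presented_group_def)
  have S: "?S \<subseteq> carrier ?G" by (auto simp: car)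
  have inv: "inv\<^bsub>?G\<^esub> (pres_class V R [(v, True)]) = pres_class V R [(v, False)]" if "v \<in> V" for v
  proof (rule inv_equality)
    show "pres_class V R [(v, False)] \<otimes>\<^bsub>?G\<^esub> pres_class V R [(v, True)] = \<one>\<^bsub>?G\<^esub>"
      using pres_eq.cancel[OF that, of R False] that
      by (simp add: one presented_group_mult pres_class_eq_iff)
  qed (use that in \<open>auto simp: car\<close>)
  have "pres_class V R x \<in> generate ?G ?S" if "x \<in> words V" for x
    using that
  proof (induction x)
    case Nil
    then show ?case using generate.one[of ?G ?S] by (simp add: one)
  next
    case (Cons a x)
    obtain v b where a: "a = (v, b)" by (cases a)
    have v: "v \<in> V" and x: "x \<in> words V" using Cons.prems by (auto simp: a)
    have "pres_class V R [(v, b)] \<in> generate ?G ?S"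
    proof (cases b)
      case True
      then show ?thesis using v by (auto intro: generate.incl)
    next
      case False
      then show ?thesis
        using v generate.inv[of "pres_class V R [(v, True)]" ?S ?G] by (auto simp: inv)
    qed
    from generate.eng[OF this Cons.IH[OF x]] show ?case
      using v x by (simp add: a presented_group_mult)
  qed
  then have "carrier ?G \<subseteq> generate ?G ?S" by (auto simp: car)
  moreover have "generate ?G ?S \<subseteq> carrier ?G" using S by (rule generate_incl)
  ultimately show ?thesis using assms S by (auto simp: finite_generating_set_def)
qed

lemma cell_vertex: "cell {v} = {indicat_real {v}}"
  by (auto simp: cell_def indicator_def fun_eq_iff)

lemma pl_path_realization:
  "pl_path V E x l y \<Longrightarrow> x \<in> realization V E \<and> y \<in> realization V E"
  by (induction rule: pl_path.induct) (auto simp: realization_def)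

lemma pl_path_nonneg: "pl_path V E x l y \<Longrightarrow> 0 \<le> l"
  by (induction rule: pl_path.induct) auto

lemma pl_path_trans:
  assumes "pl_path V E y m z" "pl_path V E x l y"
  shows "pl_path V E x (l + m) z"
  using assms(1,2)
proof (induction rule: pl_path.induct)
  case (const y)
  then show ?case by simp
next
  case (step y m z e u w)
  then show ?case
    using pl_path.step[of V E x "l + m" z e u w] by (simp add: add.assoc)
qed

lemma pl_path_edge:
  assumes "e \<in> E" "u \<in> e" "y \<in> cell e" "z \<in> cell e"
  shows "pl_path V E y \<bar>y u - z u\<bar> z"
proof -
  have "pl_path V E y 0 y" using assms by (intro pl_path.const) (auto simp: realization_def)
  from pl_path.step[OF this assms] show ?thesis by simp
qed

lemma pl_path_sym: "pl_path V E x l y \<Longrightarrow> pl_path V E y l x"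
proof (induction rule: pl_path.induct)
  case (const x)
  then show ?case by (rule pl_path.const)
next
  case (step x l y e u z)
  have "pl_path V E z \<bar>z u - y u\<bar> y" using step.hyps by (intro pl_path_edge)
  from pl_path_trans[OF step.IH this] show ?case by (simp add: add.commute abs_minus_commute)
qed

lemma pl_path_coord:
  assumes "pl_path V E x l y" "\<And>e. e \<in> E \<Longrightarrow> card e = 2"
  shows "\<bar>x w - y w\<bar> \<le> l"
  using assms(1)
proof (induction rule: pl_path.induct)
  case (const x)
  then show ?case by simp
next
  case (step x l y e u z)
  obtain a b where e: "e = {a, b}" "a \<noteq> b"
    using assms(2)[OF \<open>e \<in> E\<close>] by (auto simp: card_2_iff)
  have "y a + y b = 1" "z a + z b = 1" and 0: "w \<notin> e \<Longrightarrow> y w = 0" "w \<notin> e \<Longrightarrow> z w = 0"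
    using step.hyps e by (auto simp: cell_def)
  then have "\<bar>y w - z w\<bar> \<le> \<bar>y u - z u\<bar>"
    using \<open>u \<in> e\<close> by (cases "w \<in> e") (auto simp: e(1))
  then show ?case using step.IH by linarith
qed

lemma Metric_space_graph:
  assumes E: "\<And>e. e \<in> E \<Longrightarrow> card e = 2"
    and conn: "\<And>x y. x \<in> realization V E \<Longrightarrow> y \<in> realization V E \<Longrightarrow> \<exists>l. pl_path V E x l y"
  shows "Metric_space (realization V E) (graph_dist V E)"
proof
  have bdd: "bdd_below {l. pl_path V E x l y}" for x y
    by (rule bdd_belowI[of _ 0]) (auto dest: pl_path_nonneg)
  show "0 \<le> graph_dist V E x y" for x y
    by (auto simp: graph_dist_def intro!: cInf_greatest dest: pl_path_nonneg)
  have "pl_path V E x l y \<longleftrightarrow> pl_path V E y l x" for x y l by (blast intro: pl_path_sym)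
  then show "graph_dist V E x y = graph_dist V E y x" for x y
    unfolding graph_dist_def by presburger
  show "graph_dist V E x y = 0 \<longleftrightarrow> x = y"
    if "x \<in> realization V E" "y \<in> realization V E" for x y
  proof
    assume 0: "graph_dist V E x y = 0"
    have "\<bar>x w - y w\<bar> \<le> Inf {l. pl_path V E x l y}" for w
      using conn[OF that] pl_path_coord[OF _ E] by (intro cInf_greatest) auto
    then show "x = y" using 0 conn[OF that] by (auto simp: graph_dist_def fun_eq_iff)
  next
    assume "x = y"
    have *: "pl_path V E x 0 x" using that by (intro pl_path.const)
    then have "Inf {l. pl_path V E x l x} = 0"
      by (intro cInf_eq_minimum) (auto dest: pl_path_nonneg)
    then show "graph_dist V E x y = 0" using * \<open>x = y\<close> by (auto simp: graph_dist_def)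
  qed
  show "graph_dist V E x z \<le> graph_dist V E x y + graph_dist V E y z"
    if "x \<in> realization V E" "y \<in> realization V E" "z \<in> realization V E" for x y z
  proof -
    let ?P = "\<lambda>x y. {l. pl_path V E x l y}"
    have ne: "?P x y \<noteq> {}" "?P y z \<noteq> {}" "?P x z \<noteq> {}" using conn that by auto
    have "Inf (?P x z) \<le> l + m" if "l \<in> ?P x y" "m \<in> ?P y z" for l m
      using that pl_path_trans by (intro cInf_lower bdd) blast
    then have "Inf (?P x z) - l \<le> Inf (?P y z)" if "l \<in> ?P x y" for l
      using that ne(2) by (intro cInf_greatest) (auto simp: diff_le_eq add.commute[of _ l])
    then have "Inf (?P x z) - Inf (?P y z) \<le> Inf (?P x y)"
      using ne(1) by (intro cInf_greatest) (auto simp: algebra_simps)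
    then show ?thesis using ne by (auto simp: graph_dist_def)
  qed
qed

lemma (in group) Metric_space_cayley:
  assumes "finite_generating_set G S"
  shows "Metric_space (cayley_space G S) (cayley_dist G S)"
proof -
  let ?V = "carrier G" and ?E = "cayley_edges G S"
  have S: "S \<subseteq> carrier G" and gen: "generate G S = carrier G"
    using assms by (auto simp: finite_generating_set_def)
  have E: "card e = 2" if e: "e \<in> ?E" for e
  proof -
    obtain g s where "g \<in> carrier G" "s \<in> S" "s \<noteq> \<one>" "e = {g, g \<otimes> s}"
      using e by (auto simp: cayley_edges_def)
    moreover from this have "g \<noteq> g \<otimes> s"
      using S by (metis l_cancel_one' subsetD)
    ultimately show ?thesis by simp
  qed
  define J where "J x y \<longleftrightarrow> (\<exists>l. pl_path ?V ?E x l y)" for x y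
  have J_sym: "J x y \<Longrightarrow> J y x" for x y unfolding J_def by (blast intro: pl_path_sym)
  have J_trans: "J x y \<Longrightarrow> J y z \<Longrightarrow> J x z" for x y z
    unfolding J_def by (blast intro: pl_path_trans)
  have J_edge: "J x y" if e: "e \<in> ?E" "x \<in> cell e" "y \<in> cell e" for e x y
  proof -
    obtain u where "u \<in> e" using E[OF e(1)] by fastforce
    from pl_path_edge[OF e(1) this e(2,3)] show ?thesis unfolding J_def by (rule exI)
  qed
  have J_refl: "J (indicat_real {g}) (indicat_real {g})" if "g \<in> carrier G" for g
  proof -
    have "indicat_real {g} \<in> realization ?V ?E"
      using that by (auto simp: realization_def cell_vertex)
    then show ?thesis unfolding J_def by (intro exI[of _ 0] pl_path.const)
  qed
  have end_cell: "indicat_real {g} \<in> cell e" if e: "e \<in> ?E" "g \<in> e" for e g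
  proof -
    have "finite e" using E[OF e(1)] card.infinite by fastforce
    then have "(\<Sum>w\<in>e. indicat_real {g} w) = 1"
      using e(2) by (simp add: indicator_def of_bool_def)
    then show ?thesis using e(2) by (auto simp: cell_def indicator_def)
  qed
  have step: "J (indicat_real {g}) (indicat_real {g \<otimes> s})" if "g \<in> carrier G" "s \<in> S" for g s
  proof (cases "s = \<one>")
    case True
    then show ?thesis using J_refl that by simp
  next
    case False
    then have "{g, g \<otimes> s} \<in> ?E" using that by (auto simp: cayley_edges_def)
    then show ?thesis by (rule J_edge) (auto intro!: end_cell \<open>{g, g \<otimes> s} \<in> ?E\<close>)
  qed
  have "\<forall>g\<in>carrier G. J (indicat_real {g}) (indicat_real {g \<otimes> h})" if "h \<in> generate G S" for h
    using that
  proof (induction rule: generate.induct)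
    case one
    then show ?case using J_refl by simp
  next
    case (incl s)
    then show ?case using step by blast
  next
    case (inv s)
    show ?case
    proof
      fix g assume g: "g \<in> carrier G"
      have s: "s \<in> carrier G" using inv S by blast
      have "J (indicat_real {g \<otimes> inv s}) (indicat_real {g \<otimes> inv s \<otimes> s})"
        using g s inv by (intro step) auto
      then show "J (indicat_real {g}) (indicat_real {g \<otimes> inv s})"
        using g s J_sym[of "indicat_real {g \<otimes> inv s}" "indicat_real {g}"] by (simp add: m_assoc)
    qed
  next
    case (eng h k)
    then have hk: "h \<in> carrier G" "k \<in> carrier G" by (auto simp: gen)
    show ?case
    proof
      fix g assume g: "g \<in> carrier G"
      have "J (indicat_real {g}) (indicat_real {g \<otimes> h})" using eng g by blast
      moreover have "J (indicat_real {g \<otimes> h}) (indicat_real {g \<otimes> h \<otimes> k})"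
        using eng g hk by blast
      ultimately show "J (indicat_real {g}) (indicat_real {g \<otimes> (h \<otimes> k)})"
        using g hk J_trans by (simp add: m_assoc)
    qed
  qed
  then have base: "J (indicat_real {\<one>}) (indicat_real {h})" if "h \<in> carrier G" for h
    using that gen one_closed l_one by metis
  have "J (indicat_real {\<one>}) x" if "x \<in> realization ?V ?E" for x
    using that unfolding realization_def
  proof (elim UnE UN_E)
    fix v assume "v \<in> carrier G" "x \<in> cell {v}"
    then show ?thesis using base by (simp add: cell_vertex)
  next
    fix e assume e: "e \<in> ?E" "x \<in> cell e"
    then obtain g where g: "g \<in> carrier G" "g \<in> e" by (auto simp: cayley_edges_def)
    then have "J (indicat_real {g}) x" using e by (intro J_edge[of e] end_cell)
    with base[OF g(1)] show ?thesis by (rule J_trans)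
  qed
  then have "J x y" if "x \<in> realization ?V ?E" "y \<in> realization ?V ?E" for x y
    using that J_sym J_trans by blast
  then show ?thesis
    unfolding cayley_space_def cayley_dist_def J_def using E by (intro Metric_space_graph)
qed

end

(*
  A right-angled Coxeter group W is studied through its walls: the wall of the edge from 1 to s is
  crossed exactly by the edges labelled s that issue from the subgroup generated by star s.

  Source. Two non-adjacent vertices of the 5-cycle have only one common neighbour in Gamma. Hence
  along a geodesic in the pentagon subgroup P one finds, at a positive rate, nested walls that are
  far apart outside a bounded neighbourhood of the geodesic, and a path that joins the end points of
  a geodesic of P and avoids a ball of radius r around a point in its middle has length at least
  c r^2. Moreover P is one-ended: two opposite points p, q at distance n from 1 are joined in P by a
  path outside the ball of radius n.

  Target. Every wall of W_13 lies in a product of two infinite subgroups, because the vertices a_i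
  and b_i have the same neighbours. So any two points near a wall are joined by two paths of linear
  length that are far from each other except near their end points.

  Let f be a sublinear biLipschitz equivalence. A geodesic from f(p) to f(q) passes near f(1), since
  otherwise its pull-back would avoid a large ball around 1. The wall crossed there separates f(p)
  from f(q), so the path from p to q outside the ball contains a point u such that f(u) is near this
  wall. The two paths from f(1) to f(u) provided by the product both have to pass near f(m), where m
  is the midpoint of a geodesic from 1 to u; this is a contradiction.
*)
theory Submission
  imports Defs "HOL-Real_Asymp.Real_Asymp"
begin

section \<open>Words and walls\<close>

text \<open>Everything is estimated at one scale \<open>n\<close>: the sublinear error is at most
  \<open>\<eta> * n\<close> for any prescribed \<open>\<eta>\<close>, and the contradiction appears
  for every large \<open>n\<close>. The obstacle is that such an error occurs at each point, so a
  path that is pulled back step by step could become quadratically long, which the lower bound in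
  the source allows. Paths are therefore sampled every \<open>\<eta> * n\<close> steps; boundedly
  many samples remain, and the pulled back path has length \<open>O(n)\<close>. The quadratic bound
  holds because a wall projects to a bounded set of a disjoint wall when the stars of their labels
  share at most one vertex: the retraction onto the subgroup of one star maps the subgroup of the
  other star to at most two elements. In the target let the wall be labelled \<open>s\<close>, let
  \<open>s'\<close> be the twin of \<open>s\<close>, and let \<open>b\<close> be a word in
  neighbours of \<open>s\<close>. It commutes with \<open>s\<close> and \<open>s'\<close>. So the
  path that goes out along \<open>s s' s ...\<close>, follows \<open>b\<close> and returns ends at
  \<open>b\<close>, and so does the one that goes out along \<open>s' s s' ...\<close>. They use
  opposite rays of an infinite dihedral group.\<close>

locale racg_words =
  fixes E :: "'v set set"
begin

text \<open>The generators are involutions, so words without formal inverses suffice, and \<open>rev x\<close>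
  represents the inverse of \<open>x\<close>. Every element of the type serves as a generator; the subgroup
  generated by the actual vertices is a retract.\<close>

inductive req :: "'v list \<Rightarrow> 'v list \<Rightarrow> bool" (infix "\<asymp>" 50) where
  req_cancel: "[v, v] \<asymp> []"
| req_commute: "{v, w} \<in> E \<Longrightarrow> [v, w] \<asymp> [w, v]"
| req_refl [simp, intro]: "x \<asymp> x"
| req_sym: "x \<asymp> y \<Longrightarrow> y \<asymp> x"
| req_trans [trans]: "x \<asymp> y \<Longrightarrow> y \<asymp> z \<Longrightarrow> x \<asymp> z"
| req_cong: "x \<asymp> x' \<Longrightarrow> y \<asymp> y' \<Longrightarrow> x @ y \<asymp> x' @ y'"

lemma req_rev: "x \<asymp> y \<Longrightarrow> rev x \<asymp> rev y"
proof (induction rule: req.induct)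
  case (req_commute v w)
  then show ?case by (auto intro: req.req_commute simp: insert_commute)
qed (auto intro: req.intros)

lemma req_rev_cancel [simp]: "rev x @ x \<asymp> []"
proof (induction x)
  case (Cons v x)
  have "(rev x @ [v, v]) @ x \<asymp> (rev x @ []) @ x"
    by (intro req_cong req_refl req_cancel)
  with Cons show ?case by (auto intro: req_trans)
qed simp

lemma req_cancel_rev [simp]: "x @ rev x \<asymp> []"
  using req_rev_cancel[of "rev x"] by simp

text \<open>Deleting letters turns each defining relation into itself or into a trivial one. It thus
  induces a retraction onto the subgroup of the letters that are kept, and this retraction does not
  increase length.\<close>

lemma req_filter: "x \<asymp> y \<Longrightarrow> filter P x \<asymp> filter P y"
  by (induction rule: req.induct) (auto intro: req.intros)

lemma req_left_cancel [simp]: "g @ x \<asymp> g @ y \<longleftrightarrow> x \<asymp> y"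
proof
  assume "g @ x \<asymp> g @ y"
  then have "(rev g @ g) @ x \<asymp> (rev g @ g) @ y"
    using req_cong[OF req_refl[of "rev g"]] by simp
  moreover have "(rev g @ g) @ z \<asymp> z" for z
    using req_cong[OF req_rev_cancel req_refl] by fastforce
  ultimately show "x \<asymp> y" by (meson req_sym req_trans)
qed (auto intro: req_cong)

lemma req_Cons_cancel [simp]: "v # x \<asymp> v # y \<longleftrightarrow> x \<asymp> y"
  using req_left_cancel[of "[v]"] by simp

lemma req_insert_cancel [simp]:
  "rev g @ g @ x \<asymp> x" "g @ rev g @ x \<asymp> x" "x @ rev g @ g @ y \<asymp> x @ y" "x @ g @ rev g @ y \<asymp> x @ y"
proof -
  have *: "rev g @ g @ x \<asymp> x" for g x
    using req_cong[OF req_rev_cancel req_refl, of g x] by simp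
  show "rev g @ g @ x \<asymp> x" "g @ rev g @ x \<asymp> x" "x @ rev g @ g @ y \<asymp> x @ y"
    "x @ g @ rev g @ y \<asymp> x @ y"
    using * *[of "rev g"] by auto
qed

lemma req_move: "rev x @ y \<asymp> z \<longleftrightarrow> y \<asymp> x @ z"
proof -
  have "rev x @ y \<asymp> z \<longleftrightarrow> x @ rev x @ y \<asymp> x @ z" by simp
  also have "\<dots> \<longleftrightarrow> y \<asymp> x @ z"
    by (meson req_insert_cancel(2) req_sym req_trans)
  finally show ?thesis .
qed

section \<open>Word length, word metric and geodesics\<close>

definition len :: "'v list \<Rightarrow> nat" where
  "len x = (LEAST n. \<exists>y. x \<asymp> y \<and> length y = n)"

lemma len_req: "x \<asymp> y \<Longrightarrow> len x = len y"
proof -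
  assume "x \<asymp> y"
  then have "x \<asymp> z \<longleftrightarrow> y \<asymp> z" for z by (meson req_sym req_trans)
  then show ?thesis by (simp add: len_def)
qed

lemma len_le: "x \<asymp> y \<Longrightarrow> len x \<le> length y"
  unfolding len_def by (rule Least_le) auto

lemma len_le_length [simp]: "len x \<le> length x"
  by (rule len_le) simp

lemma len_Nil [simp]: "len [] = 0"
  using len_le_length[of "[]"] by simp

lemma obtain_geodesic:
  obtains w where "x \<asymp> w" "length w = len x"
proof -
  have "\<exists>y. x \<asymp> y \<and> length y = len x"
    unfolding len_def by (rule LeastI_ex) auto
  then show ?thesis using that by auto
qed

lemma len_eq_0: "len x = 0 \<longleftrightarrow> x \<asymp> []"
  by (metis len_Nil len_req length_0_conv obtain_geodesic)

lemma len_append: "len (x @ y) \<le> len x + len y"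
proof -
  obtain u v where "x \<asymp> u" "length u = len x" "y \<asymp> v" "length v = len y"
    by (metis obtain_geodesic)
  then show ?thesis using len_le[OF req_cong, of x u y v] by simp
qed

lemma len_rev [simp]: "len (rev x) = len x"
proof -
  have "len (rev x) \<le> len x" for x
    by (metis len_le length_rev obtain_geodesic req_rev)
  from this[of x] this[of "rev x"] show ?thesis by simp
qed

lemma len_filter: "len (filter P x) \<le> len x"
proof -
  obtain u where "x \<asymp> u" "length u = len x" by (metis obtain_geodesic)
  then show ?thesis
    using len_le[OF req_filter, of x u P] length_filter_le[of P u] by linarith
qed

definition dist :: "'v list \<Rightarrow> 'v list \<Rightarrow> nat" where
  "dist x y = len (rev x @ y)"

lemma dist_req: "x \<asymp> x' \<Longrightarrow> y \<asymp> y' \<Longrightarrow> dist x y = dist x' y'"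
  unfolding dist_def by (intro len_req req_cong req_rev)

lemma dist_sym: "dist x y = dist y x"
  unfolding dist_def using len_rev[of "rev x @ y"] by simp

lemma dist_triangle: "dist x z \<le> dist x y + dist y z"
proof -
  have "dist x z = len ((rev x @ y) @ (rev y @ z))"
    unfolding dist_def by (rule len_req) (simp add: req_sym)
  then show ?thesis using len_append by (metis dist_def)
qed

lemma dist_Nil [simp]: "dist [] x = len x" "dist x [] = len x"
  by (simp_all add: dist_def)

lemma dist_eq_0: "dist x y = 0 \<longleftrightarrow> x \<asymp> y"
  using req_move[of x y "[]"] req_sym by (auto simp: dist_def len_eq_0)

lemma dist_self [simp]: "dist x x = 0"
  by (simp add: dist_eq_0)

lemma dist_left [simp]: "dist (g @ x) (g @ y) = dist x y"
  unfolding dist_def by (rule len_req) simp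

lemma dist_append [simp]: "dist x (x @ y) = len y" "dist (x @ y) x = len y"
  using dist_left[of x "[]" y] dist_left[of x y "[]"] by simp_all

definition geodesic :: "'v list \<Rightarrow> bool" where
  "geodesic w \<longleftrightarrow> len w = length w"

lemma geodesic_sub:
  assumes "geodesic (x @ y @ z)"
  shows "geodesic y"
proof -
  have "len (x @ y @ z) \<le> length x + (len y + length z)"
    by (metis add_mono dual_order.trans len_append len_le_length order.refl)
  then have "length y \<le> len y" using assms by (simp add: geodesic_def)
  then show ?thesis using len_le_length[of y] unfolding geodesic_def by (rule le_antisym[rotated])
qed

lemma geodesic_take: "geodesic w \<Longrightarrow> geodesic (take k w)"
  using geodesic_sub[of "[]" "take k w" "drop k w"] by simp

lemma geodesic_dist_take:
  assumes "geodesic w" "i \<le> j" "j \<le> length w"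
  shows "dist (take i w) (take j w) = j - i"
proof -
  have t: "take j w = take i w @ take (j - i) (drop i w)"
    using assms(2) by (metis le_add_diff_inverse take_add)
  have "geodesic (take (j - i) (drop i w))"
    using assms(1) geodesic_sub[of "take i w" "take (j - i) (drop i w)" "drop j w"] t
    by (metis append_assoc append_take_drop_id)
  then show ?thesis
    unfolding t using assms by (simp add: geodesic_def)
qed

section \<open>Special subgroups\<close>

definition special :: "'v set \<Rightarrow> 'v list \<Rightarrow> bool" where
  "special A x \<longleftrightarrow> (\<exists>c. set c \<subseteq> A \<and> x \<asymp> c)"

lemma special_req: "x \<asymp> y \<Longrightarrow> special A x \<longleftrightarrow> special A y"
  unfolding special_def by (meson req_sym req_trans)

lemma special_word: "set x \<subseteq> A \<Longrightarrow> special A x"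
  unfolding special_def by auto

lemma special_append: "special A x \<Longrightarrow> special A y \<Longrightarrow> special A (x @ y)"
proof -
  assume "special A x" "special A y"
  then obtain c d where "set c \<subseteq> A" "x \<asymp> c" "set d \<subseteq> A" "y \<asymp> d"
    by (auto simp: special_def)
  then show ?thesis unfolding special_def
    by (intro exI[of _ "c @ d"]) (auto intro: req_cong)
qed

lemma special_rev: "special A (rev x) \<longleftrightarrow> special A x"
proof -
  have "special A x \<Longrightarrow> special A (rev x)" for x
    unfolding special_def by (metis req_rev set_rev)
  from this[of x] this[of "rev x"] show ?thesis by auto
qed

lemma special_append_left: "special A c \<Longrightarrow> special A (c @ x) \<longleftrightarrow> special A x"
  using special_append[of A c x] special_append[of A "rev c" "c @ x"]
    special_req[OF req_insert_cancel(1)] special_rev by blast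

lemma special_append_right: "special A c \<Longrightarrow> special A (x @ c) \<longleftrightarrow> special A x"
  using special_append_left[of A "rev c" "rev x"] special_rev[of A]
  by (metis rev_append rev_rev_ident)

lemma special_filter:
  assumes "special A x"
  shows "filter (\<lambda>v. v \<in> A) x \<asymp> x"
proof -
  obtain c where "set c \<subseteq> A" "x \<asymp> c" using assms by (auto simp: special_def)
  then show ?thesis using req_filter[of x c "\<lambda>v. v \<in> A"]
    by (metis filter_True req_sym req_trans subsetD)
qed

text \<open>The retraction sends a shortest word to a word for the same element that is not longer.
  Hence special subgroups are isometrically embedded.\<close>

lemma special_geodesic:
  assumes "special A x"
  obtains w where "set w \<subseteq> A" "x \<asymp> w" "length w = len x" "geodesic w"
proof -
  obtain u where u: "x \<asymp> u" "length u = len x" by (metis obtain_geodesic)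
  let ?w = "filter (\<lambda>v. v \<in> A) u"
  have xw: "x \<asymp> ?w"
    using special_filter[OF assms] req_filter[OF u(1)] by (meson req_sym req_trans)
  then have "len x \<le> length ?w" by (rule len_le)
  then have "length ?w = len x" using u(2) by (metis le_antisym length_filter_le)
  then show ?thesis using that[of ?w] xw len_req[OF xw] by (auto simp: geodesic_def)
qed

section \<open>Stars, centralizers and walls\<close>

definition star :: "'v \<Rightarrow> 'v set" where
  "star s = {v. v = s \<or> {s, v} \<in> E}"

lemma star_self [simp]: "s \<in> star s"
  by (simp add: star_def)

lemma star_sym: "v \<in> star s \<longleftrightarrow> s \<in> star v"
  by (auto simp: star_def insert_commute)

lemma star_commute: "set x \<subseteq> star s \<Longrightarrow> s # x \<asymp> x @ [s]"
proof (induction x)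
  case (Cons v x)
  have "[s, v] \<asymp> [v, s]"
    using Cons.prems by (auto simp: star_def intro: req_commute)
  then have "[s, v] @ x \<asymp> [v, s] @ x" by (rule req_cong) simp
  moreover have "v # s # x \<asymp> v # x @ [s]"
    using Cons by simp
  ultimately show ?case by (auto intro: req_trans)
qed simp

lemma special_star_commute: "special (star s) x \<Longrightarrow> s # x \<asymp> x @ [s]"
proof -
  assume "special (star s) x"
  then obtain c where c: "set c \<subseteq> star s" "x \<asymp> c" by (auto simp: special_def)
  have "[s] @ x \<asymp> [s] @ c" using c by simp
  also have "[s] @ c \<asymp> c @ [s]" using star_commute c by simp
  also have "c @ [s] \<asymp> x @ [s]" using c by (intro req_cong) (auto intro: req_sym)
  finally show ?thesis by simp
qed

lemma commute_words:
  assumes "\<And>a b. a \<in> set x \<Longrightarrow> b \<in> set y \<Longrightarrow> {a, b} \<in> E"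
  shows "x @ y \<asymp> y @ x"
  using assms
proof (induction x)
  case (Cons a x)
  have "x @ y \<asymp> y @ x" using Cons by simp
  then have "[a] @ (x @ y) \<asymp> [a] @ (y @ x)" by (simp only: req_left_cancel)
  also have "a # y \<asymp> y @ [a]"
    using Cons.prems by (intro star_commute) (auto simp: star_def)
  then have "[a] @ (y @ x) \<asymp> (y @ [a]) @ x"
    using req_cong[of "a # y" "y @ [a]" x x] by simp
  finally show ?case by simp
qed simp

text \<open>The centralizer of \<open>s\<close> is the product of the subgroup generated by the
  neighbours of \<open>s\<close> and the group of order two generated by \<open>s\<close>: all
  letters \<open>s\<close> can be moved to the end, where they cancel in pairs.\<close>

lemma special_star_cases:
  assumes "special (star s) x"
  obtains b where "set b \<subseteq> star s - {s}" "x \<asymp> b \<or> x \<asymp> b @ [s]"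
proof -
  have "\<exists>b. set b \<subseteq> star s - {s} \<and> (c \<asymp> b \<or> c \<asymp> b @ [s])" if "set c \<subseteq> star s" for c
    using that
  proof (induction c)
    case (Cons v c)
    then obtain b where b: "set b \<subseteq> star s - {s}" "c \<asymp> b \<or> c \<asymp> b @ [s]" by auto
    show ?case
    proof (cases "v = s")
      case False
      then show ?thesis using b Cons.prems req_left_cancel[of "[v]"]
        by (intro exI[of _ "v # b"]) auto
    next
      case True
      have sb: "s # b \<asymp> b @ [s]" using b by (intro star_commute) auto
      from b(2) show ?thesis
      proof
        assume "c \<asymp> b"
        then have "s # c \<asymp> s # b" by simp
        then have "s # c \<asymp> b @ [s]" using sb by (rule req_trans)
        then show ?thesis using True b by auto
      next
        assume "c \<asymp> b @ [s]"
        then have "[s] @ c \<asymp> [s] @ b @ [s]" by simp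
        also have "[s] @ b @ [s] \<asymp> (b @ [s]) @ [s]"
          using req_cong[OF sb, of "[s]" "[s]"] by simp
        also have "(b @ [s]) @ [s] \<asymp> b" using req_cong[OF req_refl req_cancel, of b s] by simp
        finally show ?thesis using True b by auto
      qed
    qed
  qed (auto intro: exI[of _ "[]"])
  then show ?thesis using assms that unfolding special_def by (meson req_trans)
qed

text \<open>The value is the parity of the number of crossings of the wall of \<open>s\<close> along
  the path that starts at \<open>g\<close> and spells the word. Only the parity is invariant under
  cancellation.\<close>

fun crossings :: "'v \<Rightarrow> 'v list \<Rightarrow> 'v list \<Rightarrow> bool" where
  "crossings s g [] = False"
| "crossings s g (v # x) = ((v = s \<and> special (star s) g) \<noteq> crossings s (g @ [v]) x)"

lemma crossings_base: "g \<asymp> g' \<Longrightarrow> crossings s g x = crossings s g' x"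
proof (induction x arbitrary: g g')
  case (Cons v x)
  then have "g @ [v] \<asymp> g' @ [v]" by (intro req_cong) auto
  then show ?case using Cons special_req[OF Cons.prems] by simp
qed simp

lemma crossings_append: "crossings s g (x @ y) = (crossings s g x \<noteq> crossings s (g @ x) y)"
  by (induction x arbitrary: g) auto

text \<open>A cancelled pair runs twice over the same edge. Opposite edges of a commuting square are
  both on the wall or both off it, since multiplication by a letter of \<open>star s\<close> neither
  enters nor leaves the subgroup of \<open>star s\<close>.\<close>

lemma crossings_req: "x \<asymp> y \<Longrightarrow> crossings s g x = crossings s g y"
proof (induction arbitrary: g rule: req.induct)
  case (req_cancel v)
  show ?case by (auto simp: special_append_right special_word)
next
  case (req_commute v w)
  then show ?case
    by (auto simp: star_def insert_commute special_append_right special_word)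
next
  case (req_cong x x' y y')
  have "g @ x \<asymp> g @ x'" using req_cong by simp
  from crossings_base[OF this] show ?case using req_cong by (simp add: crossings_append)
qed auto

lemma crossings_star:
  "special (star s) c \<Longrightarrow> crossings s (c @ g) x = crossings s g x"
  by (induction x arbitrary: g) (auto simp: special_append_left)

text \<open>\<open>side s x\<close> holds iff the wall of the edge from \<open>1\<close> to \<open>s\<close> separates \<open>1\<close> from \<open>x\<close>. This wall
  is crossed exactly by the edges labelled \<open>s\<close> that issue from the subgroup generated by \<open>star s\<close>,
  the centralizer of \<open>s\<close>.\<close>

definition side :: "'v \<Rightarrow> 'v list \<Rightarrow> bool" where
  "side s x = crossings s [] x"

lemma side_Nil [simp]: "\<not> side s []"
  by (simp add: side_def)

lemma side_single [simp]: "side s [v] \<longleftrightarrow> v = s"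
  by (simp add: side_def special_word)

lemma side_req: "x \<asymp> y \<Longrightarrow> side s x = side s y"
  unfolding side_def by (rule crossings_req)

lemma side_step: "side s (x @ [v]) = (side s x \<noteq> (v = s \<and> special (star s) x))"
  by (auto simp: side_def crossings_append)

lemma side_star: "special (star s) c \<Longrightarrow> side s (c @ x) = (side s c \<noteq> side s x)"
  using crossings_star[of s c "[]" x] by (simp add: side_def crossings_append)

lemma side_avoid: "s \<notin> set c \<Longrightarrow> side s (x @ c) = side s x"
proof -
  assume "s \<notin> set c"
  then have "\<not> crossings s g c" for g by (induction c arbitrary: g) auto
  then show ?thesis by (simp add: side_def crossings_append)
qed

lemma side_first_crossing:
  assumes "side s x \<noteq> side s (x @ c)"
  obtains t where "t < length c" "c ! t = s" "special (star s) (x @ take t c)"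
    "\<And>i. i \<le> t \<Longrightarrow> side s (x @ take i c) = side s x"
proof -
  let ?P = "\<lambda>t. side s (x @ take t c) \<noteq> side s x"
  define T where "T = (LEAST t. ?P t)"
  have ex: "?P (length c)" using assms by auto
  have T: "?P T" unfolding T_def using ex by (rule LeastI)
  have min: "\<not> ?P i" if "i < T" for i
    using not_less_Least[of i ?P] that unfolding T_def by blast
  have "T \<le> length c" unfolding T_def using ex by (rule Least_le)
  moreover have "T \<noteq> 0" using T by (metis append_Nil2 take_0)
  ultimately obtain t where t: "T = Suc t" "t < length c"
    by (metis Suc_le_lessD not0_implies_Suc)
  have "x @ take T c = (x @ take t c) @ [c ! t]"
    using t by (simp add: take_Suc_conv_app_nth)
  then have "c ! t = s \<and> special (star s) (x @ take t c)"
    using T min[of t] t side_step[of s "x @ take t c" "c ! t"] by auto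
  then show ?thesis using that[of t] t min by (metis less_Suc_eq_le)
qed

lemma geodesic_rev [simp]: "geodesic (rev w) \<longleftrightarrow> geodesic w"
  by (simp add: geodesic_def)

text \<open>Otherwise \<open>v\<close> would commute with \<open>s\<close>, and the two letters
  \<open>s\<close> around it would cancel.\<close>

lemma geodesic_not_special:
  assumes "geodesic (x @ s # v @ s # z)"
  shows "\<not> special (star s) v"
proof
  assume "special (star s) v"
  then have "(s # v) @ [s] \<asymp> (v @ [s]) @ [s]"
    by (intro req_cong special_star_commute) auto
  also have "(v @ [s]) @ [s] \<asymp> v" using req_cong[OF req_refl req_cancel, of v s] by simp
  finally have "len (s # v @ [s]) \<le> length v" by (intro len_le) simp
  moreover have "geodesic (s # v @ [s])"
    using assms geodesic_sub[of x "s # v @ [s]" z] by simp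
  ultimately show False by (simp add: geodesic_def)
qed

text \<open>The first letter crosses the wall. A second crossing would be a later letter
  \<open>s\<close>, preceded by a word of the centralizer of \<open>s\<close>.\<close>

lemma side_geodesic:
  assumes "geodesic (s # z)"
  shows "side s (s # z)"
proof (rule ccontr)
  assume "\<not> side s (s # z)"
  then have "side s [s] \<noteq> side s ([s] @ z)" by simp
  then obtain t where t: "t < length z" "z ! t = s" "special (star s) ([s] @ take t z)"
    by (rule side_first_crossing)
  then have "special (star s) (take t z)"
    using special_append_left[of "star s" "[s]"] special_word[of "[s]" "star s"] by simp
  moreover have "s # z = [] @ s # take t z @ s # drop (Suc t) z"
    using t id_take_nth_drop[of t z] by simp
  ultimately show False using assms geodesic_not_special by metis
qed

lemma side_Cons_self: "side s (s # x) \<longleftrightarrow> \<not> side s x"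
  using side_star[of s "[s]" x] special_word[of "[s]" "star s"] by simp

lemma side_rev_geodesic:
  assumes "geodesic (x @ [s])"
  shows "\<not> side s (rev x)"
proof -
  have "geodesic (rev (x @ [s]))" using assms by (simp only: geodesic_rev)
  then have "side s (s # rev x)" by (intro side_geodesic) simp
  then show ?thesis by (simp add: side_Cons_self)
qed

lemma side_special: "special A c \<Longrightarrow> s \<notin> A \<Longrightarrow> side s (x @ c) = side s x"
proof -
  assume "special A c" "s \<notin> A"
  then obtain d where d: "s \<notin> set d" "c \<asymp> d" by (auto simp: special_def)
  then have "side s (x @ c) = side s (x @ d)" by (intro side_req) simp
  then show ?thesis using side_avoid[OF d(1)] by simp
qed

text \<open>Walls with non-commuting labels do not cross. Follow a path from \<open>x\<close> to
  \<open>g\<close> up to the wall at \<open>g'\<close>. It does not cross the wall at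
  \<open>g\<close> before: from there letters of \<open>star s\<close> would lead to
  \<open>g\<close> without crossing the wall at \<open>g'\<close>, which separates \<open>x\<close>
  from \<open>g\<close>. From the point reached, letters of \<open>star s'\<close> lead to
  \<open>g'\<close>, again without crossing the wall at \<open>g\<close>.\<close>

lemma wall_side_constant:
  assumes s': "s' \<notin> star s"
    and x: "side s' (rev g' @ x) \<noteq> side s' (rev g' @ g)"
  shows "side s (rev g @ x) = side s (rev g @ g')"
proof -
  let ?c = "rev x @ g"
  have "side s' ((rev g' @ x) @ ?c) = side s' (rev g' @ g)"
    by (rule side_req) simp
  then have "side s' (rev g' @ x) \<noteq> side s' ((rev g' @ x) @ ?c)" using x by simp
  then obtain t where t: "special (star s') ((rev g' @ x) @ take t ?c)"
    "\<And>i. i \<le> t \<Longrightarrow> side s' ((rev g' @ x) @ take i ?c) = side s' (rev g' @ x)"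
    by (rule side_first_crossing) blast
  define u where "u = take t ?c"
  have "side s (rev g @ x) = side s ((rev g @ x) @ u)"
  proof (rule ccontr)
    assume "side s (rev g @ x) \<noteq> side s ((rev g @ x) @ u)"
    then obtain i where i: "i < length u" "special (star s) ((rev g @ x) @ take i u)"
      by (rule side_first_crossing) blast
    have "length u \<le> t" by (simp add: u_def del: take_append)
    then have "i \<le> t" "take i u = take i ?c"
      using i(1) by (simp_all add: u_def min_def del: take_append)
    then have "side s' (rev g' @ x) = side s' (rev g' @ x @ take i u)"
      using t(2)[of i] by (simp del: take_append)
    also have "\<dots> = side s' ((rev g' @ g) @ (rev g @ x) @ take i u)"
      by (rule side_req) (simp add: req_sym)
    also have "\<dots> = side s' (rev g' @ g)"
      using i(2) s' by (rule side_special)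
    finally show False using x by simp
  qed
  also have "\<dots> = side s ((rev g @ g') @ (rev g' @ x @ u))"
    by (rule side_req) (simp add: req_sym)
  also have "\<dots> = side s (rev g @ g')"
    using t(1) s' by (intro side_special[of "star s'"]) (auto simp: u_def star_sym)
  finally show ?thesis .
qed

lemma side_disjoint: "s' \<notin> star s \<Longrightarrow> side s x \<Longrightarrow> \<not> side s' x"
  using wall_side_constant[of s' s "[]" x "[]"] by auto

text \<open>The second wall separates both \<open>y\<close> and the end of the geodesic from
  \<open>x\<close>. By \<open>wall_side_constant\<close> these two points are on the same side of
  the first wall, and the geodesic shows which side it is.\<close>

lemma halfspace_nested:
  assumes w: "geodesic (x @ s # v @ s' # z)" and s': "s' \<notin> star s"
    and y: "side s' (rev (x @ s # v) @ y)"
  shows "side s (rev x @ y)"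
proof -
  let ?g = "x @ s # v" and ?w = "x @ s # v @ s' # z"
  have "geodesic ((s # v) @ [s'])"
    using w geodesic_sub[of x "(s # v) @ [s']" z] by simp
  then have "\<not> side s' (rev (s # v))" by (rule side_rev_geodesic)
  moreover have "side s' (rev ?g @ x) = side s' (rev (s # v))"
    by (rule side_req) (use req_insert_cancel(3)[of "rev (s # v)" x "[]"] in simp)
  ultimately have g: "\<not> side s' (rev ?g @ x)" by simp
  have "rev ?g @ ?w \<asymp> s' # z"
    using req_insert_cancel(1)[of ?g "s' # z"] by simp
  moreover have "side s' (s' # z)"
    using w geodesic_sub[of ?g "s' # z" "[]"] by (intro side_geodesic) simp
  ultimately have "side s' (rev ?g @ ?w)" using side_req by blast
  then have "side s (rev x @ ?w) = side s (rev x @ y)"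
    using wall_side_constant[OF s', of ?g _ x] g y by blast
  moreover have "side s (rev x @ ?w) = side s (s # v @ s' # z)"
    by (rule side_req) simp
  moreover have "side s (s # v @ s' # z)"
    using w geodesic_sub[of x "s # v @ s' # z" "[]"] by (intro side_geodesic) simp
  ultimately show ?thesis by simp
qed

lemma req_parity: "x \<asymp> y \<Longrightarrow> even (length x) = even (length y)"
  by (induction rule: req.induct) auto

text \<open>The length has to change because relations preserve its parity. If it grows, a geodesic
  for \<open>x\<close> followed by \<open>s\<close> is a geodesic, which meets the wall of its last
  edge only there; if it drops, the same holds with \<open>x\<close> and \<open>x @ [s]\<close>
  exchanged.\<close>

lemma len_snoc: "len (x @ [s]) = (if side s (rev x) then len x - 1 else len x + 1)"
  and len_snoc_pos: "side s (rev x) \<Longrightarrow> 0 < len x"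
proof -
  obtain w where w: "x \<asymp> w" "length w = len x" by (metis obtain_geodesic)
  obtain u where u: "x @ [s] \<asymp> u" "length u = len (x @ [s])" by (metis obtain_geodesic)
  have "(u @ [s]) \<asymp> (x @ [s]) @ [s]" using u by (intro req_cong) (auto intro: req_sym)
  also have "(x @ [s]) @ [s] \<asymp> x" using req_cong[OF req_refl req_cancel, of x s] by simp
  finally have ux: "u @ [s] \<asymp> x" .
  have le: "len x \<le> len u + 1" "len (x @ [s]) \<le> len x + 1" "len u = len (x @ [s])"
    using len_append[of u "[s]"] len_append[of x "[s]"] len_le_length[of "[s]"]
      len_req[OF ux] len_req[OF u(1)] by auto
  have "even (length (u @ [s])) = even (length w)"
    using ux w(1) by (intro req_parity) (rule req_trans)
  then have neq: "len (x @ [s]) \<noteq> len x" using w u by auto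
  have "len (x @ [s]) = (if side s (rev x) then len x - 1 else len x + 1) \<and>
        (side s (rev x) \<longrightarrow> 0 < len x)"
  proof (cases "len (x @ [s]) = len x + 1")
    case True
    have "w @ [s] \<asymp> x @ [s]" using w by (intro req_cong) (auto intro: req_sym)
    then have "geodesic (w @ [s])" using True w by (simp add: geodesic_def len_req)
    then have "\<not> side s (rev w)" by (rule side_rev_geodesic)
    then show ?thesis using True side_req[OF req_rev[OF w(1)]] by simp
  next
    case False
    then have l: "len x = len (x @ [s]) + 1" using le neq by linarith
    then have "geodesic (u @ [s])" using u len_req[OF ux] by (simp add: geodesic_def)
    then have "\<not> side s (rev u)" by (rule side_rev_geodesic)
    then have "side s (rev (u @ [s]))" by (simp add: side_Cons_self)
    then show ?thesis using l side_req[OF req_rev[OF ux]] by simp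
  qed
  then show "len (x @ [s]) = (if side s (rev x) then len x - 1 else len x + 1)"
    "side s (rev x) \<Longrightarrow> 0 < len x" by auto
qed

text \<open>For non-adjacent \<open>s\<close>, \<open>t\<close> the group maps onto the infinite dihedral group of isometries of the
  integers, \<open>s\<close> and \<open>t\<close> being the reflections in \<open>-1/2\<close> and \<open>1/2\<close>; \<open>dihedral s t x n\<close> is the image of
  \<open>n\<close> under \<open>x\<close>.\<close>

definition dihedral :: "'v \<Rightarrow> 'v \<Rightarrow> 'v list \<Rightarrow> int \<Rightarrow> int" where
  "dihedral s t = foldr (\<lambda>v n. if v = s then - 1 - n else if v = t then 1 - n else n)"

lemma dihedral_simps [simp]:
  "dihedral s t [] n = n"
  "dihedral s t (x @ y) n = dihedral s t x (dihedral s t y n)"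
  "dihedral s t (v # x) n = (if v = s then - 1 - dihedral s t x n
     else if v = t then 1 - dihedral s t x n else dihedral s t x n)"
  by (simp_all add: dihedral_def)

lemma dihedral_req:
  assumes "t \<notin> star s"
  shows "x \<asymp> y \<Longrightarrow> dihedral s t x n = dihedral s t y n"
proof (induction arbitrary: n rule: req.induct)
  case (req_commute v w)
  then show ?case using assms by (auto simp: star_def insert_commute)
qed auto

lemma dihedral_isometry: "\<bar>dihedral s t x m - dihedral s t x n\<bar> = \<bar>m - n\<bar>"
  by (induction x) (simp_all add: abs_minus_commute)

lemma dihedral_length: "\<bar>dihedral s t x 0\<bar> \<le> int (length x)"
proof (induction x)
  case (Cons v x)
  then show ?case by auto
qed simp

text \<open>The action is by isometries, and each letter moves \<open>0\<close> by at most
  one.\<close>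

lemma dihedral_lipschitz:
  assumes "t \<notin> star s"
  shows "\<bar>dihedral s t x 0 - dihedral s t y 0\<bar> \<le> int (dist x y)"
proof -
  obtain u where u: "rev x @ y \<asymp> u" "length u = dist x y"
    by (metis obtain_geodesic dist_def)
  then have "y \<asymp> x @ u" by (simp add: req_move)
  then have "dihedral s t y 0 = dihedral s t x (dihedral s t u 0)"
    using dihedral_req[OF assms] by fastforce
  then have "\<bar>dihedral s t x 0 - dihedral s t y 0\<bar> = \<bar>dihedral s t u 0\<bar>"
    using dihedral_isometry[of s t x 0 "dihedral s t u 0"] by simp
  then show ?thesis using dihedral_length[of s t u] u by simp
qed

end

section \<open>Alternating words\<close>

fun alternating :: "'v \<Rightarrow> 'v \<Rightarrow> nat \<Rightarrow> 'v list" where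
  "alternating s t 0 = []"
| "alternating s t (Suc n) = s # alternating t s n"

lemma length_alternating [simp]: "length (alternating s t n) = n"
  by (induction n arbitrary: s t) auto

lemma set_alternating: "set (alternating s t n) \<subseteq> {s, t}"
  by (induction n arbitrary: s t) fastforce+

lemma take_alternating: "take k (alternating s t n) = alternating s t (min k n)"
  by (induction n arbitrary: s t k) (auto simp: take_Cons split: nat.splits)

context racg_words
begin

lemma dihedral_alternating:
  assumes "s \<noteq> t"
  shows "dihedral s t (alternating s t n) 0 = - int n"
    "dihedral s t (alternating t s n) 0 = int n"
  using assms by (induction n) auto

text \<open>The two alternating words send \<open>0\<close> to points of opposite sign, so the
  Lipschitz bound makes their distance at least \<open>n + m\<close>.\<close>

lemma geodesic_alternating:
  assumes "t \<notin> star s"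
  shows "geodesic (alternating s t n)" "geodesic (rev (alternating s t n) @ alternating t s m)"
proof -
  have st: "s \<noteq> t" using assms by auto
  have "n + m \<le> dist (alternating s t n) (alternating t s m)" for n m
    using dihedral_lipschitz[OF assms, of "alternating s t n" "alternating t s m"] st
    by (simp add: dihedral_alternating)
  then have *: "geodesic (rev (alternating s t n) @ alternating t s m)" for n m
    using len_le_length[of "rev (alternating s t n) @ alternating t s m" for n m]
    unfolding geodesic_def dist_def by (intro le_antisym) auto
  show "geodesic (rev (alternating s t n) @ alternating t s m)" by (rule *)
  have "geodesic (rev (alternating s t n))" using *[of n 0] by simp
  then show "geodesic (alternating s t n)" by simp
qed

lemma len_letter [simp]: "len [v] \<le> Suc 0"
  using len_le_length[of "[v]"] by simp

lemma wall_step: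
  assumes "side s (rev g @ x) \<noteq> side s (rev g @ y)" "dist x y \<le> 1"
  shows "special (star s) (rev g @ x)" "special (star s) (rev g @ y)" "y \<asymp> x @ [s]"
proof -
  obtain u where u: "rev x @ y \<asymp> u" "length u = dist x y"
    by (metis obtain_geodesic dist_def)
  then have y: "y \<asymp> x @ u" by (simp add: req_move)
  then have "side s (rev g @ y) = side s ((rev g @ x) @ u)"
    by (intro side_req) simp
  then have ne: "side s (rev g @ x) \<noteq> side s ((rev g @ x) @ u)" using assms(1) by simp
  then have "u \<noteq> []" "length u \<le> 1" using u(2) assms(2) by auto
  then obtain v where v: "u = [v]" by (cases u) auto
  then have vs: "v = s" and x: "special (star s) (rev g @ x)"
    using ne side_step[of s "rev g @ x" v] by auto
  show "special (star s) (rev g @ x)" by (rule x)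
  show yx: "y \<asymp> x @ [s]" using y v vs by simp
  then have "rev g @ y \<asymp> (rev g @ x) @ [s]" by simp
  moreover have "special (star s) ((rev g @ x) @ [s])"
    by (rule special_append[OF x special_word]) simp
  ultimately show "special (star s) (rev g @ y)" using special_req by blast
qed

lemma req_bridge: "rev (rev a @ x) @ (rev a @ b) @ rev b @ y \<asymp> rev x @ y"
proof -
  have "(rev x @ a @ rev a) @ b @ rev b @ y \<asymp> (rev x @ a @ rev a) @ y"
    by (rule req_insert_cancel(4))
  also have "(rev x @ a @ rev a) @ y \<asymp> rev x @ y"
    using req_insert_cancel(4)[of "rev x" a y] by simp
  finally show ?thesis by simp
qed

lemma len_single: "set x \<subseteq> {t} \<Longrightarrow> len x \<le> 1"
proof (induction x)
  case (Cons v x)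
  then obtain u where u: "x \<asymp> u" "length u = len x" "len x \<le> 1" by (metis obtain_geodesic set_subset_Cons subset_trans)
  have "set x \<subseteq> {t}" "v = t" using Cons.prems by auto
  then obtain w where w: "set w \<subseteq> {t}" "x \<asymp> w" "length w = len x"
    using special_geodesic[of "{t}" x] special_word by metis
  then have "length w \<le> 1" using u(3) by simp
  with w(1) consider "w = []" | "w = [t]" by (cases w) auto
  then show ?case
  proof cases
    case 1
    then show ?thesis using w \<open>v = t\<close> len_le[of "v # x" "[v]"] by simp
  next
    case 2
    then have "t # x \<asymp> t # [t]" using w by simp
    then have "t # x \<asymp> []" using req_cancel req_trans by blast
    then show ?thesis using \<open>v = t\<close> len_le[of "v # x" "[]"] by simp
  qed
qed simp

text \<open>Retracting onto the subgroup generated by \<open>star s\<close> fixes \<open>h\<close> and maps \<open>h'\<close> to an element of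
  length at most \<open>1\<close>.\<close>

lemma len_between_walls:
  assumes "special (star s) h" "special (star s') h'" "star s \<inter> star s' \<subseteq> {t}"
  shows "len h \<le> len (rev h @ v @ h') + len v + 1"
proof -
  let ?f = "filter (\<lambda>u. u \<in> star s)"
  obtain c where c: "set c \<subseteq> star s'" "h' \<asymp> c" using assms(2) by (auto simp: special_def)
  have "len (?f h') = len (?f c)" using c by (intro len_req req_filter)
  also have "\<dots> \<le> 1" using c assms(3) by (intro len_single[of _ t]) auto
  finally have h': "len (?f h') \<le> 1" .
  \<comment> \<open>The inverse of \<open>h\<close> is the image of \<open>rev h @ v @ h'\<close>
    under the retraction, corrected by the images of \<open>h'\<close> and \<open>v\<close>.\<close>
  have "rev h \<asymp> rev (?f h)" using special_filter[OF assms(1)] by (intro req_rev) (rule req_sym)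
  also have "rev (?f h) \<asymp> rev (?f h) @ ?f v @ rev (?f v)"
    using req_insert_cancel(4)[of "rev (?f h)" "?f v" "[]"] by (simp add: req_sym)
  also have "\<dots> \<asymp> rev (?f h) @ ?f v @ ?f h' @ rev (?f h') @ rev (?f v)"
    by (rule req_sym) (use req_insert_cancel(4)[of "rev (?f h) @ ?f v" "?f h'" "rev (?f v)"] in simp)
  also have "\<dots> = ?f (rev h @ v @ h') @ rev (?f h') @ rev (?f v)"
    by (simp add: rev_filter)
  finally have "len h = len (?f (rev h @ v @ h') @ rev (?f h') @ rev (?f v))"
    using len_req[of "rev h"] by simp
  also have "\<dots> \<le> len (?f (rev h @ v @ h')) + (len (?f h') + len (?f v))"
    using len_append[of "?f (rev h @ v @ h')" "rev (?f h') @ rev (?f v)"]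
      len_append[of "rev (?f h')" "rev (?f v)"] by simp
  also have "\<dots> \<le> len (rev h @ v @ h') + (1 + len v)"
    using h' by (intro add_mono len_filter)
  finally show ?thesis by simp
qed

section \<open>Morse geodesics\<close>

lemma pigeonhole_letter:
  assumes "finite P" "set w \<subseteq> P" "I \<subseteq> {..<length w}" "I \<noteq> {}"
  obtains s where "s \<in> P" "card I \<le> card P * card {i \<in> I. w ! i = s}"
proof -
  have fin: "finite I" using assms(3) finite_subset by blast
  have "(\<Sum>s\<in>P. card {i \<in> I. w ! i = s}) = card I"
    using assms fin by (subst card_UN_disjoint[symmetric])
      (auto intro!: arg_cong[of _ _ card] dest: nth_mem)
  moreover have "\<exists>s\<in>P. card I \<le> card P * card {i \<in> I. w ! i = s}"
  proof (rule ccontr)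
    assume "\<not> ?thesis"
    then have less: "card P * card {i \<in> I. w ! i = s} < card I" if "s \<in> P" for s
      using that by (meson not_le)
    have "P \<noteq> {}" using assms by fastforce
    have "card P * (\<Sum>s\<in>P. card {i \<in> I. w ! i = s}) < (\<Sum>s\<in>P. card I)"
      unfolding sum_distrib_left using less assms(1) \<open>P \<noteq> {}\<close> by (intro sum_strict_mono) auto
    then show False using calculation by simp
  qed
  ultimately show ?thesis using that by blast
qed

text \<open>Seen from its edge at position \<open>i\<close>, a geodesic does not return to the wall
  of this edge in either direction.\<close>

lemma geodesic_separates:
  assumes "geodesic w" "i < length w"
  shows "\<not> side (w ! i) (rev (take i w))" "side (w ! i) (rev (take i w) @ w)"
proof -
  have w: "w = take i w @ w ! i # drop (Suc i) w"
    using assms(2) by (simp add: id_take_nth_drop[symmetric])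
  have "geodesic (take i w @ [w ! i])"
    using geodesic_take[OF assms(1), of "Suc i"] assms(2) by (simp add: take_Suc_conv_app_nth)
  then show "\<not> side (w ! i) (rev (take i w))" by (rule side_rev_geodesic)
  have "rev (take i w) @ w \<asymp> w ! i # drop (Suc i) w"
    using w req_insert_cancel(1) by metis
  moreover have "side (w ! i) (w ! i # drop (Suc i) w)"
    using geodesic_sub[of "take i w" "w ! i # drop (Suc i) w" "[]"] w assms(1)
    by (intro side_geodesic) simp
  ultimately show "side (w ! i) (rev (take i w) @ w)" using side_req by blast
qed

lemma dist_steps:
  assumes "\<And>i. i < N \<Longrightarrow> dist (\<gamma> i) (\<gamma> (Suc i)) \<le> 1" "i \<le> j" "j \<le> N"
  shows "dist (\<gamma> i) (\<gamma> j) \<le> j - i"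
  using assms(2,3)
proof (induction j rule: dec_induct)
  case (step j)
  then show ?case using assms(1)[of j] dist_triangle[of "\<gamma> i" "\<gamma> (Suc j)" "\<gamma> j"] by simp
qed simp

text \<open>Among \<open>k\<close> consecutive letters of \<open>w\<close> some letter \<open>s\<close> occurs at least \<open>k / card P\<close> times. Between two
  consecutive occurrences there is a letter \<open>s'\<close> outside \<open>star s\<close>, so the walls of these letters
  are nested and a path that stays far from \<open>take a w\<close> needs a long time from one to the next.\<close>

lemma morse_path_length:
  assumes P: "finite P" "set w \<subseteq> P"
    and narrow: "\<And>s s'. s \<in> P \<Longrightarrow> s' \<in> P \<Longrightarrow> s' \<notin> star s \<Longrightarrow> \<exists>t. star s \<inter> star s' \<subseteq> {t}"
    and w: "geodesic w" "a + k \<le> length w"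
    and \<gamma>: "\<gamma> 0 \<asymp> []" "\<gamma> N \<asymp> w" "\<And>i. i < N \<Longrightarrow> dist (\<gamma> i) (\<gamma> (Suc i)) \<le> 1"
    and far: "\<And>i. i \<le> N \<Longrightarrow> \<rho> \<le> dist (\<gamma> i) (take a w)"
  shows "\<exists>c. k \<le> card P * c \<and> (c - 1) * (\<rho> - 2 * k - 1) \<le> N"
proof (cases "k = 0")
  case True
  then show ?thesis by (intro exI[of _ 0]) auto
next
  case False
  define I where "I = {a..<a + k}"
  have I: "I \<subseteq> {..<length w}" "I \<noteq> {}" "card I = k" using w(2) False by (auto simp: I_def)
  define g where "g i = take i w" for i
  define h where "h i x = side (w ! i) (rev (g i) @ x)" for i x
  have split1: "w = g i @ w ! i # drop (Suc i) w" if "i < length w" for i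
    using that by (simp add: g_def id_take_nth_drop[symmetric])
  have split2: "\<exists>v z. w = g i @ w ! i # v @ w ! j # z \<and> g j = g i @ w ! i # v
      \<and> v = drop (Suc i) (g j)"
    if "i < j" "j < length w" for i j
  proof -
    have "g j = g i @ w ! i # drop (Suc i) (g j)"
      using id_take_nth_drop[of i "g j"] that by (simp add: g_def)
    then show ?thesis using split1[OF that(2)] by (metis append.assoc append_Cons)
  qed
  have h0: "\<not> h i []" and h1: "h i w" if "i < length w" for i
    using geodesic_separates[OF w(1) that] by (simp_all add: h_def g_def)
  have h_req: "x \<asymp> y \<Longrightarrow> h i x = h i y" for i x y
    unfolding h_def by (intro side_req) simp
  \<comment> \<open>At the first time beyond wall \<open>i\<close> the path is at the end of an edge
    of this wall, so its position lies in a coset of the subgroup of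
    \<open>star (w ! i)\<close>.\<close>
  define \<tau> where "\<tau> i = (LEAST t. h i (\<gamma> t))" for i
  have hN: "h i (\<gamma> N)" if "i < length w" for i
    using h1[OF that] h_req[OF \<gamma>(2)] by simp
  have \<tau>: "h i (\<gamma> (\<tau> i))" "\<tau> i \<le> N" "special (star (w ! i)) (rev (g i) @ \<gamma> (\<tau> i))"
    if i: "i < length w" for i
  proof -
    show 1: "h i (\<gamma> (\<tau> i))" unfolding \<tau>_def using hN[OF i] by (rule LeastI)
    show 2: "\<tau> i \<le> N" unfolding \<tau>_def using hN[OF i] by (rule Least_le)
    have "\<tau> i \<noteq> 0" using 1 h0[OF i] h_req[OF \<gamma>(1)] by (metis (full_types))
    then obtain t where t: "\<tau> i = Suc t" using not0_implies_Suc by blast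
    have "\<not> h i (\<gamma> t)" using not_less_Least[of t "\<lambda>t. h i (\<gamma> t)"] t by (simp add: \<tau>_def)
    then show "special (star (w ! i)) (rev (g i) @ \<gamma> (\<tau> i))"
      using wall_step(2)[of "w ! i" "g i" "\<gamma> t" "\<gamma> (\<tau> i)"] 1 2 t \<gamma>(3)[of t] by (auto simp: h_def)
  qed
  \<comment> \<open>On wall \<open>i\<close> the path is at least \<open>\<rho> - k\<close> away
    from \<open>take i w\<close>, a point within \<open>k\<close> of \<open>take a w\<close>. By
    \<open>len_between_walls\<close> all but \<open>k + 1\<close> of this distance has to be
    travelled before the next wall.\<close>
  define D where "D = \<rho> - 2 * k - 1"
  have next_wall: "\<tau> i + D \<le> \<tau> j" if ij: "i \<in> I" "j \<in> I" "i < j" "w ! j \<notin> star (w ! i)" for i j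
  proof -
    have l: "i < length w" "j < length w" using ij I by auto
    obtain v z where v: "w = g i @ w ! i # v @ w ! j # z" "g j = g i @ w ! i # v"
      using split2[OF ij(3) l(2)] by auto
    \<comment> \<open>By nesting, a point beyond wall \<open>j\<close> is beyond wall
      \<open>i\<close>, so the walls are reached in order.\<close>
    have "h i (\<gamma> (\<tau> j))"
      using halfspace_nested[of "g i" "w ! i" v "w ! j" z "\<gamma> (\<tau> j)"] v w(1) ij(4) \<tau>(1)[OF l(2)]
      by (simp add: h_def)
    then have le: "\<tau> i \<le> \<tau> j" by (simp add: \<tau>_def[of i] Least_le)
    let ?h = "rev (g i) @ \<gamma> (\<tau> i)" and ?h' = "rev (g j) @ \<gamma> (\<tau> j)" and ?v = "rev (g i) @ g j"
    obtain t where "star (w ! i) \<inter> star (w ! j) \<subseteq> {t}"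
      using narrow[of "w ! i" "w ! j"] P l ij by (meson nth_mem subsetD)
    then have "len ?h \<le> len (rev ?h @ ?v @ ?h') + len ?v + 1"
      using \<tau>(3)[OF l(1)] \<tau>(3)[OF l(2)] by (intro len_between_walls)
    also have "len (rev ?h @ ?v @ ?h') = dist (\<gamma> (\<tau> i)) (\<gamma> (\<tau> j))"
      unfolding dist_def by (intro len_req req_bridge)
    also have "len ?v = dist (g i) (g j)" by (simp add: dist_def)
    also have "\<dots> \<le> k"
      using geodesic_dist_take[OF w(1), of i j] ij l by (simp add: g_def I_def)
    finally have "dist (g i) (\<gamma> (\<tau> i)) \<le> dist (\<gamma> (\<tau> i)) (\<gamma> (\<tau> j)) + k + 1" by (simp add: dist_def)
    moreover have "dist (\<gamma> (\<tau> i)) (take a w) \<le> dist (g i) (\<gamma> (\<tau> i)) + dist (g i) (take a w)"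
      using dist_triangle[of "\<gamma> (\<tau> i)" "take a w" "g i"] dist_sym by simp
    moreover have "dist (g i) (take a w) \<le> k"
      using geodesic_dist_take[OF w(1), of a i] ij l dist_sym[of "g i"] by (simp add: g_def I_def)
    ultimately show ?thesis
      using far[OF \<tau>(2)[OF l(1)]] dist_steps[of N \<gamma>, OF \<gamma>(3) le \<tau>(2)[OF l(2)]] le by (simp add: D_def)
  qed
  obtain s where s: "s \<in> P" "k \<le> card P * card {i \<in> I. w ! i = s}"
    using pigeonhole_letter[OF P I(1,2)] I(3) by metis
  have repeat: "\<tau> i + D \<le> \<tau> j" if ij: "i \<in> I" "j \<in> I" "i < j" "w ! i = s" "w ! j = s" for i j
  proof -
    have l: "j < length w" using ij I by auto
    obtain v z where v: "w = g i @ s # v @ s # z" "v = drop (Suc i) (g j)"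
      using split2[OF ij(3) l] ij by auto
    then have "\<not> special (star s) v" using w(1) geodesic_not_special by metis
    \<comment> \<open>The letter outside \<open>star s\<close> supplies an intermediate wall.
      Passing it costs \<open>D\<close> before and after; one of the two suffices.\<close>
    then obtain u where "u \<in> set v" "u \<notin> star s" using special_word by blast
    then obtain m where m: "m < length v" "v ! m \<notin> star s" by (metis in_set_conv_nth)
    define n where "n = Suc i + m"
    have "w ! n = v ! m" "i < n" "n < j" using m v(2) l by (auto simp: n_def g_def)
    moreover have "n \<in> I" using \<open>i < n\<close> \<open>n < j\<close> ij by (auto simp: I_def)
    ultimately have "\<tau> i + D \<le> \<tau> n" "\<tau> n + D \<le> \<tau> j"
      using next_wall[of i n] next_wall[of n j] ij m star_sym by auto
    then show ?thesis by simp
  qed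
  have chain: "(card Q - 1) * D \<le> \<tau> (Max Q)"
    if "finite Q" "Q \<noteq> {}" "Q \<subseteq> {i \<in> I. w ! i = s}" for Q
    using that
  proof (induction Q rule: finite_linorder_max_induct)
    case (insert b Q)
    show ?case
    proof (cases "Q = {}")
      case False
      have M: "Max Q \<in> Q" using False insert by simp
      then have "\<tau> (Max Q) + D \<le> \<tau> b" using insert by (intro repeat) auto
      moreover have "(card Q - 1) * D \<le> \<tau> (Max Q)" using insert False by simp
      moreover have "Max (insert b Q) = b" using insert by (intro Max_eqI) (auto intro: less_imp_le)
      moreover have "card (insert b Q) = card Q + 1" "card Q \<noteq> 0" using insert False by auto
      ultimately show ?thesis by (cases "card Q") auto
    qed simp
  qed simp
  let ?O = "{i \<in> I. w ! i = s}"
  have "finite ?O" by (simp add: I_def)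
  have "?O \<noteq> {}"
  proof
    assume "?O = {}"
    then have "card ?O = 0" by (simp only: card.empty)
    then show False using s(2) False by simp
  qed
  have "(card ?O - 1) * D \<le> \<tau> (Max ?O)" using \<open>finite ?O\<close> \<open>?O \<noteq> {}\<close> by (intro chain) auto
  also have "\<tau> (Max ?O) \<le> N"
    using Max_in[OF \<open>finite ?O\<close> \<open>?O \<noteq> {}\<close>] I by (intro \<tau>(2)) auto
  finally show ?thesis using s(2) unfolding D_def by blast
qed

text \<open>The values of a path lie in \<open>A\<close>; the end point is prescribed up to equality in the group.\<close>

definition path :: "('v list \<Rightarrow> bool) \<Rightarrow> nat \<Rightarrow> 'v list \<Rightarrow> 'v list \<Rightarrow> bool" where
  "path A N x y \<longleftrightarrow> (\<exists>\<gamma>. \<gamma> 0 = x \<and> \<gamma> N \<asymp> y \<and> (\<forall>i\<le>N. A (\<gamma> i)) \<and>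
     (\<forall>i<N. dist (\<gamma> i) (\<gamma> (Suc i)) \<le> 1))"

lemma path_refl: "A x \<Longrightarrow> x \<asymp> y \<Longrightarrow> path A 0 x y"
  unfolding path_def by (intro exI[of _ "\<lambda>_. x"]) auto

lemma path_trans:
  assumes "path A M x y" "path A N y z"
  shows "path A (M + N) x z"
proof -
  obtain \<gamma> where \<gamma>: "\<gamma> 0 = x" "\<gamma> M \<asymp> y" "\<And>i. i \<le> M \<Longrightarrow> A (\<gamma> i)"
    "\<And>i. i < M \<Longrightarrow> dist (\<gamma> i) (\<gamma> (Suc i)) \<le> 1" using assms(1) by (auto simp: path_def)
  obtain \<delta> where \<delta>: "\<delta> 0 = y" "\<delta> N \<asymp> z" "\<And>i. i \<le> N \<Longrightarrow> A (\<delta> i)"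
    "\<And>i. i < N \<Longrightarrow> dist (\<delta> i) (\<delta> (Suc i)) \<le> 1" using assms(2) by (auto simp: path_def)
  \<comment> \<open>At time \<open>M\<close> the joined path is at \<open>\<gamma> M\<close>, which
    equals \<open>\<delta> 0\<close> only in the group. This is why \<open>i = M\<close> is a
    separate case.\<close>
  define \<epsilon> where "\<epsilon> i = (if i \<le> M then \<gamma> i else \<delta> (i - M))" for i
  have "\<epsilon> (M + N) \<asymp> z"
    using \<gamma>(2) \<delta>(1,2) by (cases "N = 0") (auto simp: \<epsilon>_def intro: req_trans)
  moreover have "dist (\<epsilon> i) (\<epsilon> (Suc i)) \<le> 1" if "i < M + N" for i
  proof -
    consider "i < M" | "i = M" | "M < i" by linarith
    then show ?thesis
    proof cases
      case 2
      then have "dist (\<epsilon> i) (\<epsilon> (Suc i)) = dist (\<delta> 0) (\<delta> (Suc 0))"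
        using \<gamma>(2) \<delta>(1) by (auto simp: \<epsilon>_def intro!: dist_req)
      then show ?thesis using \<delta>(4)[of 0] 2 that by simp
    next
      case 3
      then show ?thesis using \<delta>(4)[of "i - M"] that by (simp add: \<epsilon>_def Suc_diff_le)
    next
      case 1
      then show ?thesis using \<gamma>(4)[of i] by (simp add: \<epsilon>_def)
    qed
  qed
  moreover have "A (\<epsilon> i)" if "i \<le> M + N" for i
    using that \<gamma>(3) \<delta>(3) by (auto simp: \<epsilon>_def)
  ultimately show ?thesis
    unfolding path_def using \<gamma>(1) by (intro exI[of _ \<epsilon>]) (auto simp: \<epsilon>_def)
qed

lemma path_word:
  assumes "\<And>i. i \<le> length w \<Longrightarrow> A (x @ take i w)"
  shows "path A (length w) x (x @ w)"
  unfolding path_def using assms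
  by (intro exI[of _ "\<lambda>i. x @ take i w"]) (auto simp: take_Suc_conv_app_nth)

lemma path_end: "path A N x y \<Longrightarrow> y \<asymp> z \<Longrightarrow> path A N x z"
  unfolding path_def by (elim ex_forward) (auto intro: req_trans)

lemma path_mono:
  "path A N x y \<Longrightarrow> (\<And>z. A z \<Longrightarrow> B z) \<Longrightarrow> path B N x y"
  unfolding path_def by (elim ex_forward) auto

lemma morse_path:
  assumes P: "finite P" "set w \<subseteq> P"
    and narrow: "\<And>s s'. s \<in> P \<Longrightarrow> s' \<in> P \<Longrightarrow> s' \<notin> star s \<Longrightarrow> \<exists>t. star s \<inter> star s' \<subseteq> {t}"
    and w: "geodesic w" "a + k \<le> length w"
    and path: "path (\<lambda>z. \<rho> \<le> dist z (x @ take a w)) N x (x @ w)"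
  shows "\<exists>c. k \<le> card P * c \<and> (c - 1) * (\<rho> - 2 * k - 1) \<le> N"
proof -
  obtain \<gamma> where \<gamma>: "\<gamma> 0 = x" "\<gamma> N \<asymp> x @ w" "\<And>i. i \<le> N \<Longrightarrow> \<rho> \<le> dist (\<gamma> i) (x @ take a w)"
    "\<And>i. i < N \<Longrightarrow> dist (\<gamma> i) (\<gamma> (Suc i)) \<le> 1" using path by (auto simp: path_def)
  have d: "dist (rev x @ y) z = dist y (x @ z)" for y z
    unfolding dist_def by simp
  have "rev x @ \<gamma> N \<asymp> w" using \<gamma>(2) by (simp add: req_move)
  then show ?thesis
    using \<gamma> by (intro morse_path_length[of P w a k "\<lambda>i. rev x @ \<gamma> i"] P narrow w) (auto simp: d)
qed

section \<open>Spheres\<close>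

text \<open>A local minimum \<open>y\<close> of the length along a path can be pushed outwards: the neighbours of \<open>y\<close>
  closer to \<open>1\<close> form a clique, and the other ones are joined through squares at \<open>y\<close>.\<close>

lemma sphere_connected:
  assumes conn: "\<And>D s s'. D \<subseteq> P \<Longrightarrow> (\<And>a b. a \<in> D \<Longrightarrow> b \<in> D \<Longrightarrow> b \<in> star a) \<Longrightarrow> s \<in> P - D \<Longrightarrow> s' \<in> P - D
      \<Longrightarrow> (s, s') \<in> {(a, b). a \<in> P - D \<and> b \<in> P - D \<and> {a, b} \<in> E}\<^sup>*"
    and p: "set p \<subseteq> P" "len p = n" and q: "set q \<subseteq> P" "len q = n"
  shows "(p, q) \<in> {(x, y). set x \<subseteq> P \<and> set y \<subseteq> P \<and> len x \<in> {n..n+1} \<and> len y \<in> {n..n+1} \<and>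
    dist x y \<le> 1}\<^sup>*"
proof -
  \<comment> \<open>Paths stay between the lengths \<open>k\<close> and \<open>n + 1\<close>, and
    \<open>k\<close> is raised from \<open>0\<close> to \<open>n\<close>. The squares at an element
    of length \<open>n - 1\<close> need the length \<open>n + 1\<close>.\<close>
  define R where "R k = {(x, y). set x \<subseteq> P \<and> set y \<subseteq> P \<and> len x \<in> {k..n+1} \<and> len y \<in> {k..n+1} \<and>
    dist x y \<le> 1}" for k
  have R_sym: "(x, y) \<in> (R k)\<^sup>* \<Longrightarrow> (y, x) \<in> (R k)\<^sup>*" for x y k
  proof -
    have "sym ((R k)\<^sup>*)" by (rule sym_rtrancl) (auto simp: R_def sym_def dist_sym)
    then show "(x, y) \<in> (R k)\<^sup>* \<Longrightarrow> (y, x) \<in> (R k)\<^sup>*" by (auto dest: symD)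
  qed
  have base: "([], x) \<in> (R 0)\<^sup>*" if x: "set x \<subseteq> P" "len x = n" for x
  proof -
    obtain w where w: "set w \<subseteq> P" "x \<asymp> w" "length w = n" "geodesic w"
      using special_geodesic[OF special_word[OF x(1)]] x(2) by metis
    have "([], take i w) \<in> (R 0)\<^sup>*" if "i \<le> n" for i
      using that
    proof (induction i)
      case (Suc i)
      have s: "set (take j w) \<subseteq> P" for j
        using w(1) by (meson order.trans set_take_subset)
      have "(take i w, take (Suc i) w) \<in> R 0"
        using s[of i] s[of "Suc i"] len_le_length[of "take i w"] len_le_length[of "take (Suc i) w"] Suc.prems w(3)
          len_le_length[of "[w ! i]"]
        by (auto simp: R_def take_Suc_conv_app_nth simp del: len_le_length)
      with Suc show ?case by (meson Suc_leD rtrancl.rtrancl_into_rtrancl)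
    qed simp
    from this[of n] have "([], w) \<in> (R 0)\<^sup>*" using w by simp
    moreover have "(w, x) \<in> R 0"
      using w x len_req[OF w(2)] dist_eq_0[of w x] req_sym[OF w(2)] by (simp add: R_def)
    ultimately show ?thesis by (rule rtrancl_into_rtrancl)
  qed
  have local: "(y @ [s], y @ [s']) \<in> (R (Suc k))\<^sup>*"
    if k: "Suc k \<le> n" and y: "set y \<subseteq> P" "len y = k"
      and s: "s \<in> P" "len (y @ [s]) = Suc k" and s': "s' \<in> P" "len (y @ [s']) = Suc k" for k y s s'
  proof -
    \<comment> \<open>These are the letters that shorten \<open>y\<close>. By
      \<open>side_disjoint\<close> they commute pairwise, so \<open>conn\<close> applies to their
      complement.\<close>
    define D where "D = {s \<in> P. side s (rev y)}"
    have up: "len (y @ [v]) = Suc k \<longleftrightarrow> v \<notin> D" if "v \<in> P" for v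
      using that len_snoc[of y v] len_snoc_pos[of v y] y by (auto simp: D_def)
    have sp: "set (y @ u) \<subseteq> P" if "set u \<subseteq> P" for u
      using y that by simp
    have "(s, s') \<in> {(a, b). a \<in> P - D \<and> b \<in> P - D \<and> {a, b} \<in> E}\<^sup>*"
      using s s' up side_disjoint[of _ _ "rev y"] by (intro conn) (auto simp: D_def)
    then show ?thesis
    proof (induction rule: rtrancl_induct)
      case (step a b)
      have ab: "a \<in> P" "b \<in> P" "a \<notin> D" "b \<notin> D" "{a, b} \<in> E" using step by auto
      show ?case
      proof (cases "a = b")
        case False
        have lab: "len (y @ [a]) = Suc k" "len (y @ [b]) = Suc k" using up ab by auto
        have "a \<in> star b" using ab by (auto simp: star_def insert_commute)
        then have "\<not> side b (rev (y @ [a]))"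
          using side_star[of b "[a]" "rev y"] special_word[of "[a]" "star b"] ab False
          by (simp add: D_def)
        then have l: "len (y @ [a, b]) = Suc (Suc k)"
          using len_snoc[of "y @ [a]" b] up ab by simp
        have "(y @ [a], y @ [a, b]) \<in> R (Suc k)"
          using l ab lab k sp[of "[a]"] sp[of "[a, b]"] dist_append[of "y @ [a]" "[b]"]
            len_le_length[of "[b]"] by (simp add: R_def)
        moreover have "(y @ [a, b], y @ [b]) \<in> R (Suc k)"
        proof -
          have "y @ [a, b] \<asymp> y @ [b, a]" using ab by (auto intro: req_commute)
          then have "dist (y @ [a, b]) (y @ [b]) = dist (y @ [b] @ [a]) (y @ [b])"
            by (intro dist_req) auto
          also have "\<dots> \<le> 1" using dist_append(2)[of "y @ [b]" "[a]"] len_le_length[of "[a]"] by simp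
          finally show ?thesis
            using l ab lab k sp[of "[b]"] sp[of "[a, b]"] by (simp add: R_def)
        qed
        ultimately show ?thesis using step.IH by (meson rtrancl.rtrancl_into_rtrancl)
      qed (use step in simp)
    qed simp
  qed
  have neighbour: "\<exists>u. set u \<subseteq> P \<and> length u \<le> 1 \<and> y \<asymp> x @ u"
    if "set x \<subseteq> P" "set y \<subseteq> P" "dist x y \<le> 1" for x y
  proof -
    have "special P (rev x @ y)" using that by (intro special_word) auto
    then obtain u where "set u \<subseteq> P" "rev x @ y \<asymp> u" "length u = dist x y"
      by (rule special_geodesic) (auto simp: dist_def)
    then show ?thesis using that by (auto simp: req_move)
  qed
  have push: "(p, y) \<in> (R (Suc k))\<^sup>*"
    if k: "Suc k \<le> n" and "(p, y) \<in> (R k)\<^sup>*" "Suc k \<le> len y" for k y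
  proof -
    \<comment> \<open>While the path is at length \<open>k\<close>, all continuations to length
      \<open>k + 1\<close> are kept reachable, so it does not matter through which letter the path
      leaves again.\<close>
    let ?Q = "\<lambda>y. (Suc k \<le> len y \<longrightarrow> (p, y) \<in> (R (Suc k))\<^sup>*) \<and>
      (len y = k \<longrightarrow> (\<forall>s\<in>P. len (y @ [s]) = Suc k \<longrightarrow> (p, y @ [s]) \<in> (R (Suc k))\<^sup>*))"
    have "?Q y" using that(2)
    proof (induction rule: rtrancl_induct)
      case base
      then show ?case using p k by auto
    next
      case (step x y)
      have xy: "set x \<subseteq> P" "set y \<subseteq> P" "k \<le> len x" "k \<le> len y" "len x \<le> n + 1"
        "len y \<le> n + 1" "dist x y \<le> 1"
        using step.hyps by (auto simp: R_def)
      obtain u where u: "set u \<subseteq> P" "length u \<le> 1" "y \<asymp> x @ u"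
        using neighbour[of x y] xy by blast
      obtain u' where u': "set u' \<subseteq> P" "length u' \<le> 1" "x \<asymp> y @ u'"
        using neighbour[of y x] xy dist_sym[of x y] by auto
      \<comment> \<open>Two words for one element are different points of the relation and are
        joined by a step of distance zero.\<close>
      have close: "(z, z') \<in> R (Suc k)"
        if "z \<asymp> z'" "set z \<subseteq> P" "set z' \<subseteq> P" "len z = Suc k" for z z'
        using that k len_req[OF that(1)] dist_eq_0[of z z']
        by (auto simp: R_def)
      consider "Suc k \<le> len x" "Suc k \<le> len y" | "Suc k \<le> len x" "len y = k"
        | "len x = k" "Suc k \<le> len y" | "len x = k" "len y = k" using xy by linarith
      then show ?case
      proof cases
        case 1
        then have "(x, y) \<in> R (Suc k)" using xy by (simp add: R_def)
        then show ?thesis using step.IH 1 by (auto intro: rtrancl_into_rtrancl)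
      next
        case 2
        have "u' \<noteq> []" using u'(3) 2 len_req by fastforce
        then obtain s where s: "u' = [s]" using u'(2) by (cases u') auto
        have "len (y @ [s]) \<le> len y + 1" using len_snoc[of y s] by (auto split: if_splits)
        then have ls: "len (y @ [s]) = Suc k" using len_req[OF u'(3)] s 2 by simp
        have "(x, y @ [s]) \<in> R (Suc k)"
          using u' s xy ls len_req[OF u'(3)] by (intro close) auto
        then have "(p, y @ [s]) \<in> (R (Suc k))\<^sup>*"
          using step.IH 2 by (auto intro: rtrancl_into_rtrancl)
        moreover have "(y @ [s], y @ [s']) \<in> (R (Suc k))\<^sup>*"
          if "s' \<in> P" "len (y @ [s']) = Suc k" for s'
          using k xy(2) 2(2) u'(1) s ls that by (intro local) auto
        ultimately show ?thesis using 2 by (auto intro: rtrancl_trans)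
      next
        case 3
        have "u \<noteq> []" using u(3) 3 len_req by fastforce
        then obtain s where s: "u = [s]" using u(2) by (cases u) auto
        have "len (x @ [s]) \<le> len x + 1" using len_snoc[of x s] by (auto split: if_splits)
        then have ls: "len (x @ [s]) = Suc k" using len_req[OF u(3)] s 3 by simp
        have "(x @ [s], y) \<in> R (Suc k)" using u s ls xy by (intro close) (auto intro: req_sym)
        then show ?thesis using step.IH 3 u s ls by (auto intro: rtrancl_into_rtrancl)
      next
        case 4
        have "x \<asymp> y"
        proof (cases u)
          case (Cons s t)
          then have "u = [s]" using u(2) by simp
          then have "len y \<noteq> len x"
            using len_req[OF u(3)] len_snoc[of x s] len_snoc_pos[of s x] by auto
          then show ?thesis using 4 by simp
        qed (use u in \<open>auto intro: req_sym\<close>)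
        then have e: "x @ [s] \<asymp> y @ [s]" for s by (intro req_cong) auto
        have "(x @ [s], y @ [s]) \<in> R (Suc k)" if "s \<in> P" "len (y @ [s]) = Suc k" for s
          using e xy that len_req[OF e] by (intro close) auto
        then show ?thesis using step.IH 4 len_req[OF e] by (auto intro: rtrancl_into_rtrancl)
      qed
    qed
    then show ?thesis using that by blast
  qed
  have "(p, q) \<in> (R k)\<^sup>*" if "k \<le> n" for k
    using that
  proof (induction k)
    case 0
    show ?case using R_sym[OF base[OF p]] base[OF q] by (rule rtrancl_trans)
  next
    case (Suc k)
    then show ?case using push[of k q] q by simp
  qed
  then show ?thesis by (simp add: R_def)
qed

end

lemma rtrancl_change:
  assumes "(a, b) \<in> R\<^sup>*" "(Q a :: bool) \<noteq> Q b"
  shows "\<exists>x y. (x, y) \<in> R \<and> Q x \<noteq> Q y"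
  using assms
proof (induction rule: rtrancl_induct)
  case (step y z)
  then show ?case by (cases "Q a = Q y") blast+
qed simp

text \<open>The reflections in \<open>-1/2\<close> and \<open>1/2\<close> are exchanged by
  conjugation with the sign change.\<close>

lemma dihedral_swap:
  assumes "s \<noteq> t"
  shows "racg_words.dihedral t s x n = - racg_words.dihedral s t x (- n)"
proof -
  interpret racg_words E for E .
  show ?thesis using assms by (induction x) auto
qed

context racg_words
begin

text \<open>A path from \<open>1\<close> to \<open>b\<close> through the far point \<open>alternating s t n\<close>. Projected to the infinite
  dihedral group it goes from \<open>1\<close> to that point, waits there, and returns.\<close>

lemma detour_point:
  assumes t: "t \<notin> star s" and b: "\<And>v. v \<in> set b \<Longrightarrow> v \<in> star s - {s} \<and> v \<in> star t - {t}"
  shows "\<exists>j\<le>n. dihedral s t (take i (alternating s t n @ b @ rev (alternating s t n))) 0 = - int j \<and>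
    (j < n \<longrightarrow> dist (take i (alternating s t n @ b @ rev (alternating s t n))) [] \<le> j \<or>
      dist (take i (alternating s t n @ b @ rev (alternating s t n))) b \<le> j)"
proof -
  let ?\<alpha> = "alternating s t"
  have st: "s \<noteq> t" using t by auto
  have fix_b: "dihedral s t c m = m" if "set c \<subseteq> set b" for c m
    using that b by (induction c) auto
  consider "i \<le> n" | "n < i" "i \<le> n + length b" | "n + length b < i" by linarith
  then show ?thesis
  proof cases
    case 1
    then show ?thesis using len_le_length[of "?\<alpha> i"] st
      by (intro exI[of _ i]) (auto simp: take_alternating dihedral_alternating min_def)
  next
    case 2
    have "dihedral s t (take (i - n) b) 0 = 0"
      by (intro fix_b) (auto dest: in_set_takeD)
    with 2 show ?thesis using st
      by (intro exI[of _ n]) (auto simp: dihedral_alternating)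
  next
    case 3
    \<comment> \<open>On the way back the letters already undone cancel, as \<open>b\<close>
      commutes with the ray; the point is \<open>j\<close> steps from \<open>b\<close>. Truncated
      subtraction gives \<open>j = 0\<close> past the end of the word.\<close>
    define j where "j = n - (i - n - length b)"
    have "take j (?\<alpha> n) @ drop j (?\<alpha> n) = ?\<alpha> n" by simp
    moreover have "take j (?\<alpha> n) = ?\<alpha> j" by (simp add: take_alternating j_def min_def)
    ultimately obtain d where d: "?\<alpha> n = ?\<alpha> j @ d" "d = drop j (?\<alpha> n)" by metis
    have "take i (?\<alpha> n @ b @ rev (?\<alpha> n)) = ?\<alpha> n @ b @ rev d"
      using 3 by (simp add: j_def d(2) take_rev)
    also have "?\<alpha> n @ b @ rev d \<asymp> b @ ?\<alpha> j"
    proof -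
      have "?\<alpha> n @ b \<asymp> b @ ?\<alpha> n"
      proof (rule commute_words)
        fix u v assume "u \<in> set (?\<alpha> n)" "v \<in> set b"
        then show "{u, v} \<in> E"
          using set_alternating[of s t n] b[of v] by (auto simp: star_def insert_commute)
      qed
      then have "(?\<alpha> n @ b) @ rev d \<asymp> (b @ ?\<alpha> n) @ rev d" by (rule req_cong) simp
      also have "(b @ ?\<alpha> n) @ rev d = (b @ ?\<alpha> j) @ d @ rev d @ []" using d by simp
      also have "\<dots> \<asymp> (b @ ?\<alpha> j) @ []" by (rule req_insert_cancel(4))
      finally show ?thesis by simp
    qed
    finally have eq: "take i (?\<alpha> n @ b @ rev (?\<alpha> n)) \<asymp> b @ ?\<alpha> j" .
    have "dihedral s t (take i (?\<alpha> n @ b @ rev (?\<alpha> n))) 0 = dihedral s t (b @ ?\<alpha> j) 0"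
      by (rule dihedral_req[OF t eq])
    then have 1: "dihedral s t (take i (?\<alpha> n @ b @ rev (?\<alpha> n))) 0 = - int j"
      using st by (simp add: fix_b dihedral_alternating)
    have "dist (take i (?\<alpha> n @ b @ rev (?\<alpha> n))) b = dist (b @ ?\<alpha> j) b"
      by (rule dist_req[OF eq]) simp
    then have "dist (take i (?\<alpha> n @ b @ rev (?\<alpha> n))) b \<le> j"
      using len_le_length[of "?\<alpha> j"] by simp
    with 1 show ?thesis by (intro exI[of _ j]) (auto simp: j_def)
  qed
qed

text \<open>The two points have dihedral coordinates \<open>-j\<close> and \<open>j'\<close>, and
  their distance is at most \<open>2 * d\<close>; so \<open>j\<close> is at most
  \<open>2 * d\<close> and less than \<open>n\<close>. Thus the first point is not on the distant
  middle part, but within \<open>2 * d\<close> of \<open>y\<close> or \<open>y @ b\<close>, and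
  \<open>z\<close> is at most \<open>d\<close> further away.\<close>

lemma detours_diverge:
  assumes t: "t \<notin> star s" and b: "\<And>v. v \<in> set b \<Longrightarrow> v \<in> star s - {s} \<and> v \<in> star t - {t}"
    and z: "dist (y @ take i (alternating s t n @ b @ rev (alternating s t n))) z \<le> d"
      "dist (y @ take i' (alternating t s n @ b @ rev (alternating t s n))) z \<le> d"
    and d: "2 * d < n"
  shows "dist y z \<le> 3 * d \<or> dist (y @ b) z \<le> 3 * d"
proof -
  have s: "s \<notin> star t" and st: "s \<noteq> t" using t star_sym[of s t] by auto
  let ?D = "alternating s t n @ b @ rev (alternating s t n)"
  let ?D' = "alternating t s n @ b @ rev (alternating t s n)"
  obtain j where j: "j \<le> n" "dihedral s t (take i ?D) 0 = - int j"
    "j < n \<longrightarrow> dist (take i ?D) [] \<le> j \<or> dist (take i ?D) b \<le> j"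
    using detour_point[OF t b] by blast
  obtain j' where j': "dihedral t s (take i' ?D') 0 = - int j'"
    using detour_point[OF s] b by blast
  have "dist (take i ?D) (take i' ?D') = dist (y @ take i ?D) (y @ take i' ?D')" by simp
  also have "\<dots> \<le> dist (y @ take i ?D) z + dist z (y @ take i' ?D')" by (rule dist_triangle)
  also have "\<dots> \<le> 2 * d" using z by (simp add: dist_sym[of z])
  finally have "int j + int j' \<le> int (2 * d)"
    using dihedral_lipschitz[OF t, of "take i ?D" "take i' ?D'"] dihedral_swap[OF st, of "take i' ?D'" 0] j j'
    by simp
  then have jd: "j \<le> 2 * d" by linarith
  then have "dist (take i ?D) [] \<le> j \<or> dist (take i ?D) b \<le> j" using j d by auto
  then have "dist (y @ take i ?D) (y @ []) \<le> j \<or> dist (y @ take i ?D) (y @ b) \<le> j"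
    by (simp only: dist_left)
  then show ?thesis
  proof
    assume "dist (y @ take i ?D) (y @ []) \<le> j"
    then show ?thesis
      using dist_triangle[of y z "y @ take i ?D"] z(1) jd dist_sym[of y "y @ take i ?D"] by simp
  next
    assume "dist (y @ take i ?D) (y @ b) \<le> j"
    then show ?thesis
      using dist_triangle[of "y @ b" z "y @ take i ?D"] z(1) jd dist_sym[of "y @ b" "y @ take i ?D"] by simp
  qed
qed

lemma obtain_connecting_geodesic:
  assumes "set x \<subseteq> W" "set y \<subseteq> W"
  obtains c where "set c \<subseteq> W" "geodesic c" "length c = dist x y" "x @ c \<asymp> y"
proof -
  have "special W (rev x @ y)" using assms by (intro special_word) auto
  then obtain c where "set c \<subseteq> W" "rev x @ y \<asymp> c" "length c = len (rev x @ y)" "geodesic c"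
    by (rule special_geodesic)
  then show ?thesis using that[of c] by (auto simp: dist_def req_move req_sym)
qed

lemma path_geodesic:
  assumes "x @ c \<asymp> y" "\<And>i. i \<le> length c \<Longrightarrow> A (x @ take i c)"
  shows "path A (length c) x y"
  using path_end[OF path_word[of c A x] assms(1)] assms(2) by blast

end

section \<open>Maps with sublinear error\<close>

text \<open>A sublinear biLipschitz equivalence on the level of words: the sublinear error is replaced by
  \<open>\<epsilon>\<close> times the lengths plus a constant, for every \<open>\<epsilon>\<close>.\<close>

locale coarse_map =
  X: racg_words E + Y: racg_words F
  for E :: "'v set set" and F :: "'w set set" +
  fixes V :: "'v set" and W :: "'w set" and \<phi> :: "'v list \<Rightarrow> 'w list" and L :: real
  assumes L: "1 \<le> L"
    and \<phi>_mem: "set x \<subseteq> V \<Longrightarrow> set (\<phi> x) \<subseteq> W"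
    and \<phi>_req: "set x \<subseteq> V \<Longrightarrow> set y \<subseteq> V \<Longrightarrow> X.req x y \<Longrightarrow> \<phi> x = \<phi> y"
    and bounds: "\<And>\<epsilon>::real. \<epsilon> > 0 \<Longrightarrow> \<exists>C::real. \<forall>x y. set x \<subseteq> V \<longrightarrow> set y \<subseteq> V \<longrightarrow>
        Y.dist (\<phi> x) (\<phi> y) \<le> L * X.dist x y + \<epsilon> * (X.len x + X.len y) + C \<and>
        X.dist x y \<le> L * Y.dist (\<phi> x) (\<phi> y) + \<epsilon> * (X.len x + X.len y) + C"
    and surjective: "\<And>\<epsilon>::real. \<epsilon> > 0 \<Longrightarrow> \<exists>C::real. \<forall>y. set y \<subseteq> W \<longrightarrow>
        (\<exists>x. set x \<subseteq> V \<and> Y.dist y (\<phi> x) \<le> \<epsilon> * Y.len y + C)"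
begin

lemma eventually_bounds:
  assumes "M > 0" "\<eta> > 0"
  shows "\<forall>\<^sub>F n in sequentially. \<forall>x y. set x \<subseteq> V \<longrightarrow> set y \<subseteq> V \<longrightarrow>
    X.len x \<le> M * real n \<longrightarrow> X.len y \<le> M * real n \<longrightarrow>
    Y.dist (\<phi> x) (\<phi> y) \<le> L * X.dist x y + \<eta> * real n \<and>
    X.dist x y \<le> L * Y.dist (\<phi> x) (\<phi> y) + \<eta> * real n"
proof -
  \<comment> \<open>Half of \<open>\<eta> * n\<close> pays for two lengths of at most
    \<open>M * n\<close>, the other half for the constant \<open>C\<close>.\<close>
  define \<epsilon> where "\<epsilon> = \<eta> / (4 * M)"
  have \<epsilon>: "\<epsilon> > 0" using assms by (simp add: \<epsilon>_def)
  from bounds[OF this] obtain C where C: "\<And>x y. set x \<subseteq> V \<Longrightarrow> set y \<subseteq> V \<Longrightarrow>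
        Y.dist (\<phi> x) (\<phi> y) \<le> L * X.dist x y + \<epsilon> * (X.len x + X.len y) + C \<and>
        X.dist x y \<le> L * Y.dist (\<phi> x) (\<phi> y) + \<epsilon> * (X.len x + X.len y) + C" by blast
  have "\<forall>\<^sub>F n in sequentially. C \<le> \<eta> / 2 * real n" using assms by real_asymp
  then show ?thesis
  proof (rule eventually_mono, intro allI impI)
    fix n x y
    assume n: "C \<le> \<eta> / 2 * real n" and xy: "set x \<subseteq> V" "set y \<subseteq> V"
      "X.len x \<le> M * real n" "X.len y \<le> M * real n"
    have "\<epsilon> * (X.len x + X.len y) \<le> \<epsilon> * (2 * M * real n)"
      using xy \<epsilon> by (intro mult_left_mono) auto
    also have "\<dots> = \<eta> / 2 * real n" using assms by (simp add: \<epsilon>_def)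
    finally have "\<epsilon> * (X.len x + X.len y) + C \<le> \<eta> * real n" using n by linarith
    then show "Y.dist (\<phi> x) (\<phi> y) \<le> L * X.dist x y + \<eta> * real n \<and>
      X.dist x y \<le> L * Y.dist (\<phi> x) (\<phi> y) + \<eta> * real n"
      using C[OF xy(1,2)] by linarith
  qed
qed

text \<open>The error of the map at a preimage depends on the length of this preimage, which is not
  known in advance. With the rate \<open>1 / 2\<close> half of the length can be absorbed, whence
  the factor 2 in the bound.\<close>

lemma eventually_surjective:
  assumes "M > 0" "\<eta> > 0"
  shows "\<forall>\<^sub>F n in sequentially. \<forall>y. set y \<subseteq> W \<longrightarrow> Y.len y \<le> M * real n \<longrightarrow>
    (\<exists>x. set x \<subseteq> V \<and> X.len x \<le> 2 * L * (M + 2) * real n \<and> Y.dist y (\<phi> x) \<le> \<eta> * real n)"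
proof -
  define \<epsilon> where "\<epsilon> = min \<eta> 1 / (2 * M)"
  have \<epsilon>: "\<epsilon> > 0" using assms by (simp add: \<epsilon>_def)
  from surjective[OF this] obtain C where C: "\<And>y. set y \<subseteq> W \<Longrightarrow>
      \<exists>x. set x \<subseteq> V \<and> Y.dist y (\<phi> x) \<le> \<epsilon> * Y.len y + C" by blast
  have "(1 / 2 :: real) > 0" by simp
  from bounds[OF this] obtain C' where C': "\<And>x y. set x \<subseteq> V \<Longrightarrow> set y \<subseteq> V \<Longrightarrow>
      X.dist x y \<le> L * Y.dist (\<phi> x) (\<phi> y) + 1 / 2 * (X.len x + X.len y) + C'" by blast
  have "\<forall>\<^sub>F n in sequentially. C \<le> min \<eta> 1 / 2 * real n" using assms by real_asymp
  moreover have "\<forall>\<^sub>F n in sequentially. L * Y.len (\<phi> []) + C' \<le> 1 * real n" by real_asymp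
  ultimately show ?thesis
  proof eventually_elim
    case (elim n)
    show ?case
    proof (intro allI impI)
      fix y assume y: "set y \<subseteq> W" "Y.len y \<le> M * real n"
      then obtain x where x: "set x \<subseteq> V" "Y.dist y (\<phi> x) \<le> \<epsilon> * Y.len y + C" using C by blast
      have "\<epsilon> * Y.len y \<le> \<epsilon> * (M * real n)" using y \<epsilon> by (intro mult_left_mono) auto
      also have "\<dots> = min \<eta> 1 / 2 * real n" using assms by (simp add: \<epsilon>_def)
      finally have d: "Y.dist y (\<phi> x) \<le> min \<eta> 1 * real n" using elim(1) x(2) by linarith
      have "Y.dist (\<phi> x) (\<phi> []) \<le> Y.dist y (\<phi> x) + (Y.len y + Y.len (\<phi> []))"
        using Y.dist_triangle[of "\<phi> x" "\<phi> []" y] Y.dist_triangle[of y "\<phi> []" "[]"]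
          Y.dist_sym[of "\<phi> x" y] by simp
      moreover have "min \<eta> 1 * real n \<le> 1 * real n" by (intro mult_right_mono) auto
      ultimately have "real (Y.dist (\<phi> x) (\<phi> [])) \<le> real n + M * real n + Y.len (\<phi> [])"
        using d y(2) by linarith
      then have "L * Y.dist (\<phi> x) (\<phi> []) \<le> L * (real n + M * real n + Y.len (\<phi> []))"
        using L by (intro mult_left_mono) auto
      moreover have "X.len x \<le> L * Y.dist (\<phi> x) (\<phi> []) + 1 / 2 * X.len x + C'"
        using C'[OF x(1), of "[]"] by simp
      ultimately have "X.len x \<le> 2 * (L * (real n + M * real n)) + 2 * (L * Y.len (\<phi> []) + C')"
        by (simp add: algebra_simps)
      also have "L * Y.len (\<phi> []) + C' \<le> L * real n"
        using elim(2) mult_right_mono[OF L of_nat_0_le_iff, of n] by simp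
      also have "2 * (L * (real n + M * real n)) + 2 * (L * real n) = 2 * L * (M + 2) * real n" by (simp add: algebra_simps)
      finally have "X.len x \<le> 2 * L * (M + 2) * real n" by simp
      moreover have "min \<eta> 1 * real n \<le> \<eta> * real n" by (intro mult_right_mono) auto
      ultimately show "\<exists>x. set x \<subseteq> V \<and> X.len x \<le> 2 * L * (M + 2) * real n \<and>
        Y.dist y (\<phi> x) \<le> \<eta> * real n" using x(1) d by force
    qed
  qed
qed

text \<open>Preimages are taken along the path every \<open>h\<close> steps, with \<open>h\<close>
  about \<open>\<eta> * n\<close>, and joined by geodesics of length at most
  \<open>5 * L * \<eta> * n\<close>. These are too short to come near \<open>m\<close>, and their
  number does not grow with \<open>n\<close>.\<close>

lemma eventually_pull_back:
  assumes K: "K > 0" and M: "M > 0" and r: "r > 0"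
  obtains K' where "\<forall>\<^sub>F n in sequentially. \<forall>x x' m N.
    set x \<subseteq> V \<longrightarrow> set x' \<subseteq> V \<longrightarrow> set m \<subseteq> V \<longrightarrow>
    X.len x \<le> M * real n \<longrightarrow> X.len x' \<le> M * real n \<longrightarrow> X.len m \<le> M * real n \<longrightarrow> N \<le> K * real n \<longrightarrow>
    Y.path (\<lambda>z. set z \<subseteq> W \<and> Y.len z \<le> M * real n \<and> r * real n \<le> Y.dist z (\<phi> m)) N (\<phi> x) (\<phi> x') \<longrightarrow>
    (\<exists>N'\<le>K' * real n. X.path (\<lambda>z. r / (2 * L) * real n \<le> X.dist z m) N' x x')"
proof -
  \<comment> \<open>A point on a joining geodesic loses \<open>2 * \<eta>\<close> through the errors
    of the map and \<open>5 * L\<^sup>2 * \<eta>\<close> through the length of the geodesic, in all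
    at most half of \<open>r\<close>.\<close>
  define \<eta> where "\<eta> = r / (14 * L\<^sup>2)"
  have \<eta>: "\<eta> > 0" using r L by (simp add: \<eta>_def)
  define M' where "M' = max M (2 * L * (M + 2))"
  have M': "M' > 0" "M \<le> M'" "2 * L * (M + 2) \<le> M'" using M by (auto simp: M'_def)
  have small: "2 * \<eta> + 5 * L\<^sup>2 * \<eta> \<le> r / 2"
  proof -
    have "2 * \<eta> \<le> 2 * L\<^sup>2 * \<eta>" using L \<eta> by simp
    moreover have "7 * L\<^sup>2 * \<eta> = r / 2" using L by (simp add: \<eta>_def)
    ultimately show ?thesis by linarith
  qed
  \<comment> \<open>There are at most \<open>K / \<eta>\<close> complete hops and a last
    one.\<close>
  define K' where "K' = 5 * L * (K + \<eta>)"
  have "\<forall>\<^sub>F n in sequentially. 1 \<le> \<eta> * real n" using \<eta> by real_asymp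
  from eventually_bounds[OF M'(1) \<eta>] eventually_surjective[OF M \<eta>] this
  have "\<forall>\<^sub>F n in sequentially. \<forall>x x' m N.
    set x \<subseteq> V \<longrightarrow> set x' \<subseteq> V \<longrightarrow> set m \<subseteq> V \<longrightarrow>
    X.len x \<le> M * real n \<longrightarrow> X.len x' \<le> M * real n \<longrightarrow> X.len m \<le> M * real n \<longrightarrow> N \<le> K * real n \<longrightarrow>
    Y.path (\<lambda>z. set z \<subseteq> W \<and> Y.len z \<le> M * real n \<and> r * real n \<le> Y.dist z (\<phi> m)) N (\<phi> x) (\<phi> x') \<longrightarrow>
    (\<exists>N'\<le>K' * real n. X.path (\<lambda>z. r / (2 * L) * real n \<le> X.dist z m) N' x x')"
  proof eventually_elim
    case (elim n)
    show ?case
    proof (intro allI impI)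
      fix x x' m N
      assume V: "set x \<subseteq> V" "set x' \<subseteq> V" "set m \<subseteq> V"
        and len: "X.len x \<le> M * real n" "X.len x' \<le> M * real n" "X.len m \<le> M * real n"
        and N: "N \<le> K * real n"
        and path: "Y.path (\<lambda>z. set z \<subseteq> W \<and> Y.len z \<le> M * real n \<and> r * real n \<le> Y.dist z (\<phi> m)) N (\<phi> x) (\<phi> x')"
      let ?A = "\<lambda>z. r / (2 * L) * real n \<le> X.dist z m"
      obtain \<delta> where \<delta>: "\<delta> 0 = \<phi> x" "Y.req (\<delta> N) (\<phi> x')"
        "\<And>i. i \<le> N \<Longrightarrow> set (\<delta> i) \<subseteq> W \<and> Y.len (\<delta> i) \<le> M * real n \<and> r * real n \<le> Y.dist (\<delta> i) (\<phi> m)"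
        "\<And>i. i < N \<Longrightarrow> Y.dist (\<delta> i) (\<delta> (Suc i)) \<le> 1"
        using path by (auto simp: Y.path_def)
      have M'n: "M * real n \<le> M' * real n" "2 * L * (M + 2) * real n \<le> M' * real n"
        using M' by (auto intro!: mult_right_mono)
      have "\<forall>i. \<exists>z. i \<le> N \<longrightarrow> set z \<subseteq> V \<and> X.len z \<le> M' * real n \<and> Y.dist (\<delta> i) (\<phi> z) \<le> \<eta> * real n \<and>
        (i = 0 \<longrightarrow> z = x)"
      proof
        fix i
        show "\<exists>z. i \<le> N \<longrightarrow> set z \<subseteq> V \<and> X.len z \<le> M' * real n \<and> Y.dist (\<delta> i) (\<phi> z) \<le> \<eta> * real n \<and>
          (i = 0 \<longrightarrow> z = x)"
        proof (cases "i = 0")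
          case True
          then show ?thesis using V len M'n \<delta>(1) \<eta> by (intro exI[of _ x]) auto
        next
          case False
          then show ?thesis using elim(2) \<delta>(3)[of i] M'n by (meson order_trans)
        qed
      qed
      from choice[OF this] obtain \<xi> where "\<forall>i. i \<le> N \<longrightarrow> set (\<xi> i) \<subseteq> V \<and> X.len (\<xi> i) \<le> M' * real n \<and>
        Y.dist (\<delta> i) (\<phi> (\<xi> i)) \<le> \<eta> * real n \<and> (i = 0 \<longrightarrow> \<xi> i = x)" ..
      then have \<xi>: "\<And>i. i \<le> N \<Longrightarrow> set (\<xi> i) \<subseteq> V" "\<And>i. i \<le> N \<Longrightarrow> X.len (\<xi> i) \<le> M' * real n"
        "\<And>i. i \<le> N \<Longrightarrow> Y.dist (\<delta> i) (\<phi> (\<xi> i)) \<le> \<eta> * real n" "\<xi> 0 = x" by auto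
      \<comment> \<open>The factor 3 allows for \<open>h\<close>, which is at most
        \<open>2 * \<eta> * n\<close>, and for the error at the next preimage. The error at
        \<open>\<xi> i\<close> makes it 4, and the lower bound for the map turns this into
        \<open>5 * L\<close>.\<close>
      have hop: "\<exists>k\<le>5 * L * \<eta> * real n. X.path ?A k (\<xi> i) z"
        if i: "i \<le> N" and z: "set z \<subseteq> V" "X.len z \<le> M' * real n" "Y.dist (\<delta> i) (\<phi> z) \<le> 3 * \<eta> * real n" for i z
      proof -
        obtain c where c: "length c = X.dist (\<xi> i) z" "X.req (\<xi> i @ c) z"
          using X.obtain_connecting_geodesic[OF \<xi>(1)[OF i] z(1)] by metis
        have "real (Y.dist (\<phi> (\<xi> i)) (\<phi> z)) \<le> Y.dist (\<delta> i) (\<phi> (\<xi> i)) + Y.dist (\<delta> i) (\<phi> z)"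
          using Y.dist_triangle[of "\<phi> (\<xi> i)" "\<phi> z" "\<delta> i"] Y.dist_sym[of "\<phi> (\<xi> i)" "\<delta> i"] by linarith
        then have "real (Y.dist (\<phi> (\<xi> i)) (\<phi> z)) \<le> 4 * \<eta> * real n" using \<xi>(3)[OF i] z(3) by linarith
        then have "L * Y.dist (\<phi> (\<xi> i)) (\<phi> z) \<le> L * (4 * \<eta> * real n)" using L by (intro mult_left_mono) auto
        moreover have "X.dist (\<xi> i) z \<le> L * Y.dist (\<phi> (\<xi> i)) (\<phi> z) + \<eta> * real n"
          using elim(1) \<xi>(1,2)[OF i] z by blast
        moreover have "1 * (\<eta> * real n) \<le> L * (\<eta> * real n)" using L \<eta> by (intro mult_right_mono) auto
        ultimately have lc: "real (length c) \<le> 5 * L * \<eta> * real n" by (simp add: c(1))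
        have "?A (\<xi> i @ take j c)" for j
        proof -
          have "r * real n \<le> Y.dist (\<phi> (\<xi> i)) (\<phi> m) + \<eta> * real n"
            using \<delta>(3)[OF i] \<xi>(3)[OF i] Y.dist_triangle[of "\<delta> i" "\<phi> m" "\<phi> (\<xi> i)"] by linarith
          moreover have "Y.dist (\<phi> (\<xi> i)) (\<phi> m) \<le> L * X.dist (\<xi> i) m + \<eta> * real n"
            using elim(1) \<xi>(1,2)[OF i] V(3) len(3) M'n(1) by (meson order_trans)
          moreover have "X.dist (\<xi> i) m \<le> X.len (take j c) + X.dist (\<xi> i @ take j c) m"
            using X.dist_triangle[of "\<xi> i" m "\<xi> i @ take j c"] by simp
          then have "L * X.dist (\<xi> i) m \<le> L * (5 * L * \<eta> * real n + X.dist (\<xi> i @ take j c) m)"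
            using lc X.len_le_length[of "take j c"] L by (intro mult_left_mono) auto
          ultimately have "r * real n \<le> (2 * \<eta> + 5 * L\<^sup>2 * \<eta>) * real n + L * X.dist (\<xi> i @ take j c) m"
            by (simp add: algebra_simps power2_eq_square)
          also have "\<dots> \<le> r / 2 * real n + L * X.dist (\<xi> i @ take j c) m"
            using small by (intro add_right_mono mult_right_mono) auto
          finally have "r / 2 * real n \<le> L * X.dist (\<xi> i @ take j c) m" by linarith
          then show ?thesis using L by (simp add: field_simps)
        qed
        then have "X.path ?A (length c) (\<xi> i) z" using c(2) by (intro X.path_geodesic) auto
        then show ?thesis using lc by blast
      qed
      define h where "h = nat \<lceil>\<eta> * real n\<rceil>"
      have h: "\<eta> * real n \<le> real h" "real h \<le> 2 * (\<eta> * real n)" "h > 0"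
        using elim(3) unfolding h_def by linarith+
      have chain: "\<exists>k\<le>real j * (5 * L * \<eta> * real n). X.path ?A k x (\<xi> (j * h))" if "j * h \<le> N" for j
        using that
      proof (induction j)
        case 0
        have "X.path ?A 0 x x"
        proof (rule X.path_refl)
          obtain k where "X.path ?A k (\<xi> 0) x"
            using hop[of 0 x] V len M'n \<delta>(1) \<eta> by auto
          then show "?A x" using \<xi>(4) by (auto simp: X.path_def)
        qed simp
        then show ?case using \<xi>(4) by (intro exI[of _ 0]) simp
      next
        case (Suc j)
        have jh: "j * h \<le> N" "Suc j * h \<le> N" using Suc.prems by auto
        obtain k where k: "real k \<le> real j * (5 * L * \<eta> * real n)" "X.path ?A k x (\<xi> (j * h))"
          using Suc.IH jh(1) by blast
        have "Y.dist (\<delta> (j * h)) (\<delta> (Suc j * h)) \<le> Suc j * h - j * h"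
          using jh by (intro Y.dist_steps[of N \<delta>] \<delta>(4)) auto
        then have "Y.dist (\<delta> (j * h)) (\<phi> (\<xi> (Suc j * h))) \<le> h + Y.dist (\<delta> (Suc j * h)) (\<phi> (\<xi> (Suc j * h)))"
          using Y.dist_triangle[of "\<delta> (j * h)" "\<phi> (\<xi> (Suc j * h))" "\<delta> (Suc j * h)"] by simp
        then have "Y.dist (\<delta> (j * h)) (\<phi> (\<xi> (Suc j * h))) \<le> 3 * \<eta> * real n"
          using \<xi>(3)[OF jh(2)] h by linarith
        then obtain k' where k': "real k' \<le> 5 * L * \<eta> * real n" "X.path ?A k' (\<xi> (j * h)) (\<xi> (Suc j * h))"
          using hop[OF jh(1)] \<xi>(1,2)[OF jh(2)] by blast
        have "X.path ?A (k + k') x (\<xi> (Suc j * h))" using k(2) k'(2) by (rule X.path_trans)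
        then show ?case using k(1) k'(1) by (intro exI[of _ "k + k'"]) (simp add: algebra_simps)
      qed
      define j where "j = N div h"
      have jh: "j * h \<le> N" "N < j * h + h"
        using h(3) by (simp_all add: j_def) (metis add.commute div_mult_mod_eq mod_less_divisor nat_add_left_cancel_less)
      obtain k where k: "real k \<le> real j * (5 * L * \<eta> * real n)" "X.path ?A k x (\<xi> (j * h))"
        using chain jh(1) by blast
      have "Y.dist (\<delta> (j * h)) (\<delta> N) \<le> N - j * h"
        using jh by (intro Y.dist_steps[of N \<delta>] \<delta>(4)) auto
      moreover have "Y.dist (\<delta> (j * h)) (\<phi> x') = Y.dist (\<delta> (j * h)) (\<delta> N)"
        using \<delta>(2) by (intro Y.dist_req) (auto intro: Y.req_sym)
      ultimately have "Y.dist (\<delta> (j * h)) (\<phi> x') \<le> h" using jh(2) by linarith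
      then have "Y.dist (\<delta> (j * h)) (\<phi> x') \<le> 3 * \<eta> * real n" using h elim(3) by linarith
      then obtain k' where k': "real k' \<le> 5 * L * \<eta> * real n" "X.path ?A k' (\<xi> (j * h)) x'"
        using hop[OF jh(1)] V(2) len(2) M'n(1) by (meson order_trans)
      have "real j * (\<eta> * real n) \<le> real j * real h" using h by (intro mult_left_mono) auto
      also have "\<dots> \<le> K * real n" using jh(1) N by (metis of_nat_le_iff of_nat_mult order_trans)
      finally have "5 * L * (real j * (\<eta> * real n)) \<le> 5 * L * (K * real n)"
        using L by (intro mult_left_mono) auto
      then have "real (k + k') \<le> K' * real n"
        using k(1) k'(1) by (simp add: K'_def algebra_simps)
      then show "\<exists>N'\<le>K' * real n. X.path ?A N' x x'"
        using X.path_trans[OF k(2) k'(2)] by blast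
    qed
  qed
  then show ?thesis by (rule that)
qed

text \<open>Pulled back to the source, such a path of length \<open>O(n)\<close> would avoid a ball of radius linear in
  \<open>n\<close> around a point in the middle of a geodesic, which takes quadratic time.\<close>

lemma eventually_cut_point:
  assumes P: "finite P" "P \<subseteq> V"
    and narrow: "\<forall>s\<in>P. \<forall>s'\<in>P - X.star s. \<exists>t. X.star s \<inter> X.star s' \<subseteq> {t}"
    and K: "K > 0" and M: "M > 0" and r: "r > 0" and c: "c > 0"
  shows "\<forall>\<^sub>F n in sequentially. \<forall>x w a N. set x \<subseteq> V \<longrightarrow> set w \<subseteq> P \<longrightarrow> X.geodesic w \<longrightarrow>
    X.len x \<le> M * real n \<longrightarrow> length w \<le> M * real n \<longrightarrow> a + c * real n \<le> length w \<longrightarrow> N \<le> K * real n \<longrightarrow>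
    \<not> Y.path (\<lambda>z. set z \<subseteq> W \<and> Y.len z \<le> M * real n \<and> r * real n \<le> Y.dist z (\<phi> (x @ take a w)))
      N (\<phi> x) (\<phi> (x @ w))"
proof -
  obtain K' where K': "\<forall>\<^sub>F n in sequentially. \<forall>x x' m N.
    set x \<subseteq> V \<longrightarrow> set x' \<subseteq> V \<longrightarrow> set m \<subseteq> V \<longrightarrow>
    X.len x \<le> 2 * M * real n \<longrightarrow> X.len x' \<le> 2 * M * real n \<longrightarrow> X.len m \<le> 2 * M * real n \<longrightarrow> N \<le> K * real n \<longrightarrow>
    Y.path (\<lambda>z. set z \<subseteq> W \<and> Y.len z \<le> 2 * M * real n \<and> r * real n \<le> Y.dist z (\<phi> m)) N (\<phi> x) (\<phi> x') \<longrightarrow>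
    (\<exists>N'\<le>K' * real n. X.path (\<lambda>z. r / (2 * L) * real n \<le> X.dist z m) N' x x')"
    using eventually_pull_back[OF K, of "2 * M" r] M r by auto
  \<comment> \<open>About \<open>\<kappa> * n\<close> letters after position \<open>a\<close> are
    used as \<open>k\<close>. The bound by \<open>c\<close> ensures that they exist; the other one
    leaves \<open>\<rho> - 2 * k - 1\<close> at least \<open>\<beta> * n - 2\<close>, since
    \<open>1/2 - 2/16 = 3/8\<close>. Some letter occurs at a rate of about \<open>\<alpha>\<close>,
    so the length needed is quadratic in \<open>n\<close>.\<close>
  define \<kappa> where "\<kappa> = min c (r / (16 * L))"
  have \<kappa>: "\<kappa> > 0" "\<kappa> \<le> c" "\<kappa> \<le> r / (16 * L)" using c r L by (auto simp: \<kappa>_def)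
  define \<alpha> where "\<alpha> = \<kappa> / (card P + 1)"
  define \<beta> where "\<beta> = 3 * r / (8 * L)"
  have \<alpha>\<beta>: "\<alpha> > 0" "\<beta> > 0" using \<kappa> r L by (auto simp: \<alpha>_def \<beta>_def)
  have "\<forall>\<^sub>F n in sequentially. K' * real n < (\<alpha> * real n - 2) * (\<beta> * real n - 2)"
    "\<forall>\<^sub>F n in sequentially. 0 \<le> \<alpha> * real n - 2" "\<forall>\<^sub>F n in sequentially. 0 \<le> \<beta> * real n - 2"
    using \<alpha>\<beta> by real_asymp+
  with K' show ?thesis
  proof eventually_elim
    case (elim n)
    show ?case
    proof (intro allI impI notI)
      fix x w a N
      assume x: "set x \<subseteq> V" "X.len x \<le> M * real n"
        and w: "set w \<subseteq> P" "X.geodesic w" "length w \<le> M * real n" "a + c * real n \<le> length w"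
        and N: "N \<le> K * real n"
        and path: "Y.path (\<lambda>z. set z \<subseteq> W \<and> Y.len z \<le> M * real n \<and>
          r * real n \<le> Y.dist z (\<phi> (x @ take a w))) N (\<phi> x) (\<phi> (x @ w))"
      let ?m = "x @ take a w"
      have len: "X.len (x @ u) \<le> 2 * M * real n" if "length u \<le> length w" for u
        using X.len_append[of x u] X.len_le_length[of u] that x(2) w(3) by linarith
      have Mn: "M * real n \<le> 2 * M * real n" using M by simp
      have V: "set (x @ w) \<subseteq> V" "set ?m \<subseteq> V"
        using x(1) w(1) P(2) set_take_subset[of a w] by auto
      have "Y.path (\<lambda>z. set z \<subseteq> W \<and> Y.len z \<le> 2 * M * real n \<and> r * real n \<le> Y.dist z (\<phi> ?m))
        N (\<phi> x) (\<phi> (x @ w))"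
        by (rule Y.path_mono[OF path]) (use Mn in auto)
      then obtain N' where N': "N' \<le> K' * real n"
        "X.path (\<lambda>z. r / (2 * L) * real n \<le> X.dist z ?m) N' x (x @ w)"
        using elim(1)[rule_format, of x "x @ w" ?m N] x(1) V N len[of "[]"] len[of w] len[of "take a w"]
        by auto
      define \<rho> where "\<rho> = nat \<lfloor>r / (2 * L) * real n\<rfloor>"
      define k where "k = nat \<lfloor>\<kappa> * real n\<rfloor>"
      have nonneg: "0 \<le> r / (2 * L) * real n" "0 \<le> \<kappa> * real n" using r L \<kappa> by auto
      have \<rho>: "real \<rho> \<le> r / (2 * L) * real n" "r / (2 * L) * real n - 1 \<le> real \<rho>"
        using nonneg unfolding \<rho>_def by linarith+
      have k: "real k \<le> \<kappa> * real n" "\<kappa> * real n - 1 \<le> real k"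
        using nonneg unfolding k_def by linarith+
      have "\<kappa> * real n \<le> c * real n" using \<kappa> by (intro mult_right_mono) auto
      then have ak: "a + k \<le> length w" using k w(4) by linarith
      have "X.path (\<lambda>z. \<rho> \<le> X.dist z ?m) N' x (x @ w)"
        using N'(2) by (rule X.path_mono) (use \<rho>(1) in linarith)
      then have "\<exists>d. k \<le> card P * d \<and> (d - 1) * (\<rho> - 2 * k - 1) \<le> N'"
        using P(1) w(1,2) narrow ak by (intro X.morse_path[of P w a k \<rho> x N']) auto
      then obtain d where d: "k \<le> card P * d" "(d - 1) * (\<rho> - 2 * k - 1) \<le> N'" by blast
      have "\<kappa> * real n \<le> r / (16 * L) * real n" using \<kappa> by (intro mult_right_mono) auto
      then have "\<beta> * real n - 2 \<le> real \<rho> - 2 * real k - 1"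
        using k(1) \<rho>(2) by (simp add: \<beta>_def)
      then have D: "\<beta> * real n - 2 \<le> real (\<rho> - 2 * k - 1)" by linarith
      have "real k \<le> real (card P) * real d" using d(1) by (metis of_nat_le_iff of_nat_mult)
      then have "\<kappa> * real n \<le> real (card P) * real d + 1" using k(2) by linarith
      also have "\<dots> \<le> (card P + 1) * (real d + 1)" by (simp add: algebra_simps)
      finally have "\<alpha> * real n \<le> real d + 1"
        by (simp add: \<alpha>_def divide_le_eq mult.commute)
      then have d': "\<alpha> * real n - 2 \<le> real (d - 1)" by linarith
      have "(\<alpha> * real n - 2) * (\<beta> * real n - 2) \<le> real (d - 1) * real (\<rho> - 2 * k - 1)"
        using d' D elim(3,4) by (intro mult_mono) auto
      also have "\<dots> \<le> real N'" using d(2) by (metis of_nat_le_iff of_nat_mult)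
      finally show False using N'(1) elim(2) by linarith
    qed
  qed
qed

text \<open>In the source, \<open>narrow\<close> yields the quadratic bound, \<open>conn\<close> the
  connected spheres, and \<open>s\<^sub>0\<close>, \<open>t\<^sub>0\<close> two opposite rays. In
  the target, \<open>twin\<close> supplies the infinite dihedral factor that commutes with the
  neighbours of \<open>s\<close>.\<close>

lemma impossible:
  assumes P: "finite P" "P \<subseteq> V" "s\<^sub>0 \<in> P" "t\<^sub>0 \<in> P" "t\<^sub>0 \<notin> X.star s\<^sub>0"
    and narrow: "\<forall>s\<in>P. \<forall>s'\<in>P - X.star s. \<exists>t. X.star s \<inter> X.star s' \<subseteq> {t}"
    and conn: "\<And>D s s'. D \<subseteq> P \<Longrightarrow> (\<And>a b. a \<in> D \<Longrightarrow> b \<in> D \<Longrightarrow> b \<in> X.star a) \<Longrightarrow> s \<in> P - D \<Longrightarrow> s' \<in> P - D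
      \<Longrightarrow> (s, s') \<in> {(a, b). a \<in> P - D \<and> b \<in> P - D \<and> {a, b} \<in> E}\<^sup>*"
    and twin: "\<And>s. s \<in> W \<Longrightarrow> \<exists>s'\<in>W. s' \<notin> Y.star s \<and> Y.star s - {s} \<subseteq> Y.star s' - {s'}"
    and W: "\<And>s. s \<in> W \<Longrightarrow> Y.star s \<subseteq> W"
  shows False
proof -
  \<comment> \<open>Points at distance about \<open>n / 2\<close> then have images at least
    \<open>8 * r * n\<close> apart. At the end \<open>detours_diverge\<close> costs
    \<open>3 * r * n\<close>, and passing from \<open>y\<close> or \<open>y @ b\<close> to the image
    of an end point costs another \<open>r * n\<close>.\<close>
  define r where "r = 1 / (32 * L)"
  define \<eta> where "\<eta> = r / 4"
  have r: "r > 0" "r \<le> 1 / 32" and \<eta>: "\<eta> > 0" "\<eta> \<le> 1 / 128" "2 * \<eta> \<le> r" and L0: "L > 0"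
    using L by (auto simp: r_def \<eta>_def divide_le_eq)
  define M where "M = 20 * L"
  have M: "M > 0" using L by (simp add: M_def)
  have c: "(1 / 4 :: real) > 0" by simp
  have "\<forall>\<^sub>F n in sequentially. 8 \<le> real n" "\<forall>\<^sub>F n in sequentially. Y.len (\<phi> []) \<le> 1 * real n"
    "\<forall>\<^sub>F n in sequentially. L + 2 \<le> \<eta> * real n"
    using \<eta> by real_asymp+
  with eventually_cut_point[OF P(1,2) narrow M M r(1) c] eventually_bounds[OF M \<eta>(1)]
  have "\<forall>\<^sub>F n in sequentially. False"
  proof eventually_elim
    case (elim n)
    let ?n = "real n"
    define B where "B = M * ?n"
    note cut = elim(1)[rule_format, folded B_def] and bnd = elim(2)[rule_format, folded B_def]
    have Ln: "?n \<le> L * ?n" "8 \<le> L * ?n"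
      using elim(3) mult_right_mono[OF L of_nat_0_le_iff, of n] by linarith+
    have \<eta>n: "\<eta> * ?n \<le> ?n / 8" "r * ?n \<le> ?n / 32" "2 * (\<eta> * ?n) \<le> r * ?n" "r * ?n > 0" "\<eta> * ?n > 0"
      using mult_right_mono[OF \<eta>(2), of ?n] mult_right_mono[OF r(2), of ?n]
        mult_right_mono[OF \<eta>(3), of ?n] elim(3) r \<eta> by (simp_all add: algebra_simps)
    have Mn: "2 * ?n \<le> B" "B = 20 * (L * ?n)" using Ln elim(3) by (auto simp: B_def M_def)
    have upper: "Y.dist (\<phi> x) (\<phi> y) \<le> L * X.dist x y + \<eta> * ?n"
      and lower: "X.dist x y \<le> L * Y.dist (\<phi> x) (\<phi> y) + \<eta> * ?n"
      if "set x \<subseteq> V" "set y \<subseteq> V" "X.len x \<le> 2 * ?n" "X.len y \<le> 2 * ?n" for x y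
      using bnd[of x y] that Mn by auto
    have far: "8 * (r * ?n) \<le> Y.dist (\<phi> x) (\<phi> y)"
      if "set x \<subseteq> V" "set y \<subseteq> V" "X.len x \<le> 2 * ?n" "X.len y \<le> 2 * ?n" "?n / 2 - 1 \<le> X.dist x y" for x y
    proof -
      have "?n / 4 \<le> L * Y.dist (\<phi> x) (\<phi> y)"
        using lower[OF that(1-4)] that(5) \<eta>n(1) elim(3) by linarith
      then show ?thesis using L0 by (simp add: r_def field_simps)
    qed
    have len_\<phi>: "Y.len (\<phi> x) \<le> 4 * (L * ?n)" if "set x \<subseteq> V" "X.len x \<le> 2 * ?n" for x
    proof -
      have "L * X.len x \<le> L * (2 * ?n)" using that L0 by (intro mult_left_mono) auto
      then have "Y.dist (\<phi> x) (\<phi> []) \<le> L * (2 * ?n) + \<eta> * ?n"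
        using upper[of x "[]"] that by simp
      moreover have "Y.len (\<phi> x) \<le> Y.dist (\<phi> x) (\<phi> []) + Y.len (\<phi> [])"
        using Y.dist_triangle[of "\<phi> x" "[]" "\<phi> []"] by simp
      ultimately show ?thesis using elim(4) \<eta>n(1) Ln by simp
    qed
    define p where "p = alternating s\<^sub>0 t\<^sub>0 n"
    define q where "q = alternating t\<^sub>0 s\<^sub>0 n"
    have pq: "set p \<subseteq> P" "set q \<subseteq> P" "length p = n" "length q = n"
      using P set_alternating[of s\<^sub>0 t\<^sub>0 n] set_alternating[of t\<^sub>0 s\<^sub>0 n] by (auto simp: p_def q_def)
    have pq_geo: "X.geodesic p" "X.geodesic q" "X.geodesic (rev p @ q)"
      unfolding p_def q_def using P(5) X.star_sym[of s\<^sub>0 t\<^sub>0]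
      by (auto intro: X.geodesic_alternating)
    have pq_len: "X.len p = n" "X.len q = n" using pq_geo pq by (simp_all add: X.geodesic_def)
    have pq_V: "set p \<subseteq> V" "set q \<subseteq> V" using pq P(2) by auto
    have \<phi>_pq: "\<phi> (p @ rev p @ q) = \<phi> q" "\<phi> (p @ rev p) = \<phi> []"
      using pq_V by (auto intro!: \<phi>_req)
    obtain c where c: "set c \<subseteq> W" "Y.geodesic c" "length c = Y.dist (\<phi> p) (\<phi> q)" "Y.req (\<phi> p @ c) (\<phi> q)"
      using Y.obtain_connecting_geodesic[OF \<phi>_mem[OF pq_V(1)] \<phi>_mem[OF pq_V(2)]] by metis
    have "X.dist p q \<le> 2 * n" using X.dist_triangle[of p q "[]"] pq_len by simp
    then have "L * X.dist p q \<le> L * (2 * ?n)" using L0 by (intro mult_left_mono) auto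
    then have lc: "length c \<le> 3 * (L * ?n)"
      using upper[of p q] pq_V pq_len c(3) \<eta>n(1) Ln by simp
    \<comment> \<open>Otherwise \<open>c\<close> would contradict \<open>cut\<close> for the
      geodesic \<open>rev p @ q\<close> issuing from \<open>p\<close>, which is at the identity
      after \<open>n\<close> letters.\<close>
    have "\<exists>i\<le>length c. Y.dist (\<phi> p @ take i c) (\<phi> []) < r * ?n"
    proof (rule ccontr)
      assume near: "\<not> ?thesis"
      let ?A = "\<lambda>z. set z \<subseteq> W \<and> Y.len z \<le> B \<and> r * ?n \<le> Y.dist z (\<phi> [])"
      have "Y.path ?A (length c) (\<phi> p) (\<phi> q)"
      proof (rule Y.path_geodesic[OF c(4)])
        fix i assume i: "i \<le> length c"
        have "Y.len (\<phi> p @ take i c) \<le> Y.len (\<phi> p) + length c"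
          using Y.len_append[of "\<phi> p" "take i c"] Y.len_le_length[of "take i c"] by simp
        then have "Y.len (\<phi> p @ take i c) \<le> B"
          using len_\<phi>[OF pq_V(1)] pq_len lc Ln Mn(2) by simp
        moreover have "set (\<phi> p @ take i c) \<subseteq> W"
          using \<phi>_mem[OF pq_V(1)] c(1) set_take_subset[of i c] by auto
        ultimately show "?A (\<phi> p @ take i c)" using near i by (auto simp: not_less)
      qed
      then show False
        using cut[of p "rev p @ q" n "length c"] pq pq_V pq_geo pq_len lc \<phi>_pq Mn Ln by simp
    qed
    then obtain i where i: "i \<le> length c" "Y.dist (\<phi> p @ take i c) (\<phi> []) < r * ?n" by blast
    define y where "y = \<phi> p @ take i c"
    have y: "set y \<subseteq> W" "Y.dist y (\<phi> []) < r * ?n"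
      using \<phi>_mem[OF pq_V(1)] c(1) set_take_subset[of i c] i by (auto simp: y_def)
    \<comment> \<open>A letter of \<open>c\<close> has to follow \<open>y\<close>, as its wall is
      used; \<open>y\<close> is not the end because \<open>\<phi> q\<close> is far from
      \<open>\<phi> []\<close>.\<close>
    have "i \<noteq> length c"
    proof
      assume "i = length c"
      then have "Y.dist y (\<phi> []) = Y.dist (\<phi> q) (\<phi> [])"
        using c(4) by (intro Y.dist_req) (auto simp: y_def)
      then show False using far[of q "[]"] pq_V pq_len elim(3) y(2) \<eta>n(4) by simp
    qed
    then have ic: "i < length c" using i by simp
    define s where "s = c ! i"
    have s: "s \<in> W" using c(1) ic by (auto simp: s_def)
    have "\<not> Y.side s (rev y @ \<phi> p)"
    proof -
      have "Y.req (rev y @ \<phi> p) (rev (take i c))"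
        using Y.req_insert_cancel(3)[of "rev (take i c)" "\<phi> p" "[]"] by (simp add: y_def)
      then show ?thesis using Y.geodesic_separates(1)[OF c(2) ic] Y.side_req by (auto simp: s_def)
    qed
    moreover have "Y.side s (rev y @ \<phi> q)"
    proof -
      have "Y.req (rev y @ \<phi> q) (rev y @ \<phi> p @ c)" using c(4) by (simp add: Y.req_sym)
      moreover have "Y.req (rev y @ \<phi> p @ c) (rev (take i c) @ c)"
        using Y.req_insert_cancel(3)[of "rev (take i c)" "\<phi> p" c] by (simp add: y_def)
      ultimately have "Y.req (rev y @ \<phi> q) (rev (take i c) @ c)" by (rule Y.req_trans)
      then show ?thesis using Y.geodesic_separates(2)[OF c(2) ic] Y.side_req by (auto simp: s_def)
    qed
    ultimately have sides: "Y.side s (rev y @ \<phi> p) \<noteq> Y.side s (rev y @ \<phi> q)" by blast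
    \<comment> \<open>The images along a path in this annulus change sides of the wall between two
      consecutive points. The short geodesic \<open>d\<close> between these images meets the wall at
      \<open>z\<close>.\<close>
    let ?R = "{(x, y). set x \<subseteq> P \<and> set y \<subseteq> P \<and> X.len x \<in> {n..n + 1} \<and> X.len y \<in> {n..n + 1} \<and> X.dist x y \<le> 1}"
    have "(p, q) \<in> ?R\<^sup>*"
      using pq pq_len by (intro X.sphere_connected conn)
    then have "\<exists>u u'. (u, u') \<in> ?R \<and> Y.side s (rev y @ \<phi> u) \<noteq> Y.side s (rev y @ \<phi> u')"
      using sides by (rule rtrancl_change)
    then obtain u u' where u: "set u \<subseteq> P" "set u' \<subseteq> P" "X.len u \<in> {n..n + 1}" "X.len u' \<in> {n..n + 1}"
      "X.dist u u' \<le> 1" "Y.side s (rev y @ \<phi> u) \<noteq> Y.side s (rev y @ \<phi> u')" by blast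
    have uV: "set u \<subseteq> V" "set u' \<subseteq> V" "X.len u \<le> 2 * ?n" "X.len u' \<le> 2 * ?n"
      using u P(2) elim(3) by auto
    obtain d where d: "set d \<subseteq> W" "length d = Y.dist (\<phi> u) (\<phi> u')" "Y.req (\<phi> u @ d) (\<phi> u')"
      using Y.obtain_connecting_geodesic[OF \<phi>_mem[OF uV(1)] \<phi>_mem[OF uV(2)]] by metis
    have "L * X.dist u u' \<le> L * 1" using u(5) L0 by (intro mult_left_mono) auto
    then have ld: "length d \<le> L + \<eta> * ?n" using upper[OF uV] d(2) by simp
    have "Y.side s (rev y @ \<phi> u') = Y.side s ((rev y @ \<phi> u) @ d)"
      using d(3) by (intro Y.side_req) (simp add: Y.req_sym)
    then have "Y.side s (rev y @ \<phi> u) \<noteq> Y.side s ((rev y @ \<phi> u) @ d)" using u(6) by simp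
    then obtain t where t: "t < length d" "Y.special (Y.star s) ((rev y @ \<phi> u) @ take t d)"
      by (rule Y.side_first_crossing) blast
    define z where "z = \<phi> u @ take t d"
    have "Y.special (Y.star s) (rev y @ z)" using t(2) by (simp add: z_def)
    \<comment> \<open>A final letter \<open>s\<close> is dropped at the cost of 1, because the
      remaining word has to commute with the twin of \<open>s\<close> as well.\<close>
    then obtain b\<^sub>0 where b\<^sub>0: "set b\<^sub>0 \<subseteq> Y.star s - {s}" "Y.req (rev y @ z) b\<^sub>0 \<or> Y.req (rev y @ z) (b\<^sub>0 @ [s])"
      by (rule Y.special_star_cases)
    obtain b where b: "set b \<subseteq> Y.star s - {s}" "Y.req b\<^sub>0 b" "length b = Y.len b\<^sub>0" "Y.geodesic b"
      using Y.special_geodesic[OF Y.special_word[OF b\<^sub>0(1)]] by metis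
    have zb: "Y.dist z (y @ b) \<le> 1"
    proof -
      have "Y.dist z (y @ b) = Y.dist (rev y @ z) b"
        unfolding Y.dist_def by simp
      also have "\<dots> = Y.dist (rev y @ z) b\<^sub>0" by (rule Y.dist_req) (auto simp: b(2) Y.req_sym)
      also have "\<dots> \<le> 1" using b\<^sub>0(2)
      proof
        assume "Y.req (rev y @ z) (b\<^sub>0 @ [s])"
        then have "Y.dist (rev y @ z) b\<^sub>0 = Y.dist (b\<^sub>0 @ [s]) b\<^sub>0" by (intro Y.dist_req) auto
        then show ?thesis by simp
      qed (simp add: Y.dist_eq_0[THEN iffD2])
      finally show ?thesis .
    qed
    have "Y.dist (\<phi> u) (y @ b) \<le> Y.dist (\<phi> u) z + Y.dist z (y @ b)" by (rule Y.dist_triangle)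
    moreover have "Y.dist (\<phi> u) z \<le> t" using Y.len_le_length[of "take t d"] t(1) by (simp add: z_def)
    ultimately have ub: "Y.dist (\<phi> u) (y @ b) \<le> r * ?n"
      using zb t(1) ld elim(5) \<eta>n(3) by linarith
    obtain w where w: "set w \<subseteq> P" "X.req u w" "length w = X.len u" "X.geodesic w"
      using X.special_geodesic[OF X.special_word[OF u(1)]] by metis
    have wV: "set w \<subseteq> V" using w(1) P(2) by auto
    have \<phi>w: "\<phi> w = \<phi> u" using \<phi>_req[OF uV(1) wV w(2)] by simp
    \<comment> \<open>The length of \<open>u\<close> is \<open>n\<close> or \<open>n + 1\<close>, so
      the midpoint is far from both ends of \<open>w\<close>.\<close>
    define m where "m = take (n div 2) w"
    have m: "set m \<subseteq> V" "X.len m \<le> 2 * ?n"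
      using wV set_take_subset[of "n div 2" w] X.len_le_length[of m] w(3) uV(3)
      by (auto simp: m_def)
    have "n div 2 \<le> length w" using w(3) u(3) by auto
    then have "X.dist [] m = n div 2" "X.dist m w = length w - n div 2"
      using X.geodesic_dist_take[OF w(4), of 0 "n div 2"]
        X.geodesic_dist_take[OF w(4), of "n div 2" "length w"] by (simp_all add: m_def)
    then have "?n / 2 - 1 \<le> X.dist [] m" "?n / 2 - 1 \<le> X.dist w m"
      using w(3) u(3) X.dist_sym[of w m] by (auto simp: of_nat_diff)
    then have far_m: "8 * (r * ?n) \<le> Y.dist (\<phi> []) (\<phi> m)" "8 * (r * ?n) \<le> Y.dist (\<phi> u) (\<phi> m)"
      using far[of "[]" m] far[of w m] m wV \<phi>w w(2) uV(3) X.len_req[OF w(2)] by auto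
    have ly: "Y.len y \<le> 2 * ?n"
      using Y.dist_triangle[of y "[]" "\<phi> []"] y(2) elim(4) \<eta>n(2) by simp
    have "L * X.len u \<le> L * (2 * ?n)" using uV(3) L0 by (intro mult_left_mono) auto
    then have "Y.dist (\<phi> []) (\<phi> u) \<le> 2 * (L * ?n) + \<eta> * ?n" using upper[of "[]" u] uV by simp
    moreover have "length b = Y.dist y (y @ b)" using b(4) by (simp add: Y.geodesic_def)
    moreover have "Y.dist y (y @ b) \<le> Y.dist y (\<phi> []) + (Y.dist (\<phi> []) (\<phi> u) + Y.dist (\<phi> u) (y @ b))"
      using Y.dist_triangle[of y "y @ b" "\<phi> []"] Y.dist_triangle[of "\<phi> []" "y @ b" "\<phi> u"] by linarith
    ultimately have lb: "length b \<le> 3 * (L * ?n)" using y(2) ub \<eta>n Ln by linarith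
    have \<phi>0: "set (\<phi> []) \<subseteq> W" by (rule \<phi>_mem) simp
    obtain e where e: "set e \<subseteq> W" "length e = Y.dist (\<phi> []) y" "Y.req (\<phi> [] @ e) y"
      using Y.obtain_connecting_geodesic[OF \<phi>0 y(1)] by metis
    have le: "length e < r * ?n" using e(2) y(2) Y.dist_sym[of y] by simp
    \<comment> \<open>The words \<open>e\<close>, \<open>D\<close>, \<open>f\<close> spell a path of
      linear length from \<open>\<phi> []\<close> to \<open>\<phi> u\<close>. Its short ends
      \<open>e\<close> and \<open>f\<close> stay away from \<open>\<phi> m\<close>; if
      \<open>D\<close> did so too, \<open>cut\<close> would fail at the midpoint of
      \<open>w\<close>.\<close>
    have detour: "\<exists>i. Y.dist (y @ take i D) (\<phi> m) \<le> nat \<lfloor>r * ?n\<rfloor>"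
      if D: "set D \<subseteq> W" "length D = 2 * n + length b" "Y.req (y @ D) (y @ b)" for D
    proof (rule ccontr)
      assume "\<not> ?thesis"
      then have "nat \<lfloor>r * ?n\<rfloor> < Y.dist (y @ take i D) (\<phi> m)" for i by (simp add: not_le)
      have near: "r * ?n \<le> Y.dist (y @ take i D) (\<phi> m)" for i
        using \<open>nat \<lfloor>r * ?n\<rfloor> < Y.dist (y @ take i D) (\<phi> m)\<close> by linarith
      let ?A = "\<lambda>z. set z \<subseteq> W \<and> Y.len z \<le> B \<and> r * ?n \<le> Y.dist z (\<phi> m)"
      have yD: "set (y @ D) \<subseteq> W" using y(1) D(1) by simp
      obtain f where f: "set f \<subseteq> W" "length f = Y.dist (y @ D) (\<phi> u)" "Y.req ((y @ D) @ f) (\<phi> u)"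
        using Y.obtain_connecting_geodesic[OF yD \<phi>_mem[OF uV(1)]] by metis
      have "Y.dist (y @ D) (\<phi> u) = Y.dist (y @ b) (\<phi> u)" using D(3) by (intro Y.dist_req) auto
      then have lf: "length f \<le> r * ?n" using f(2) ub Y.dist_sym[of "\<phi> u"] by simp
      have lD: "length D \<le> 2 * ?n + 3 * (L * ?n)" using D(2) lb by simp
      have "Y.path ?A (length e) (\<phi> []) y"
      proof (rule Y.path_geodesic[OF e(3)])
        fix i
        have "Y.len (take i e) \<le> r * ?n"
          using Y.len_le_length[of "take i e"] le by simp
        moreover have "Y.dist (\<phi> []) (\<phi> m) \<le> Y.len (take i e) + Y.dist (\<phi> [] @ take i e) (\<phi> m)"
          using Y.dist_triangle[of "\<phi> []" "\<phi> m" "\<phi> [] @ take i e"] by simp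
        moreover have "Y.len (\<phi> [] @ take i e) \<le> Y.len (\<phi> []) + Y.len (take i e)" by (rule Y.len_append)
        ultimately have "Y.len (\<phi> [] @ take i e) \<le> B" "r * ?n \<le> Y.dist (\<phi> [] @ take i e) (\<phi> m)"
          using far_m(1) elim(4) \<eta>n Ln Mn(2) by linarith+
        then show "?A (\<phi> [] @ take i e)" using e(1) \<phi>0 set_take_subset[of i e] by auto
      qed
      moreover have "Y.path ?A (length D) y (y @ D)"
      proof (rule Y.path_word)
        fix i
        have "Y.len (y @ take i D) \<le> Y.len y + length D"
          using Y.len_append[of y "take i D"] Y.len_le_length[of "take i D"] by simp
        then have "Y.len (y @ take i D) \<le> B" using ly lD Ln Mn(2) by linarith
        then show "?A (y @ take i D)" using near[of i] y(1) D(1) set_take_subset[of i D] by auto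
      qed
      moreover have "Y.path ?A (length f) (y @ D) (\<phi> u)"
      proof (rule Y.path_geodesic[OF f(3)])
        fix i
        let ?x = "(y @ D) @ take i f"
        have lt: "Y.len (take i f) \<le> r * ?n"
          using Y.len_le_length[of "take i f"] lf by simp
        have "Y.len ?x \<le> Y.len y + length D + Y.len (take i f)"
          using Y.len_append[of "y @ D" "take i f"] Y.len_append[of y D] Y.len_le_length[of D] by linarith
        moreover have "Y.dist (\<phi> u) (\<phi> m) \<le> Y.dist (y @ D) (\<phi> u) + Y.dist (y @ D) (\<phi> m)"
          using Y.dist_triangle[of "\<phi> u" "\<phi> m" "y @ D"] Y.dist_sym[of "\<phi> u" "y @ D"] by simp
        moreover have "Y.dist (y @ D) (\<phi> m) \<le> Y.len (take i f) + Y.dist ?x (\<phi> m)"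
          using Y.dist_triangle[of "y @ D" "\<phi> m" ?x] Y.dist_append(1)[of "y @ D" "take i f"] by simp
        ultimately have "Y.len ?x \<le> B" "r * ?n \<le> Y.dist ?x (\<phi> m)"
          using far_m(2) lf f(2) lt ly lD \<eta>n Ln Mn(2) by linarith+
        then show "?A ?x" using y(1) D(1) f(1) set_take_subset[of i f] by auto
      qed
      ultimately have "Y.path ?A (length e + (length D + length f)) (\<phi> []) (\<phi> u)"
        by (meson Y.path_trans)
      moreover have "real (length e) + (real (length D) + real (length f)) \<le> B"
        using le lD lf \<eta>n Ln Mn(2) by linarith
      then have "real (length e + (length D + length f)) \<le> B" by simp
      moreover have "real (n div 2) + 1 / 4 * ?n \<le> length w" using w(3) u(3) by auto
      ultimately show False
        using cut[of "[]" w "n div 2" "length e + (length D + length f)"] w uV(3) Mn \<phi>w by (simp add: m_def)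
    qed
    obtain s' where s': "s' \<in> W" "s' \<notin> Y.star s" "Y.star s - {s} \<subseteq> Y.star s' - {s'}"
      using twin[OF s] by blast
    have b': "v \<in> Y.star s - {s} \<and> v \<in> Y.star s' - {s'}" if "v \<in> set b" for v
      using that b(1) s'(3) by auto
    have bW: "set b \<subseteq> W" using b(1) W[OF s] by auto
    have D: "\<exists>i. Y.dist (y @ take i (alternating \<sigma> \<tau> n @ b @ rev (alternating \<sigma> \<tau> n))) (\<phi> m) \<le> nat \<lfloor>r * ?n\<rfloor>"
      if "\<sigma> = s \<and> \<tau> = s' \<or> \<sigma> = s' \<and> \<tau> = s" for \<sigma> \<tau>
    proof (rule detour)
      let ?\<alpha> = "alternating \<sigma> \<tau> n"
      have \<alpha>: "set ?\<alpha> \<subseteq> {s, s'}" using set_alternating[of \<sigma> \<tau> n] that by auto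
      then show "set (?\<alpha> @ b @ rev ?\<alpha>) \<subseteq> W" using s s' bW by auto
      have "Y.req (?\<alpha> @ b) (b @ ?\<alpha>)"
      proof (rule Y.commute_words)
        fix v v' assume "v \<in> set ?\<alpha>" "v' \<in> set b"
        then show "{v, v'} \<in> F" using \<alpha> b'[of v'] by (auto simp: Y.star_def insert_commute)
      qed
      then have "Y.req ((?\<alpha> @ b) @ rev ?\<alpha>) ((b @ ?\<alpha>) @ rev ?\<alpha>)" by (rule Y.req_cong) simp
      moreover have "Y.req ((b @ ?\<alpha>) @ rev ?\<alpha>) b"
        using Y.req_insert_cancel(4)[of b ?\<alpha> "[]"] by simp
      ultimately have "Y.req ((?\<alpha> @ b) @ rev ?\<alpha>) b" by (rule Y.req_trans)
      then show "Y.req (y @ ?\<alpha> @ b @ rev ?\<alpha>) (y @ b)" by simp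
    qed simp
    obtain j j' where
      "Y.dist (y @ take j (alternating s s' n @ b @ rev (alternating s s' n))) (\<phi> m) \<le> nat \<lfloor>r * ?n\<rfloor>"
      "Y.dist (y @ take j' (alternating s' s n @ b @ rev (alternating s' s n))) (\<phi> m) \<le> nat \<lfloor>r * ?n\<rfloor>"
      using D by blast
    moreover have fl: "real (nat \<lfloor>r * ?n\<rfloor>) \<le> r * ?n" using \<eta>n(4) by linarith
    then have "2 * nat \<lfloor>r * ?n\<rfloor> < n" using \<eta>n(2) elim(3) by linarith
    ultimately have "Y.dist y (\<phi> m) \<le> 3 * nat \<lfloor>r * ?n\<rfloor> \<or> Y.dist (y @ b) (\<phi> m) \<le> 3 * nat \<lfloor>r * ?n\<rfloor>"
      using Y.detours_diverge[OF s'(2) b'] by blast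
    then show False
    proof
      assume "Y.dist y (\<phi> m) \<le> 3 * nat \<lfloor>r * ?n\<rfloor>"
      then show False
        using Y.dist_triangle[of "\<phi> []" "\<phi> m" y] Y.dist_sym[of y "\<phi> []"] y(2) far_m(1) fl \<eta>n(4) by linarith
    next
      assume "Y.dist (y @ b) (\<phi> m) \<le> 3 * nat \<lfloor>r * ?n\<rfloor>"
      then show False
        using Y.dist_triangle[of "\<phi> u" "\<phi> m" "y @ b"] ub far_m(2) fl \<eta>n(4) by linarith
    qed
  qed
  then show False by simp
qed

end

section \<open>Comparison with Cayley graphs\<close>

context racg_words
begin

section \<open>Words and elements of the presented group\<close>

definition lift :: "'v list \<Rightarrow> 'v word" where
  "lift x = map (\<lambda>v. (v, True)) x"

lemma lift_simps [simp]: "lift [] = []" "lift (v # x) = (v, True) # lift x" "lift (x @ y) = lift x @ lift y"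
  by (simp_all add: lift_def)

lemma lift_words [simp]: "lift x \<in> words V \<longleftrightarrow> set x \<subseteq> V"
  by (induction x) auto

lemma map_fst_lift [simp]: "map fst (lift x) = x"
  by (induction x) auto

lemma pres_eq_imp_req: "pres_eq V (racg_relations V E) x y \<Longrightarrow> map fst x \<asymp> map fst y"
proof (induction rule: pres_eq.induct)
  case (rels p q)
  then show ?case by (auto simp: racg_relations_def intro: req.intros)
qed (auto intro: req.intros)

text \<open>A derivation may pass through letters outside \<open>V\<close>. Deleting them in every
  word leaves a derivation in the presented group.\<close>

lemma req_imp_pres_eq:
  "x \<asymp> y \<Longrightarrow> pres_eq V (racg_relations V E) (lift (filter (\<lambda>v. v \<in> V) x)) (lift (filter (\<lambda>v. v \<in> V) y))"
proof (induction rule: req.induct)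
  case (req_cancel v)
  show ?case
    by (auto intro!: pres_eq.refl) (auto intro!: pres_eq.rels simp: racg_relations_def)
next
  case (req_commute v w)
  then have "v \<in> V \<Longrightarrow> w \<in> V \<Longrightarrow> pres_eq V (racg_relations V E) (lift [v, w]) (lift [w, v])"
    by (intro pres_eq.rels) (auto simp: racg_relations_def)
  then show ?case by (auto intro!: pres_eq.refl)
next
  case (req_refl x)
  show ?case by (rule pres_eq.refl) auto
next
  case (req_sym x y)
  then show ?case by (blast intro: pres_eq.sym)
next
  case (req_trans x y z)
  then show ?case by (blast intro: pres_eq.trans)
next
  case (req_cong x x' y y')
  then show ?case by (simp add: pres_eq.cong)
qed

lemma pres_eq_lift: "x \<in> words V \<Longrightarrow> pres_eq V (racg_relations V E) x (lift (map fst x))"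
proof (induction x)
  case Nil
  show ?case by (simp add: pres_eq.refl)
next
  case (Cons a x)
  obtain v b where a: "a = (v, b)" by (cases a)
  have v: "v \<in> V" using Cons.prems a by simp
  let ?eq = "pres_eq V (racg_relations V E)"
  have 1: "?eq [(v, True), (v, True)] []"
    using v by (intro pres_eq.rels) (auto simp: racg_relations_def)
  have "?eq ([(v, False)] @ [(v, True), (v, True)]) ([(v, False)] @ [])"
    using v by (intro pres_eq.cong 1 pres_eq.refl) simp
  moreover have "?eq ([(v, False), (v, \<not> False)] @ [(v, True)]) ([] @ [(v, True)])"
    using v by (intro pres_eq.cong pres_eq.cancel pres_eq.refl) simp_all
  ultimately have "?eq [(v, False)] [(v, True)]"
    by simp (meson pres_eq.sym pres_eq.trans)
  then have "?eq [(v, b)] [(v, True)]" using v by (cases b) (auto intro: pres_eq.refl)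
  then have "?eq ([(v, b)] @ x) ([(v, True)] @ lift (map fst x))"
    using Cons by (intro pres_eq.cong) auto
  then show ?case by (simp add: a)
qed

definition elt :: "'v set \<Rightarrow> 'v list \<Rightarrow> 'v word set" where
  "elt V x = pres_class V (racg_relations V E) (lift x)"

lemma elt_eq_iff:
  assumes "set x \<subseteq> V" "set y \<subseteq> V"
  shows "elt V x = elt V y \<longleftrightarrow> x \<asymp> y"
proof -
  have "filter (\<lambda>v. v \<in> V) x = x" "filter (\<lambda>v. v \<in> V) y = y" using assms by (auto simp: filter_id_conv)
  then show ?thesis
    using pres_eq_imp_req[of V "lift x" "lift y"] req_imp_pres_eq[of x y V] assms
    by (auto simp: elt_def pres_class_eq_iff)
qed

lemma elt_carrier [simp]: "set x \<subseteq> V \<Longrightarrow> elt V x \<in> carrier (racg V E)"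
  by (simp add: elt_def racg_def presented_group_def)

lemma carrier_elt:
  assumes "g \<in> carrier (racg V E)"
  obtains x where "set x \<subseteq> V" "g = elt V x"
proof -
  obtain w where w: "w \<in> words V" "g = pres_class V (racg_relations V E) w"
    using assms by (auto simp: racg_def presented_group_def)
  then have "g = elt V (map fst w)"
    using pres_eq_lift[OF w(1)] by (simp add: elt_def pres_class_eq_iff)
  moreover have "set (map fst w) \<subseteq> V" using w(1) by (induction w) auto
  ultimately show ?thesis using that by blast
qed

lemma elt_mult:
  "set x \<subseteq> V \<Longrightarrow> set y \<subseteq> V \<Longrightarrow> elt V x \<otimes>\<^bsub>racg V E\<^esub> elt V y = elt V (x @ y)"
  by (simp add: elt_def racg_def presented_group_mult)

lemma elt_one: "\<one>\<^bsub>racg V E\<^esub> = elt V []"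
  by (simp add: elt_def racg_def presented_group_def)

end

section \<open>The Cayley metric on vertices\<close>

lemma graph_dist_le: "pl_path V E x l y \<Longrightarrow> graph_dist V E x y \<le> l"
  unfolding graph_dist_def
  by (auto intro!: cInf_lower bdd_belowI[of _ 0] dest: pl_path_nonneg)

lemma indicat_cell: "finite e \<Longrightarrow> g \<in> e \<Longrightarrow> indicat_real {g} \<in> cell e"
  by (auto simp: cell_def indicator_def of_bool_def)

text \<open>The length spent is at least \<open>d w\<close> plus the distance \<open>1 - y w\<close>
  from an end \<open>w\<close> of the current edge to \<open>y\<close>. When the path reaches the
  other end, that end replaces \<open>w\<close>. Positivity of \<open>y w\<close> forces
  \<open>w\<close> to be an end of the next edge.\<close>

lemma pl_path_lower:
  assumes "pl_path V E x l y" "x = indicat_real {g}" "d g = (0 :: real)"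
    and E: "\<And>e. e \<in> E \<Longrightarrow> card e = 2" "\<And>e a b. e \<in> E \<Longrightarrow> a \<in> e \<Longrightarrow> b \<in> e \<Longrightarrow> d a \<le> d b + 1"
  shows "\<exists>w. y w > 0 \<and> d w + 1 - y w \<le> l"
  using assms(1,2)
proof (induction rule: pl_path.induct)
  case (const x)
  then show ?case using assms(3) by (intro exI[of _ g]) simp
next
  case (step x l y e u z)
  then obtain w where w: "y w > 0" "d w + 1 - y w \<le> l" by blast
  have we: "w \<in> e" using w(1) step.hyps by (auto simp: cell_def)
  obtain a b where ab: "e = {a, b}" "a \<noteq> b" using E(1)[OF step.hyps(2)] by (auto simp: card_2_iff)
  obtain w' where w': "e = {w, w'}" "w \<noteq> w'" using ab we by auto
  have sums: "y w + y w' = 1" "z w + z w' = 1" "0 \<le> z w" "0 \<le> z w'"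
    using step.hyps w' by (auto simp: cell_def)
  have uw: "\<bar>y u - z u\<bar> = \<bar>y w - z w\<bar>" using step.hyps(3) w' sums by auto
  show ?case
  proof (cases "z w > 0")
    case True
    then show ?thesis using w uw by (intro exI[of _ w]) linarith
  next
    case False
    then have "z w = 0" "z w' = 1" using sums by auto
    moreover have "d w' \<le> d w + 1" using E(2)[OF step.hyps(2)] w' by auto
    ultimately show ?thesis using w uw by (intro exI[of _ w']) linarith
  qed
qed

context racg_words
begin

text \<open>Upper bound: right multiplication by a fixed element moves all vertices by a bounded
  distance, and \<open>V\<close> is finite. Lower bound: the word distance from \<open>x\<close>,
  divided by a bound for the word lengths of \<open>S\<close>, changes by at most one along an edge,
  so \<open>pl_path_lower\<close> applies.\<close>

lemma cayley_metric:
  assumes V: "finite V" and S: "finite_generating_set (racg V E) S"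
  shows "\<exists>K :: real. 1 \<le> K \<and> (\<forall>x y. set x \<subseteq> V \<longrightarrow> set y \<subseteq> V \<longrightarrow>
    cayley_dist (racg V E) S (indicat_real {elt V x}) (indicat_real {elt V y}) \<le> K * dist x y \<and>
    dist x y \<le> K * cayley_dist (racg V E) S (indicat_real {elt V x}) (indicat_real {elt V y}))"
proof -
  let ?G = "racg V E"
  interpret G: group ?G unfolding racg_def by (rule group_presented_group)
  interpret M: Metric_space "cayley_space ?G S" "cayley_dist ?G S" by (rule G.Metric_space_cayley[OF S])
  have S_car: "S \<subseteq> carrier ?G" and gen: "generate ?G S = carrier ?G" and fin: "finite S"
    using S by (auto simp: finite_generating_set_def)
  define \<delta> where "\<delta> g h = cayley_dist ?G S (indicat_real {g}) (indicat_real {h})" for g h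
  have mem: "indicat_real {g} \<in> cayley_space ?G S" if "g \<in> carrier ?G" for g
    using that by (auto simp: cayley_space_def realization_def cell_vertex)
  have card_e: "card e = 2" if e: "e \<in> cayley_edges ?G S" for e
  proof -
    obtain g s where gs: "g \<in> carrier ?G" "s \<in> S" "s \<noteq> \<one>\<^bsub>?G\<^esub>" "e = {g, g \<otimes>\<^bsub>?G\<^esub> s}"
      using e by (auto simp: cayley_edges_def)
    then have "s \<in> carrier ?G" using S_car by blast
    then have "g \<noteq> g \<otimes>\<^bsub>?G\<^esub> s" using G.l_cancel_one'[of g s] gs by simp
    then show ?thesis using gs(4) by simp
  qed
  have \<delta>_refl: "\<delta> g g = 0" if "g \<in> carrier ?G" for g
    using that mem unfolding \<delta>_def by simp
  have \<delta>_sym: "\<delta> g h = \<delta> h g" for g h unfolding \<delta>_def by (rule M.commute)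
  have \<delta>_tri: "\<delta> g k \<le> \<delta> g h + \<delta> h k" if "g \<in> carrier ?G" "h \<in> carrier ?G" "k \<in> carrier ?G" for g h k
    unfolding \<delta>_def using that mem by (intro M.triangle)
  have step: "\<delta> g (g \<otimes>\<^bsub>?G\<^esub> s) \<le> 1" if g: "g \<in> carrier ?G" "s \<in> S" for g s
  proof (cases "s = \<one>\<^bsub>?G\<^esub>")
    case True
    then show ?thesis using g \<delta>_refl by simp
  next
    case False
    let ?e = "{g, g \<otimes>\<^bsub>?G\<^esub> s}"
    have e: "?e \<in> cayley_edges ?G S" using g False by (auto simp: cayley_edges_def)
    have "pl_path (carrier ?G) (cayley_edges ?G S) (indicat_real {g})
        \<bar>indicat_real {g} g - indicat_real {g \<otimes>\<^bsub>?G\<^esub> s} g\<bar> (indicat_real {g \<otimes>\<^bsub>?G\<^esub> s})"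
      using e by (intro pl_path_edge[of ?e]) (auto intro: indicat_cell)
    then have "\<delta> g (g \<otimes>\<^bsub>?G\<^esub> s) \<le> \<bar>indicat_real {g} g - indicat_real {g \<otimes>\<^bsub>?G\<^esub> s} g\<bar>"
      unfolding \<delta>_def cayley_dist_def by (rule graph_dist_le)
    then show ?thesis by (auto simp: indicator_def of_bool_def split: if_splits)
  qed
  have bounded: "\<exists>k. \<forall>g\<in>carrier ?G. \<delta> g (g \<otimes>\<^bsub>?G\<^esub> h) \<le> k" if "h \<in> generate ?G S" for h
    using that
  proof (induction rule: generate.induct)
    case one
    then show ?case using \<delta>_refl by (intro exI[of _ 0]) simp
  next
    case (incl s)
    then show ?case using step by blast
  next
    case (inv s)
    have s: "s \<in> carrier ?G" using inv S_car by blast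
    have "\<delta> g (g \<otimes>\<^bsub>?G\<^esub> inv\<^bsub>?G\<^esub> s) \<le> 1" if g: "g \<in> carrier ?G" for g
      using step[of "g \<otimes>\<^bsub>?G\<^esub> inv\<^bsub>?G\<^esub> s" s] g s inv \<delta>_sym by (simp add: G.m_assoc)
    then show ?case by blast
  next
    case (eng h k)
    then have hk: "h \<in> carrier ?G" "k \<in> carrier ?G" by (auto simp: gen)
    from eng obtain a b where ab: "\<And>g. g \<in> carrier ?G \<Longrightarrow> \<delta> g (g \<otimes>\<^bsub>?G\<^esub> h) \<le> a"
      "\<And>g. g \<in> carrier ?G \<Longrightarrow> \<delta> g (g \<otimes>\<^bsub>?G\<^esub> k) \<le> b" by blast
    have "\<delta> g (g \<otimes>\<^bsub>?G\<^esub> (h \<otimes>\<^bsub>?G\<^esub> k)) \<le> a + b" if g: "g \<in> carrier ?G" for g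
      using \<delta>_tri[of g "g \<otimes>\<^bsub>?G\<^esub> h" "g \<otimes>\<^bsub>?G\<^esub> h \<otimes>\<^bsub>?G\<^esub> k"] ab(1)[OF g] ab(2)[of "g \<otimes>\<^bsub>?G\<^esub> h"] g hk
      by (simp add: G.m_assoc)
    then show ?case by blast
  qed
  have "\<forall>v\<in>V. \<exists>k. \<forall>g\<in>carrier ?G. \<delta> g (g \<otimes>\<^bsub>?G\<^esub> elt V [v]) \<le> k"
    using bounded gen by simp
  then obtain k where k: "\<And>v g. v \<in> V \<Longrightarrow> g \<in> carrier ?G \<Longrightarrow> \<delta> g (g \<otimes>\<^bsub>?G\<^esub> elt V [v]) \<le> k v"
    by metis
  define K\<^sub>1 where "K\<^sub>1 = (\<Sum>v\<in>V. \<bar>k v\<bar>)"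
  have K\<^sub>1: "0 \<le> K\<^sub>1" "\<And>v. v \<in> V \<Longrightarrow> k v \<le> K\<^sub>1"
  proof -
    show "0 \<le> K\<^sub>1" by (simp add: K\<^sub>1_def sum_nonneg)
    show "k v \<le> K\<^sub>1" if "v \<in> V" for v
      using member_le_sum[OF that, of "\<lambda>v. \<bar>k v\<bar>"] V by (simp add: K\<^sub>1_def)
  qed
  have word: "\<delta> (elt V x) (elt V (x @ w)) \<le> K\<^sub>1 * length w" if "set x \<subseteq> V" "set w \<subseteq> V" for x w
    using that
  proof (induction w arbitrary: x)
    case Nil
    then show ?case using \<delta>_refl by simp
  next
    case (Cons v w)
    have "\<delta> (elt V x) (elt V (x @ [v])) \<le> K\<^sub>1"
      using k[of v "elt V x"] K\<^sub>1(2)[of v] Cons.prems elt_mult[of x V "[v]"] by simp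
    moreover have "\<delta> (elt V (x @ [v])) (elt V ((x @ [v]) @ w)) \<le> K\<^sub>1 * length w"
      using Cons.prems by (intro Cons.IH) auto
    moreover have "\<delta> (elt V x) (elt V (x @ v # w)) \<le>
        \<delta> (elt V x) (elt V (x @ [v])) + \<delta> (elt V (x @ [v])) (elt V (x @ v # w))"
      using Cons.prems by (intro \<delta>_tri) auto
    ultimately show ?case by (simp add: algebra_simps)
  qed
  have upper: "\<delta> (elt V x) (elt V y) \<le> K\<^sub>1 * dist x y" if xy: "set x \<subseteq> V" "set y \<subseteq> V" for x y
  proof -
    obtain c where c: "set c \<subseteq> V" "length c = dist x y" "x @ c \<asymp> y"
      using obtain_connecting_geodesic[OF xy] by metis
    then have "elt V y = elt V (x @ c)" using xy elt_eq_iff[of "x @ c" V y] by simp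
    then show ?thesis using word[OF xy(1) c(1)] c(2) by simp
  qed
  have "\<forall>g\<in>carrier ?G. \<exists>x. set x \<subseteq> V \<and> g = elt V x" using carrier_elt by metis
  then obtain W where W: "\<And>g. g \<in> carrier ?G \<Longrightarrow> set (W g) \<subseteq> V \<and> g = elt V (W g)" by metis
  define K\<^sub>2 where "K\<^sub>2 = 1 + (\<Sum>s\<in>S. real (len (W s)))"
  have K\<^sub>2: "1 \<le> K\<^sub>2" "\<And>s. s \<in> S \<Longrightarrow> len (W s) \<le> K\<^sub>2"
  proof -
    show "1 \<le> K\<^sub>2" by (simp add: K\<^sub>2_def sum_nonneg)
    show "len (W s) \<le> K\<^sub>2" if "s \<in> S" for s
      using member_le_sum[OF that, of "\<lambda>s. real (len (W s))"] fin by (simp add: K\<^sub>2_def)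
  qed
  have lower: "dist x y \<le> K\<^sub>2 * \<delta> (elt V x) (elt V y)" if xy: "set x \<subseteq> V" "set y \<subseteq> V" for x y
  proof -
    define d where "d g = real (dist x (W g)) / K\<^sub>2" for g
    have W_elt: "W (elt V z) \<asymp> z" if "set z \<subseteq> V" for z
      using W[of "elt V z"] that elt_eq_iff[of "W (elt V z)" V z] by simp
    have lip: "d a \<le> d b + 1" if e: "e \<in> cayley_edges ?G S" "a \<in> e" "b \<in> e" for e a b
    proof -
      obtain g s where gs: "g \<in> carrier ?G" "s \<in> S" "e = {g, g \<otimes>\<^bsub>?G\<^esub> s}"
        using e by (auto simp: cayley_edges_def)
      have s: "s \<in> carrier ?G" using gs S_car by blast
      have "g \<otimes>\<^bsub>?G\<^esub> s = elt V (W g @ W s)"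
        using W[OF gs(1)] W[OF s] elt_mult[of "W g" V "W s"] by simp
      then have "W (g \<otimes>\<^bsub>?G\<^esub> s) \<asymp> W g @ W s"
        using W_elt[of "W g @ W s"] W[OF gs(1)] W[OF s] by simp
      then have "dist (W g) (W (g \<otimes>\<^bsub>?G\<^esub> s)) = dist (W g) (W g @ W s)" by (intro dist_req) auto
      then have gd: "dist (W g) (W (g \<otimes>\<^bsub>?G\<^esub> s)) \<le> K\<^sub>2" using K\<^sub>2(2)[OF gs(2)] by simp
      have "real (dist x (W a)) \<le> dist x (W b) + K\<^sub>2"
        using e(2,3) gs(3) gd K\<^sub>2(1) dist_triangle[of x "W g" "W (g \<otimes>\<^bsub>?G\<^esub> s)"]
          dist_triangle[of x "W (g \<otimes>\<^bsub>?G\<^esub> s)" "W g"] dist_sym[of "W g" "W (g \<otimes>\<^bsub>?G\<^esub> s)"]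
        by auto
      then show ?thesis using K\<^sub>2(1) by (simp add: d_def field_simps)
    qed
    have d0: "d (elt V x) = 0"
      using dist_eq_0[of x "W (elt V x)"] W_elt[OF xy(1)] req_sym by (auto simp: d_def)
    have dy: "d (elt V y) = dist x y / K\<^sub>2"
      using dist_req[of x x "W (elt V y)" y] W_elt[OF xy(2)] by (simp add: d_def)
    let ?p = "\<lambda>l. pl_path (carrier ?G) (cayley_edges ?G S) (indicat_real {elt V x}) l (indicat_real {elt V y})"
    have le: "dist x y / K\<^sub>2 \<le> l" if l: "?p l" for l
    proof -
      have "\<exists>w. indicat_real {elt V y} w > 0 \<and> d w + 1 - indicat_real {elt V y} w \<le> l"
      proof (rule pl_path_lower[OF l HOL.refl, of d])
        show "d a \<le> d b + 1" if "e \<in> cayley_edges ?G S" "a \<in> e" "b \<in> e" for e a b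
          using that by (rule lip)
      qed (use d0 card_e in auto)
      then obtain w where w: "indicat_real {elt V y} w > 0" "d w + 1 - indicat_real {elt V y} w \<le> l" by blast
      then have "w = elt V y" by (auto simp: indicator_def split: if_splits)
      then show ?thesis using w dy by simp
    qed
    \<comment> \<open>Without a path the dummy value 0 of the distance would identify the two
      points, and the constant path would join them.\<close>
    have ex: "\<exists>l. ?p l"
    proof (rule ccontr)
      assume no: "\<nexists>l. ?p l"
      then have "cayley_dist ?G S (indicat_real {elt V x}) (indicat_real {elt V y}) = 0"
        by (simp add: cayley_dist_def graph_dist_def)
      then have "indicat_real {elt V x} = indicat_real {elt V y}" using M.zero mem xy by simp
      moreover have "?p 0" if "indicat_real {elt V x} = indicat_real {elt V y}"
        unfolding that using mem[of "elt V y"] xy by (intro pl_path.const) (simp add: cayley_space_def)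
      ultimately show False using no by blast
    qed
    have "dist x y / K\<^sub>2 \<le> Inf {l. ?p l}" using ex le by (intro cInf_greatest) auto
    then have "dist x y / K\<^sub>2 \<le> \<delta> (elt V x) (elt V y)"
      using ex by (simp add: \<delta>_def cayley_dist_def graph_dist_def)
    then show ?thesis using K\<^sub>2(1) by (simp add: field_simps)
  qed
  define K where "K = K\<^sub>1 + K\<^sub>2"
  have nn: "0 \<le> \<delta> g h" for g h unfolding \<delta>_def by simp
  have K: "1 \<le> K" using K\<^sub>1 K\<^sub>2 by (simp add: K_def)
  have bounds: "\<delta> (elt V x) (elt V y) \<le> K * dist x y" "dist x y \<le> K * \<delta> (elt V x) (elt V y)"
    if xy: "set x \<subseteq> V" "set y \<subseteq> V" for x y
  proof -
    have "K\<^sub>1 * dist x y \<le> K * dist x y" using K\<^sub>2 by (intro mult_right_mono) (auto simp: K_def)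
    then show "\<delta> (elt V x) (elt V y) \<le> K * dist x y" using upper[OF xy] by simp
    have "K\<^sub>2 * \<delta> (elt V x) (elt V y) \<le> K * \<delta> (elt V x) (elt V y)"
      using K\<^sub>1 nn by (intro mult_right_mono) (auto simp: K_def)
    then show "dist x y \<le> K * \<delta> (elt V x) (elt V y)" using lower[OF xy] by simp
  qed
  show ?thesis
    by (intro exI[of _ K] conjI allI impI) (use K bounds in \<open>simp_all add: \<delta>_def\<close>)
qed

lemma near_vertex:
  assumes "z \<in> cayley_space (racg V E) S"
  shows "\<exists>x. set x \<subseteq> V \<and> cayley_dist (racg V E) S z (indicat_real {elt V x}) \<le> 1"
proof -
  let ?G = "racg V E"
  consider v where "v \<in> carrier ?G" "z \<in> cell {v}"
    | e where "e \<in> cayley_edges ?G S" "z \<in> cell e"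
    using assms by (auto simp: cayley_space_def realization_def)
  then show ?thesis
  proof cases
    case 1
    obtain x where x: "set x \<subseteq> V" "v = elt V x" using carrier_elt[OF 1(1)] by blast
    have "pl_path (carrier ?G) (cayley_edges ?G S) z 0 (indicat_real {v})"
      using 1 cell_vertex[of v] assms by (auto simp: cayley_space_def intro: pl_path.const)
    from graph_dist_le[OF this] show ?thesis using x by (auto simp: cayley_dist_def)
  next
    case 2
    obtain g s where gs: "g \<in> carrier ?G" "e = {g, g \<otimes>\<^bsub>?G\<^esub> s}" using 2 by (auto simp: cayley_edges_def)
    obtain x where x: "set x \<subseteq> V" "g = elt V x" using carrier_elt[OF gs(1)] by blast
    have "0 \<le> z w" for w using 2(2) by (auto simp: cell_def)
    moreover have "(\<Sum>w\<in>e. z w) = 1" using 2(2) by (auto simp: cell_def)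
    ultimately have "0 \<le> z g" "z g \<le> 1"
      using member_le_sum[of g e z] gs(2) by auto
    moreover have "pl_path (carrier ?G) (cayley_edges ?G S) z \<bar>z g - indicat_real {g} g\<bar> (indicat_real {g})"
      using 2 gs by (intro pl_path_edge[of e]) (auto intro: indicat_cell)
    from graph_dist_le[OF this] have "cayley_dist ?G S z (indicat_real {g}) \<le> \<bar>z g - 1\<bar>"
      by (simp add: cayley_dist_def)
    ultimately show ?thesis using x by (intro exI[of _ x]) auto
  qed
qed

end

section \<open>From a sublinear biLipschitz equivalence to a coarse map\<close>

lemma sublinear_gauge_bound:
  assumes \<theta>: "sublinear_gauge \<theta>" and \<epsilon>: "\<epsilon> > 0"
  obtains C where "0 \<le> C" "\<And>r. 0 \<le> r \<Longrightarrow> \<theta> r \<le> \<epsilon> * r + C"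
proof -
  have "((\<lambda>r. \<theta> r / r) \<longlongrightarrow> 0) at_top" using \<theta> by (simp add: sublinear_gauge_def)
  then have "\<forall>\<^sub>F r in at_top. \<theta> r / r < \<epsilon>" using \<epsilon> by (rule order_tendstoD)
  then obtain R where R: "\<And>r. R \<le> r \<Longrightarrow> \<theta> r / r < \<epsilon>" by (auto simp: eventually_at_top_linorder)
  \<comment> \<open>Up to \<open>R'\<close> monotonicity bounds \<open>\<theta>\<close> by a
    constant; beyond \<open>R'\<close> the slope is less than \<open>\<epsilon>\<close>.\<close>
  define R' where "R' = max R 1"
  have "\<theta> r \<le> \<epsilon> * r + \<theta> R'" if "0 \<le> r" for r
  proof (cases "r \<le> R'")
    case True
    have "\<theta> r \<le> \<theta> R'" using \<theta> True that by (auto simp: sublinear_gauge_def intro: mono_onD)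
    moreover have "0 \<le> \<epsilon> * r" using \<epsilon> that by simp
    ultimately show ?thesis by linarith
  next
    case False
    then have "r > 0" "\<theta> r / r < \<epsilon>" using R[of r] by (auto simp: R'_def)
    then have "\<theta> r < \<epsilon> * r" by (simp add: divide_less_eq)
    moreover have "1 \<le> \<theta> R'" using \<theta> by (simp add: sublinear_gauge_def R'_def)
    ultimately show ?thesis by simp
  qed
  moreover have "0 \<le> \<theta> R'" using \<theta> by (auto simp: sublinear_gauge_def R'_def intro: order_trans[of 0 1])
  ultimately show ?thesis using that by blast
qed

lemma sublinear_biLipschitz_imp_coarse_map:
  fixes E :: "'v set set" and F :: "'w set set"
  assumes fin: "finite V" "finite W"
    and equiv: "sublinear_biLipschitz_equivalent (racg V E) (racg W F)"
  shows "\<exists>\<phi> L. coarse_map E F V W \<phi> L"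
proof -
  interpret X: racg_words E .
  interpret Y: racg_words F .
  obtain S T L \<theta> \<Phi> where S: "finite_generating_set (racg V E) S" and T: "finite_generating_set (racg W F) T"
    and L: "1 \<le> L" and \<theta>: "sublinear_gauge \<theta>"
    and \<Phi>: "sublinear_biLipschitz L \<theta> (cayley_space (racg V E) S) (cayley_dist (racg V E) S) (cayley_base (racg V E))
      (cayley_space (racg W F) T) (cayley_dist (racg W F) T) (cayley_base (racg W F)) \<Phi>"
    using equiv unfolding sublinear_biLipschitz_equivalent_def by blast
  define A where "A = cayley_space (racg V E) S"
  define B where "B = cayley_space (racg W F) T"
  define dA where "dA = cayley_dist (racg V E) S"
  define dB where "dB = cayley_dist (racg W F) T"
  define p where "p x = indicat_real {X.elt V x}" for x
  define q where "q y = indicat_real {Y.elt W y}" for y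
  interpret A: Metric_space A dA
    unfolding A_def dA_def
    by (rule group.Metric_space_cayley[OF _ S]) (simp add: racg_def group_presented_group)
  interpret B: Metric_space B dB
    unfolding B_def dB_def
    by (rule group.Metric_space_cayley[OF _ T]) (simp add: racg_def group_presented_group)
  obtain K\<^sub>1 :: real where K\<^sub>1: "1 \<le> K\<^sub>1"
    "\<And>x y. set x \<subseteq> V \<Longrightarrow> set y \<subseteq> V \<Longrightarrow> dA (p x) (p y) \<le> K\<^sub>1 * X.dist x y"
    "\<And>x y. set x \<subseteq> V \<Longrightarrow> set y \<subseteq> V \<Longrightarrow> X.dist x y \<le> K\<^sub>1 * dA (p x) (p y)"
    using X.cayley_metric[OF fin(1) S, folded dA_def p_def] by blast
  obtain K\<^sub>2 :: real where K\<^sub>2: "1 \<le> K\<^sub>2"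
    "\<And>x y. set x \<subseteq> W \<Longrightarrow> set y \<subseteq> W \<Longrightarrow> dB (q x) (q y) \<le> K\<^sub>2 * Y.dist x y"
    "\<And>x y. set x \<subseteq> W \<Longrightarrow> set y \<subseteq> W \<Longrightarrow> Y.dist x y \<le> K\<^sub>2 * dB (q x) (q y)"
    using Y.cayley_metric[OF fin(2) T, folded dB_def q_def] by blast
  have pA: "p x \<in> A" if "set x \<subseteq> V" for x
    using that by (auto simp: p_def A_def cayley_space_def realization_def cell_vertex)
  have qB: "q y \<in> B" if "set y \<subseteq> W" for y
    using that by (auto simp: q_def B_def cayley_space_def realization_def cell_vertex)
  have base: "cayley_base (racg V E) = p []" "cayley_base (racg W F) = q []"
    by (simp_all add: cayley_base_def p_def q_def X.elt_one Y.elt_one)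
  have \<Phi>_mem: "\<Phi> x \<in> B" if "x \<in> A" for x
    using \<Phi> that by (auto simp: sublinear_biLipschitz_def A_def B_def)
  let ?\<theta> = "\<lambda>x y. \<theta> (max (dA x (p [])) (dA y (p [])))"
  have \<Phi>_lower: "1 / L * dA x y - ?\<theta> x y \<le> dB (\<Phi> x) (\<Phi> y)"
    and \<Phi>_upper: "dB (\<Phi> x) (\<Phi> y) \<le> L * dA x y + ?\<theta> x y" if "x \<in> A" "y \<in> A" for x y
    using \<Phi> that unfolding sublinear_biLipschitz_def base A_def B_def dA_def dB_def by blast+
  obtain D where D: "0 \<le> D" "\<And>y. y \<in> B \<Longrightarrow> (INF x\<in>A. dB y (\<Phi> x)) \<le> D * \<theta> (dB y (q []))"
    using \<Phi> unfolding sublinear_biLipschitz_def base A_def B_def dA_def dB_def by blast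
  have "\<forall>z\<in>A. \<exists>x. set x \<subseteq> V \<and> dA z (p x) \<le> 1"
    using X.near_vertex unfolding A_def dA_def p_def by blast
  then obtain near where near: "\<And>z. z \<in> A \<Longrightarrow> set (near z) \<subseteq> V \<and> dA z (p (near z)) \<le> 1" by metis
  have "\<forall>z\<in>B. \<exists>y. set y \<subseteq> W \<and> dB z (q y) \<le> 1"
    using Y.near_vertex unfolding B_def dB_def q_def by blast
  then obtain near' where near': "\<And>z. z \<in> B \<Longrightarrow> set (near' z) \<subseteq> W \<and> dB z (q (near' z)) \<le> 1" by metis
  \<comment> \<open>The image is chosen for the vertex \<open>p x\<close>, not for the word, so
    words for one element have the same image.\<close>
  define \<phi> where "\<phi> x = near' (\<Phi> (p x))" for x
  have \<phi>: "set (\<phi> x) \<subseteq> W" "dB (\<Phi> (p x)) (q (\<phi> x)) \<le> 1" if "set x \<subseteq> V" for x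
    using near' \<Phi>_mem pA that by (auto simp: \<phi>_def)
  have close: "\<bar>dB (q (\<phi> x)) (q (\<phi> y)) - dB (\<Phi> (p x)) (\<Phi> (p y))\<bar> \<le> 2" if xy: "set x \<subseteq> V" "set y \<subseteq> V" for x y
  proof -
    have m: "\<Phi> (p x) \<in> B" "\<Phi> (p y) \<in> B" "q (\<phi> x) \<in> B" "q (\<phi> y) \<in> B"
      using \<Phi>_mem pA qB \<phi> xy by auto
    show ?thesis
      using B.triangle[OF m(3,1,4)] B.triangle[OF m(1,2,4)] B.triangle[OF m(1,3,2)] B.triangle[OF m(3,4,2)]
        \<phi>(2)[OF xy(1)] \<phi>(2)[OF xy(2)] B.commute[of "q (\<phi> x)" "\<Phi> (p x)"] B.commute[of "q (\<phi> y)" "\<Phi> (p y)"]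
      by linarith
  qed
  have \<theta>_word: "?\<theta> (p x) (p y) \<le> \<epsilon> * K\<^sub>1 * (X.len x + X.len y) + C"
    if C: "\<And>r. 0 \<le> r \<Longrightarrow> \<theta> r \<le> \<epsilon> * r + C" and \<epsilon>: "0 < \<epsilon>" and xy: "set x \<subseteq> V" "set y \<subseteq> V" for \<epsilon> C x y
  proof -
    have *: "dA (p x) (p []) \<le> K\<^sub>1 * X.len x" "dA (p y) (p []) \<le> K\<^sub>1 * X.len y"
      using K\<^sub>1(2)[of x "[]"] K\<^sub>1(2)[of y "[]"] xy by simp_all
    have "0 \<le> K\<^sub>1 * X.len x" "0 \<le> K\<^sub>1 * X.len y" using K\<^sub>1(1) by simp_all
    then have "max (dA (p x) (p [])) (dA (p y) (p [])) \<le> K\<^sub>1 * (X.len x + X.len y)"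
      using * by (simp add: algebra_simps)
    then have "\<epsilon> * max (dA (p x) (p [])) (dA (p y) (p [])) \<le> \<epsilon> * (K\<^sub>1 * (X.len x + X.len y))"
      using \<epsilon> by (intro mult_left_mono) auto
    moreover have "?\<theta> (p x) (p y) \<le> \<epsilon> * max (dA (p x) (p [])) (dA (p y) (p [])) + C"
      by (intro C) (simp add: le_max_iff_disj)
    ultimately show ?thesis by (simp add: mult.assoc)
  qed
  define L' where "L' = K\<^sub>1 * K\<^sub>2 * L"
  have prods: "1 \<le> K\<^sub>1 * K\<^sub>2" "1 \<le> K\<^sub>2 * L" "1 \<le> K\<^sub>1 * L"
    using mult_mono[of 1 K\<^sub>1 1 K\<^sub>2] mult_mono[of 1 K\<^sub>2 1 L] mult_mono[of 1 K\<^sub>1 1 L] K\<^sub>1(1) K\<^sub>2(1) L by simp_all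
  have L': "1 \<le> L'" "K\<^sub>2 \<le> L'" "K\<^sub>1 * L \<le> L'"
    using mult_mono[of 1 "K\<^sub>1 * K\<^sub>2" 1 L] mult_right_mono[of 1 "K\<^sub>1 * L" K\<^sub>2] mult_left_mono[of 1 K\<^sub>2 "K\<^sub>1 * L"]
      prods K\<^sub>1(1) K\<^sub>2(1) L by (simp_all add: L'_def mult.assoc mult.left_commute mult.commute)
  have "coarse_map E F V W \<phi> L'"
  proof
    show "1 \<le> L'" by (rule L')
    show "set (\<phi> x) \<subseteq> W" if "set x \<subseteq> V" for x using \<phi>(1)[OF that] .
    show "\<phi> x = \<phi> y" if "set x \<subseteq> V" "set y \<subseteq> V" "X.req x y" for x y
      using that X.elt_eq_iff[of x V y] by (simp add: \<phi>_def p_def)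
  next
    fix \<epsilon> :: real assume \<epsilon>: "\<epsilon> > 0"
    \<comment> \<open>Word lengths enter \<open>\<theta>\<close> with the factor
      \<open>K\<^sub>1\<close>, and the result is multiplied by at most \<open>L'\<close>.\<close>
    define \<epsilon>' where "\<epsilon>' = \<epsilon> / (L' * K\<^sub>1)"
    have \<epsilon>': "\<epsilon>' > 0" using \<epsilon> L' K\<^sub>1(1) by (simp add: \<epsilon>'_def)
    obtain C where C: "0 \<le> C" "\<And>r. 0 \<le> r \<Longrightarrow> \<theta> r \<le> \<epsilon>' * r + C"
      using sublinear_gauge_bound[OF \<theta> \<epsilon>'] by metis
    show "\<exists>C. \<forall>x y. set x \<subseteq> V \<longrightarrow> set y \<subseteq> V \<longrightarrow>
        Y.dist (\<phi> x) (\<phi> y) \<le> L' * X.dist x y + \<epsilon> * (X.len x + X.len y) + C \<and>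
        X.dist x y \<le> L' * Y.dist (\<phi> x) (\<phi> y) + \<epsilon> * (X.len x + X.len y) + C"
    proof (intro exI[of _ "L' * (C + 2)"] allI impI)
      fix x y assume xy: "set x \<subseteq> V" "set y \<subseteq> V"
      let ?e = "\<epsilon>' * K\<^sub>1 * (X.len x + X.len y) + C"
      have e: "?\<theta> (p x) (p y) \<le> ?e" using C(2) \<epsilon>' xy by (rule \<theta>_word)
      have e0: "0 \<le> ?e + 2" using C(1) \<epsilon>' K\<^sub>1(1) by simp
      have Le: "L' * (?e + 2) = \<epsilon> * (X.len x + X.len y) + L' * (C + 2)"
        using L' K\<^sub>1(1) by (simp add: \<epsilon>'_def field_simps)
      have "dB (\<Phi> (p x)) (\<Phi> (p y)) \<le> L * dA (p x) (p y) + ?e"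
        using \<Phi>_upper[OF pA[OF xy(1)] pA[OF xy(2)]] e by linarith
      also have "L * dA (p x) (p y) \<le> L * (K\<^sub>1 * X.dist x y)"
        using K\<^sub>1(2)[OF xy] L by (intro mult_left_mono) auto
      finally have "dB (q (\<phi> x)) (q (\<phi> y)) \<le> L * (K\<^sub>1 * X.dist x y) + (?e + 2)"
        using close[OF xy] by linarith
      then have "K\<^sub>2 * dB (q (\<phi> x)) (q (\<phi> y)) \<le> K\<^sub>2 * (L * (K\<^sub>1 * X.dist x y) + (?e + 2))"
        using K\<^sub>2(1) by (intro mult_left_mono) auto
      also have "\<dots> = L' * X.dist x y + K\<^sub>2 * (?e + 2)" by (simp add: L'_def algebra_simps)
      also have "\<dots> \<le> L' * X.dist x y + L' * (?e + 2)"
        using L'(2) e0 by (intro add_left_mono mult_right_mono)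
      finally have 1: "Y.dist (\<phi> x) (\<phi> y) \<le> L' * X.dist x y + L' * (?e + 2)"
        using K\<^sub>2(3)[OF \<phi>(1)[OF xy(1)] \<phi>(1)[OF xy(2)]] by linarith
      have "dA (p x) (p y) / L \<le> dB (\<Phi> (p x)) (\<Phi> (p y)) + ?e"
        using \<Phi>_lower[OF pA[OF xy(1)] pA[OF xy(2)]] e by simp
      also have "dB (\<Phi> (p x)) (\<Phi> (p y)) \<le> K\<^sub>2 * Y.dist (\<phi> x) (\<phi> y) + 2"
        using close[OF xy] K\<^sub>2(2)[OF \<phi>(1)[OF xy(1)] \<phi>(1)[OF xy(2)]] by linarith
      finally have "dA (p x) (p y) / L \<le> K\<^sub>2 * Y.dist (\<phi> x) (\<phi> y) + (?e + 2)" by simp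
      then have "dA (p x) (p y) \<le> L * (K\<^sub>2 * Y.dist (\<phi> x) (\<phi> y) + (?e + 2))"
        using L by (simp add: field_simps)
      then have "K\<^sub>1 * dA (p x) (p y) \<le> K\<^sub>1 * (L * (K\<^sub>2 * Y.dist (\<phi> x) (\<phi> y) + (?e + 2)))"
        using K\<^sub>1(1) by (intro mult_left_mono) auto
      also have "\<dots> = L' * Y.dist (\<phi> x) (\<phi> y) + K\<^sub>1 * L * (?e + 2)" by (simp add: L'_def algebra_simps)
      also have "\<dots> \<le> L' * Y.dist (\<phi> x) (\<phi> y) + L' * (?e + 2)"
        using L'(3) e0 by (intro add_left_mono mult_right_mono)
      finally have 2: "X.dist x y \<le> L' * Y.dist (\<phi> x) (\<phi> y) + L' * (?e + 2)"
        using K\<^sub>1(3)[OF xy] by linarith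
      show "Y.dist (\<phi> x) (\<phi> y) \<le> L' * X.dist x y + \<epsilon> * (X.len x + X.len y) + L' * (C + 2) \<and>
        X.dist x y \<le> L' * Y.dist (\<phi> x) (\<phi> y) + \<epsilon> * (X.len x + X.len y) + L' * (C + 2)"
        using 1 2 unfolding Le by linarith
    qed
  next
    fix \<epsilon> :: real assume \<epsilon>: "\<epsilon> > 0"
    \<comment> \<open>The number \<open>N - 1\<close> collects the factors of
      \<open>\<epsilon>' * Y.len y\<close>: \<open>D * K\<^sub>2\<close> from the approximation of
      \<open>q y\<close>, the other summand from the length of the preimage, both times
      \<open>K\<^sub>2\<close>.\<close>
    define N where "N = K\<^sub>2 * (D * K\<^sub>2 + 2 * L * (D * K\<^sub>2 + K\<^sub>2)) + 1"
    have N: "N \<ge> 1" using D(1) K\<^sub>2(1) L by (simp add: N_def)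
    define \<epsilon>' where "\<epsilon>' = \<epsilon> / N"
    have \<epsilon>': "\<epsilon>' > 0" using \<epsilon> N by (simp add: \<epsilon>'_def)
    have half: "1 / (2 * L) > 0" using L by simp
    obtain C where C: "0 \<le> C" "\<And>r. 0 \<le> r \<Longrightarrow> \<theta> r \<le> \<epsilon>' * r + C"
      using sublinear_gauge_bound[OF \<theta> \<epsilon>'] by metis
    obtain C\<^sub>1 where C\<^sub>1: "0 \<le> C\<^sub>1" "\<And>r. 0 \<le> r \<Longrightarrow> \<theta> r \<le> 1 * r + C\<^sub>1"
      using sublinear_gauge_bound[OF \<theta>, of 1] by (metis zero_less_one)
    obtain C\<^sub>2 where C\<^sub>2: "0 \<le> C\<^sub>2" "\<And>r. 0 \<le> r \<Longrightarrow> \<theta> r \<le> 1 / (2 * L) * r + C\<^sub>2"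
      using sublinear_gauge_bound[OF \<theta> half] by metis
    define c where "c = dB (q []) (\<Phi> (p []))"
    define H where "H = 2 * L * (D * C\<^sub>1 + 1 + c + C\<^sub>2)"
    define H' where "H' = K\<^sub>2 * (D * C + \<epsilon>' * (H + 1) + C + L + 2)"
    show "\<exists>C. \<forall>y. set y \<subseteq> W \<longrightarrow> (\<exists>x. set x \<subseteq> V \<and> Y.dist y (\<phi> x) \<le> \<epsilon> * Y.len y + C)"
    proof (intro exI[of _ H'] allI impI)
      fix y assume y: "set y \<subseteq> W"
      let ?r = "dB (q y) (q [])"
      have r: "0 \<le> ?r" "?r \<le> K\<^sub>2 * Y.len y" using K\<^sub>2(2)[OF y, of "[]"] by auto
      have "(INF x\<in>A. dB (q y) (\<Phi> x)) < D * \<theta> ?r + 1" using D(2)[OF qB[OF y]] by simp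
      moreover have "A \<noteq> {}" using pA[of "[]"] by auto
      ultimately obtain x\<^sub>0 where x\<^sub>0: "x\<^sub>0 \<in> A" "dB (q y) (\<Phi> x\<^sub>0) < D * \<theta> ?r + 1"
        using cInf_lessD[of "(\<lambda>x. dB (q y) (\<Phi> x)) ` A"] by auto
      define x where "x = near x\<^sub>0"
      have x: "set x \<subseteq> V" "dA x\<^sub>0 (p x) \<le> 1" using near[OF x\<^sub>0(1)] by (simp_all add: x_def)
      let ?s = "dA x\<^sub>0 (p [])"
      have mem: "p [] \<in> A" "p x \<in> A" "q [] \<in> B" "q y \<in> B" "\<Phi> x\<^sub>0 \<in> B" "\<Phi> (p []) \<in> B" "\<Phi> (p x) \<in> B" "q (\<phi> x) \<in> B"
        using pA qB \<Phi>_mem x\<^sub>0 x y \<phi> by auto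
      \<comment> \<open>Before the error at \<open>x\<^sub>0\<close> can be used, the distance of
        \<open>x\<^sub>0\<close> from the base point is bounded; \<open>C\<^sub>2\<close> belongs to
        a slope at which half of \<open>?s / L\<close> survives.\<close>
      have "?s / L \<le> dB (\<Phi> x\<^sub>0) (\<Phi> (p [])) + \<theta> ?s"
        using \<Phi>_lower[OF x\<^sub>0(1) mem(1)] A.nonneg[of x\<^sub>0 "p []"] mem(1) by simp
      moreover have "\<theta> ?s \<le> ?s / (2 * L) + C\<^sub>2" using C\<^sub>2(2)[of ?s] by simp
      moreover have "?s / L = ?s / (2 * L) + ?s / (2 * L)" using L by (simp add: field_simps)
      moreover have "dB (\<Phi> x\<^sub>0) (\<Phi> (p [])) \<le> dB (q y) (\<Phi> x\<^sub>0) + ?r + c"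
        using B.triangle[OF mem(5,4,6)] B.triangle[OF mem(4,3,6)] B.commute[of "\<Phi> x\<^sub>0" "q y"]
        unfolding c_def by linarith
      moreover have D\<theta>: "D * \<theta> ?r \<le> D * (?r + C\<^sub>1)" using C\<^sub>1(2)[of ?r] D(1) by (intro mult_left_mono) auto
      ultimately have "?s / (2 * L) \<le> D * (?r + C\<^sub>1) + 1 + ?r + c + C\<^sub>2" using x\<^sub>0(2) by linarith
      then have "?s \<le> 2 * L * (D * (?r + C\<^sub>1) + 1 + ?r + c + C\<^sub>2)" using L by (simp add: field_simps)
      also have "\<dots> = 2 * L * (D + 1) * ?r + H" by (simp add: H_def algebra_simps)
      also have "\<dots> \<le> 2 * L * (D + 1) * (K\<^sub>2 * Y.len y) + H"
        using r L D(1) by (intro add_right_mono mult_left_mono) auto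
      finally have s: "?s \<le> 2 * L * (D * K\<^sub>2 + K\<^sub>2) * Y.len y + H" by (simp add: algebra_simps)
      have "max ?s (dA (p x) (p [])) \<le> ?s + 1"
        using A.triangle[OF mem(2) x\<^sub>0(1) mem(1)] x(2) A.commute[of x\<^sub>0 "p x"] by simp
      then have "\<epsilon>' * max ?s (dA (p x) (p [])) \<le> \<epsilon>' * (2 * L * (D * K\<^sub>2 + K\<^sub>2) * Y.len y + H + 1)"
        using s \<epsilon>' by (intro mult_left_mono) auto
      moreover have "?\<theta> x\<^sub>0 (p x) \<le> \<epsilon>' * max ?s (dA (p x) (p [])) + C"
        by (intro C(2)) (simp add: le_max_iff_disj)
      moreover have "L * dA x\<^sub>0 (p x) \<le> L" using x(2) L by simp
      ultimately have 1: "dB (\<Phi> x\<^sub>0) (\<Phi> (p x)) \<le> L + \<epsilon>' * (2 * L * (D * K\<^sub>2 + K\<^sub>2) * Y.len y + H + 1) + C"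
        using \<Phi>_upper[OF x\<^sub>0(1) mem(2)] by linarith
      have "D * \<theta> ?r \<le> D * (\<epsilon>' * (K\<^sub>2 * Y.len y) + C)"
      proof (intro mult_left_mono D(1))
        have "\<epsilon>' * ?r \<le> \<epsilon>' * (K\<^sub>2 * Y.len y)" using r \<epsilon>' by (intro mult_left_mono) auto
        then show "\<theta> ?r \<le> \<epsilon>' * (K\<^sub>2 * Y.len y) + C" using C(2)[of ?r] by simp
      qed
      moreover have "dB (q y) (q (\<phi> x)) \<le> dB (q y) (\<Phi> x\<^sub>0) + dB (\<Phi> x\<^sub>0) (\<Phi> (p x)) + 1"
        using B.triangle[OF mem(4,5,8)] B.triangle[OF mem(5,7,8)] \<phi>(2)[OF x(1)] by linarith
      ultimately have "dB (q y) (q (\<phi> x)) \<le> D * (\<epsilon>' * (K\<^sub>2 * Y.len y) + C) + 1 +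
          (L + \<epsilon>' * (2 * L * (D * K\<^sub>2 + K\<^sub>2) * Y.len y + H + 1) + C) + 1"
        using 1 x\<^sub>0(2) by linarith
      then have "K\<^sub>2 * dB (q y) (q (\<phi> x)) \<le> K\<^sub>2 * (D * (\<epsilon>' * (K\<^sub>2 * Y.len y) + C) + 1 +
          (L + \<epsilon>' * (2 * L * (D * K\<^sub>2 + K\<^sub>2) * Y.len y + H + 1) + C) + 1)"
        using K\<^sub>2(1) by (intro mult_left_mono) auto
      also have "\<dots> = \<epsilon>' * (N - 1) * Y.len y + H'"
        by (simp add: N_def H'_def algebra_simps)
      also have "\<epsilon>' * (N - 1) * Y.len y \<le> \<epsilon> * Y.len y"
        using N \<epsilon> by (intro mult_right_mono) (auto simp: \<epsilon>'_def field_simps)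
      finally have "Y.dist y (\<phi> x) \<le> \<epsilon> * Y.len y + H'"
        using K\<^sub>2(3)[OF y \<phi>(1)[OF x(1)]] by linarith
      then show "\<exists>x. set x \<subseteq> V \<and> Y.dist y (\<phi> x) \<le> \<epsilon> * Y.len y + H'" using x(1) by blast
    qed
  qed
  then show ?thesis by blast
qed

section \<open>The two defining graphs\<close>

lemma edge_E13_iff: "{(c, i), (c', j)} \<in> E13 \<longleftrightarrow> i \<in> {1..13} \<and> j \<in> {1..13} \<and> \<bar>int i - int j\<bar> = 1"
  unfolding E13_def by (auto simp: doubleton_eq_iff)

lemma star_E13_iff:
  "(c', j) \<in> racg_words.star E13 (c, i) \<longleftrightarrow>
     c' = c \<and> j = i \<or> i \<in> {1..13} \<and> j \<in> {1..13} \<and> \<bar>int i - int j\<bar> = 1"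
  by (auto simp: racg_words.star_def edge_E13_iff)

lemma edge_C5_iff: "{(c, i), (c', j)} \<in> C5 \<longleftrightarrow> c = SideA \<and> c' = SideA \<and>
    (i, j) \<in> {(1, 4), (4, 1), (4, 7), (7, 4), (7, 10), (10, 7), (10, 13), (13, 10), (13, 1), (1, 13)}"
  unfolding C5_def by (auto simp: doubleton_eq_iff)

lemma star_Gamma_iff:
  "(c', j) \<in> racg_words.star (E13 \<union> C5) (c, i) \<longleftrightarrow>
     c' = c \<and> j = i \<or> i \<in> {1..13} \<and> j \<in> {1..13} \<and> \<bar>int i - int j\<bar> = 1 \<or> c = SideA \<and> c' = SideA \<and>
    (i, j) \<in> {(1, 4), (4, 1), (4, 7), (7, 4), (7, 10), (10, 7), (10, 13), (13, 10), (13, 1), (1, 13)}"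
  by (auto simp: racg_words.star_def edge_E13_iff edge_C5_iff)

definition pentagon :: "(side \<times> nat) set" where
  "pentagon = {SideA} \<times> {1, 4, 7, 10, 13}"

text \<open>The neighbours of \<open>a_i\<close> in \<open>E13\<close> have index
  \<open>i - 1\<close> or \<open>i + 1\<close>, and the indices of the pentagon are at least 3
  apart. So the new edges alone produce common neighbours, and in a 5-cycle two non-adjacent
  vertices have just one.\<close>

lemma pentagon_narrow:
  "\<forall>s\<in>pentagon. \<forall>s'\<in>pentagon - racg_words.star (E13 \<union> C5) s.
    \<exists>t. racg_words.star (E13 \<union> C5) s \<inter> racg_words.star (E13 \<union> C5) s' \<subseteq> {t}"
proof -
  let ?star = "racg_words.star (E13 \<union> C5)"
  have "?star (SideA, 1) \<inter> ?star (SideA, 7) \<subseteq> {(SideA, 4)}"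
    "?star (SideA, 1) \<inter> ?star (SideA, 10) \<subseteq> {(SideA, 13)}"
    "?star (SideA, 4) \<inter> ?star (SideA, 10) \<subseteq> {(SideA, 7)}"
    "?star (SideA, 4) \<inter> ?star (SideA, 13) \<subseteq> {(SideA, 1)}"
    "?star (SideA, 7) \<inter> ?star (SideA, 13) \<subseteq> {(SideA, 10)}"
    by (auto simp: star_Gamma_iff)
  moreover from this have "?star (SideA, 7) \<inter> ?star (SideA, 1) \<subseteq> {(SideA, 4)}"
    "?star (SideA, 10) \<inter> ?star (SideA, 1) \<subseteq> {(SideA, 13)}"
    "?star (SideA, 10) \<inter> ?star (SideA, 4) \<subseteq> {(SideA, 7)}"
    "?star (SideA, 13) \<inter> ?star (SideA, 4) \<subseteq> {(SideA, 1)}"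
    "?star (SideA, 13) \<inter> ?star (SideA, 7) \<subseteq> {(SideA, 10)}" by (simp_all only: Int_commute)
  ultimately show ?thesis
    unfolding pentagon_def by (auto simp: star_Gamma_iff simp del: Int_iff)
qed

text \<open>Either the short route through \<open>t\<close> avoids the clique \<open>D\<close>, or
  \<open>t\<close> is in \<open>D\<close>; then \<open>x\<close> and \<open>x'\<close> are not,
  because they are not adjacent to \<open>t\<close>.\<close>

lemma cycle_route:
  assumes D: "\<And>a b. a \<in> D \<Longrightarrow> b \<in> D \<Longrightarrow> b \<in> racg_words.star E a"
    and s: "s \<in> P - D" "s' \<in> P - D" and mem: "t \<in> P" "x \<in> P" "x' \<in> P"
    and edges: "{s, t} \<in> E" "{t, s'} \<in> E" "{s, x} \<in> E" "{x, x'} \<in> E" "{x', s'} \<in> E"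
    and non: "x \<notin> racg_words.star E t" "x' \<notin> racg_words.star E t"
  shows "(s, s') \<in> {(a, b). a \<in> P - D \<and> b \<in> P - D \<and> {a, b} \<in> E}\<^sup>*"
    "(s', s) \<in> {(a, b). a \<in> P - D \<and> b \<in> P - D \<and> {a, b} \<in> E}\<^sup>*"
proof -
  let ?R = "{(a, b). a \<in> P - D \<and> b \<in> P - D \<and> {a, b} \<in> E}"
  show 1: "(s, s') \<in> ?R\<^sup>*"
  proof (cases "t \<in> D")
    case True
    then have "x \<notin> D" "x' \<notin> D" using D non by blast+
    then have "(s, x) \<in> ?R" "(x, x') \<in> ?R" "(x', s') \<in> ?R" using s mem edges by auto
    then show ?thesis by (meson converse_rtrancl_into_rtrancl rtrancl.rtrancl_refl)
  next
    case False
    then have "(s, t) \<in> ?R" "(t, s') \<in> ?R" using s mem edges by auto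
    then show ?thesis by (meson converse_rtrancl_into_rtrancl rtrancl.rtrancl_refl)
  qed
  have "sym (?R\<^sup>*)" by (rule sym_rtrancl) (auto simp: sym_def insert_commute)
  then show "(s', s) \<in> ?R\<^sup>*" using 1 by (rule symD)
qed

lemma pentagon_connected:
  assumes D: "\<And>a b. a \<in> D \<Longrightarrow> b \<in> D \<Longrightarrow> b \<in> racg_words.star (E13 \<union> C5) a"
    and s: "s \<in> pentagon - D" "s' \<in> pentagon - D"
  shows "(s, s') \<in> {(a, b). a \<in> pentagon - D \<and> b \<in> pentagon - D \<and> {a, b} \<in> E13 \<union> C5}\<^sup>*"
    (is "_ \<in> ?R\<^sup>*")
proof (cases "s = s' \<or> {s, s'} \<in> E13 \<union> C5")
  case True
  then show ?thesis using s by auto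
next
  case False
  obtain i j where ij: "s = (SideA, i)" "s' = (SideA, j)" "i \<in> {1, 4, 7, 10, 13}" "j \<in> {1, 4, 7, 10, 13}"
    using s by (auto simp: pentagon_def)
  have "i \<noteq> j" "{(SideA, i), (SideA, j)} \<notin> C5" using False ij by auto
  then have "(i, j) \<in> {(1, 7), (7, 1), (1, 10), (10, 1), (4, 10), (10, 4), (4, 13), (13, 4), (7, 13), (13, 7)}"
    using ij(3,4) unfolding edge_C5_iff by auto
  \<comment> \<open>The entries are two non-adjacent vertices \<open>i\<close>, \<open>j\<close>,
    their common neighbour \<open>k\<close>, and the two vertices \<open>l\<close>, \<open>m\<close>
    of the other arc from \<open>i\<close> to \<open>j\<close>.\<close>
  moreover have "((SideA, i), (SideA, j)) \<in> ?R\<^sup>* \<and> ((SideA, j), (SideA, i)) \<in> ?R\<^sup>*"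
    if ijk: "(i, j, k, l, m) \<in> {(1, 7, 4, 13, 10), (1, 10, 13, 4, 7), (4, 10, 7, 1, 13), (4, 13, 1, 7, 10),
        (7, 13, 10, 4, 1)}" and D': "(SideA, i) \<notin> D" "(SideA, j) \<notin> D" for i j k l m :: nat
  proof -
    have mem: "(SideA, k) \<in> pentagon" "(SideA, l) \<in> pentagon" "(SideA, m) \<in> pentagon"
      and ends: "(SideA, i) \<in> pentagon - D" "(SideA, j) \<in> pentagon - D"
      using ijk D' by (auto simp: pentagon_def)
    have edges: "{(SideA, i), (SideA, k)} \<in> E13 \<union> C5" "{(SideA, k), (SideA, j)} \<in> E13 \<union> C5"
      "{(SideA, i), (SideA, l)} \<in> E13 \<union> C5" "{(SideA, l), (SideA, m)} \<in> E13 \<union> C5"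
      "{(SideA, m), (SideA, j)} \<in> E13 \<union> C5"
      using ijk by (auto simp: edge_C5_iff)
    have non: "(SideA, l) \<notin> racg_words.star (E13 \<union> C5) (SideA, k)"
      "(SideA, m) \<notin> racg_words.star (E13 \<union> C5) (SideA, k)"
      using ijk by (auto simp: star_Gamma_iff)
    show ?thesis
      using cycle_route[of D "E13 \<union> C5", OF D ends mem edges non] by blast
  qed
  ultimately show ?thesis using s ij(1,2) by (elim insertE emptyE) auto
qed

theorem proposition4p7:
  shows "\<not> sublinear_biLipschitz_equivalent W_Gamma W_Gamma13"
proof
  assume "sublinear_biLipschitz_equivalent W_Gamma W_Gamma13"
  moreover have "finite V13"
  proof -
    have "(UNIV :: side set) = {SideA, SideB}" using side.exhaust by auto
    then have "finite (UNIV :: side set)" by (metis finite.emptyI finite.insertI)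
    then show ?thesis by (auto simp: V13_def)
  qed
  ultimately obtain \<phi> L where "coarse_map (E13 \<union> C5) E13 V13 V13 \<phi> L"
    using sublinear_biLipschitz_imp_coarse_map[of V13 V13 "E13 \<union> C5" E13]
    unfolding W_Gamma_def W_Gamma13_def by blast
  then interpret coarse_map "E13 \<union> C5" E13 V13 V13 \<phi> L .
  show False
  proof (rule impossible[of pentagon "(SideA, 1)" "(SideA, 7)"])
    show "finite pentagon" "pentagon \<subseteq> V13" "(SideA, 1) \<in> pentagon" "(SideA, 7) \<in> pentagon"
      by (auto simp: pentagon_def V13_def)
    show "(SideA, 7) \<notin> X.star (SideA, 1)" by (simp add: star_Gamma_iff)
    show "\<forall>s\<in>pentagon. \<forall>s'\<in>pentagon - X.star s. \<exists>t. X.star s \<inter> X.star s' \<subseteq> {t}"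
      by (rule pentagon_narrow)
    show "(s, s') \<in> {(a, b). a \<in> pentagon - D \<and> b \<in> pentagon - D \<and> {a, b} \<in> E13 \<union> C5}\<^sup>*"
      if "D \<subseteq> pentagon" "\<And>a b. a \<in> D \<Longrightarrow> b \<in> D \<Longrightarrow> b \<in> X.star a" "s \<in> pentagon - D" "s' \<in> pentagon - D" for D s s'
      using that(2-) by (rule pentagon_connected)
    show "\<exists>s'\<in>V13. s' \<notin> Y.star s \<and> Y.star s - {s} \<subseteq> Y.star s' - {s'}" if sV: "s \<in> V13" for s
    proof -
      obtain c i where s: "s = (c, i)" "i \<in> {1..13}" using sV by (auto simp: V13_def)
      obtain c' where "c' \<noteq> c" by (metis side.distinct(1) side.exhaust)
      then show ?thesis using s
        by (intro bexI[of _ "(c', i)"]) (auto simp: V13_def star_E13_iff)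
    qed
    show "Y.star s \<subseteq> V13" if "s \<in> V13" for s
      using that by (cases s) (auto simp: V13_def star_E13_iff)
  qed
qed

end
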